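(* The algebra $\mathcal B_1$ may be identified with the algebra $C(\widetilde M_1)$ of continuous functions on $\widetilde M_1=\varprojlim([0,1],\alpha_1)$, which is (homeomorphic to) the Brouwer–Janiszewski–Knaster continuum. Under this identification the automorphism $\delta_1:\mathcal B_1\to\mathcal B_1$, $\delta_1(b)=U_1bU_1^*$, becomes the operator of composition with the homeomorphism $\widetilde\alpha_1:\widetilde M_1\to\widetilde M_1$ induced by $\alpha_1$, which in the parametrization $\rho:[0,\infty)\to\widetilde M_1$ of the composant of the point $(0,0,0,\dots)$ assumes the form $\widetilde\alpha_1(\rho(t))=\rho(g(t))$, where $$g(t)=\begin{cases}2k+\alpha_1(\{t\}), & t\in[k,k+\frac12),\\ 2(k+1)-\alpha_1(\{t\}), & t\in[k+\frac12,k+1),\end{cases}\qquad k=0,1,2,\dots$$ Furthermore, the irreducibility of $\widetilde M_1$ expresses as the following property of $\mathcal B_1$: if $I_1,I_2$ are (closed) ideals in $\mathcal B_1$ such that $\mathcal B_1/I_i$, $i=1,2$, does not contain non-trivial idempotents, then $$I_1\cap I_2=\{0\}\ \Longrightarrow\ I_1=\{0\}\ \text{ or }\ I_2=\{0\}.$$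
   Context: $\mathbb N=\{0,1,2,\dots\}$; $\{t\}$ is the fractional part of $t$. $\alpha_1:[0,1]\to[0,1]$, $\alpha_1(x)=4x(1-x)$. $\varprojlim([0,1],\alpha_1)=\{(x_0,x_1,\dots)\in[0,1]^{\mathbb N}:\alpha_1(x_{n+1})=x_n\}$ with the product topology; the induced homeomorphism is $\widetilde\alpha_1(x_0,x_1,\dots)=(\alpha_1(x_0),x_0,x_1,\dots)$. $\mathcal A\subset L(L^2(\mathbb R))$ is the $C^*$-algebra of operators of multiplication by functions $a$ on $\mathbb R$ with $a(t+1)=a(t)$, $a|_{[0,1)}$ continuous, and $\lim_{t\to1^-}a(t)$ existing. Define $\gamma_1(t)=4\{t\}(1-\{t\})+2k$ for $t\in[k,k+\frac12]$ and $\gamma_1(t)=4\{t\}(1-\{t\})+2k+1$ for $t\in(k+\frac12,k+1)$, $k\in\mathbb Z$; $(U_1f)(t)=\sqrt{|\gamma_1'(t)|}f(\gamma_1(t))$, $f\in L^2(\mathbb R)$ (a unitary operator); $\mathcal B_1=C^*\big(\bigcup_{n\in\mathbb N}U_1^{*n}\mathcal AU_1^n\big)$, a commutative unital $C^*$-algebra. The Brouwer–Janiszewski–Knaster (buckethandle) continuum: with $C$ the ternary Cantor set on the $x$-axis of the plane, it is the union of all closed upper half-circles centred at $(\frac12,0)$ with endpoints in $C$ and, for every $n\ge1$, all closed lower half-circles centred at $(\frac{5}{2\cdot3^n},0)$ with endpoints in $C\cap[\frac{2}{3^n},\frac{1}{3^{n-1}}]$. Parametrization $\rho$: let $s(u)=\mathrm{dist}(u,2\mathbb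 Z)$ and $h(y)=\sin^2(\pi y/2)$, so that $h\circ\alpha_T=\alpha_1\circ h$ for the tent map $\alpha_T(x)=1-|2x-1|$. For $t\in[k,k+1]$, $k\in\mathbb N$, $\rho(t)$ is the unique point of the arc $\{(h(s(u)),h(s(u/2)),h(s(u/4)),\dots):u\in[k,k+1]\}\subset\varprojlim([0,1],\alpha_1)$ whose zeroth coordinate is $s(t)$. (For the tent map the corresponding parametrization $u\mapsto(s(u),s(u/2),\dots)$ turns the induced homeomorphism into $u\mapsto2u$.) A continuum (connected compact metric space) is irreducible if it has more than one point and is not the union of two proper subcontinua. *)

theory Defs
  imports "HOL-Analysis.Analysis" "HOL-Algebra.QuotRing" "HOL-Algebra.Module"
begin

section \<open>The complex Hilbert space $L^2(\mathbb{R})$\<close>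

definition square_integrable :: "(real \<Rightarrow> complex) \<Rightarrow> bool" where
  "square_integrable f \<longleftrightarrow>
     f \<in> borel_measurable lborel \<and> integrable lborel (\<lambda>t. (cmod (f t))\<^sup>2)"

lemma square_integrable_mult:
  assumes "square_integrable f" "square_integrable g"
  shows "integrable lborel (\<lambda>t. f t * cnj (g t))"
proof (rule Bochner_Integration.integrable_bound)
  show "integrable lborel (\<lambda>t. (cmod (f t))\<^sup>2 + (cmod (g t))\<^sup>2)"
    using assms by (auto simp: square_integrable_def)
  have [measurable]: "f \<in> borel_measurable borel" "g \<in> borel_measurable borel"
    using assms by (auto simp: square_integrable_def)
  show "(\<lambda>t. f t * cnj (g t)) \<in> borel_measurable lborel"
    using measurable_compose[of g borel borel cnj] borel_measurable_continuous_onI[of cnj]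
    by (simp add: continuous_on_cnj borel_measurable_times)
  have "cmod (f t) * cmod (g t) \<le> (cmod (f t))\<^sup>2 + (cmod (g t))\<^sup>2" for t
    using sum_squares_bound[of "cmod (f t)" "cmod (g t)"]
      mult_nonneg_nonneg[OF norm_ge_zero[of "f t"] norm_ge_zero[of "g t"]] by linarith
  then show "AE t in lborel. norm (f t * cnj (g t)) \<le> norm ((cmod (f t))\<^sup>2 + (cmod (g t))\<^sup>2)"
    by (simp add: norm_mult)
qed

lemma square_integrable_add:
  assumes "square_integrable f" "square_integrable g"
  shows "square_integrable (\<lambda>t. f t + g t)"
  unfolding square_integrable_def
proof
  have [measurable]: "f \<in> borel_measurable borel" "g \<in> borel_measurable borel"
    using assms by (auto simp: square_integrable_def)
  show "(\<lambda>t. f t + g t) \<in> borel_measurable lborel" by simp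
  show "integrable lborel (\<lambda>t. (cmod (f t + g t))\<^sup>2)"
  proof (rule Bochner_Integration.integrable_bound)
    show "integrable lborel (\<lambda>t. 2 * (cmod (f t))\<^sup>2 + 2 * (cmod (g t))\<^sup>2)"
      using assms by (auto simp: square_integrable_def)
    show "(\<lambda>t. (cmod (f t + g t))\<^sup>2) \<in> borel_measurable lborel" by simp
    have "(cmod (f t + g t))\<^sup>2 \<le> 2 * (cmod (f t))\<^sup>2 + 2 * (cmod (g t))\<^sup>2" for t
    proof -
      have "(cmod (f t + g t))\<^sup>2 \<le> (cmod (f t) + cmod (g t))\<^sup>2"
        by (simp add: norm_triangle_ineq power_mono)
      then show ?thesis
        using sum_squares_bound[of "cmod (f t)" "cmod (g t)"]
        by (simp add: power2_sum)
    qed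
    then show "AE t in lborel. norm ((cmod (f t + g t))\<^sup>2)
        \<le> norm (2 * (cmod (f t))\<^sup>2 + 2 * (cmod (g t))\<^sup>2)"
      by simp
  qed
qed

lemma square_integrable_scale:
  "square_integrable f \<Longrightarrow> square_integrable (\<lambda>t. c * f t)"
  by (auto simp: square_integrable_def norm_mult power_mult_distrib)

lemma square_integrable_zero: "square_integrable (\<lambda>t. 0)"
  by (simp add: square_integrable_def)

definition ae_eq :: "(real \<Rightarrow> complex) \<Rightarrow> (real \<Rightarrow> complex) \<Rightarrow> bool" where
  "ae_eq f g \<longleftrightarrow>
     square_integrable f \<and> square_integrable g \<and> (AE t in lborel. f t = g t)"

quotient_type L2 = "real \<Rightarrow> complex" / partial: ae_eq
proof (rule part_equivpI)
  show "\<exists>f. ae_eq f f"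
    by (rule exI[of _ "\<lambda>t. 0"]) (simp add: ae_eq_def square_integrable_zero)
  show "symp ae_eq"
    by (rule sympI) (auto simp: ae_eq_def elim!: eventually_mono)
  show "transp ae_eq"
  proof (rule transpI)
    fix f g h assume "ae_eq f g" "ae_eq g h"
    then have ae: "AE t in lborel. f t = g t" "AE t in lborel. g t = h t"
      and *: "square_integrable f" "square_integrable h"
      by (simp_all add: ae_eq_def)
    from ae have "AE t in lborel. f t = h t"
      by eventually_elim simp
    with * show "ae_eq f h"
      by (simp add: ae_eq_def)
  qed
qed

lift_definition scaleC_L2 :: "complex \<Rightarrow> L2 \<Rightarrow> L2" is "\<lambda>c f t. c * f t"
  by (auto simp: ae_eq_def square_integrable_scale elim!: eventually_mono)

lift_definition cinner_L2 :: "L2 \<Rightarrow> L2 \<Rightarrow> complex" is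
  "\<lambda>f g. integral\<^sup>L lborel (\<lambda>t. f t * cnj (g t))"
proof -
  fix f f' g g' assume "ae_eq f f'" "ae_eq g g'"
  then have m: "integrable lborel (\<lambda>t. f t * cnj (g t))" "integrable lborel (\<lambda>t. f' t * cnj (g' t))"
    and ae: "AE t in lborel. f t = f' t" "AE t in lborel. g t = g' t"
    by (simp_all add: ae_eq_def square_integrable_mult)
  show "integral\<^sup>L lborel (\<lambda>t. f t * cnj (g t)) = integral\<^sup>L lborel (\<lambda>t. f' t * cnj (g' t))"
  proof (rule integral_cong_AE)
    show "(\<lambda>t. f t * cnj (g t)) \<in> borel_measurable lborel"
      "(\<lambda>t. f' t * cnj (g' t)) \<in> borel_measurable lborel"
      using m by (simp_all only: borel_measurable_integrable)
    show "AE t in lborel. f t * cnj (g t) = f' t * cnj (g' t)"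
      using ae by eventually_elim simp
  qed
qed

instantiation L2 :: real_vector
begin

lift_definition zero_L2 :: L2 is "\<lambda>t. 0"
  by (simp add: ae_eq_def square_integrable_zero)

lift_definition plus_L2 :: "L2 \<Rightarrow> L2 \<Rightarrow> L2" is "\<lambda>f g t. f t + g t"
proof -
  fix f f' g g' assume *: "ae_eq f f'" "ae_eq g g'"
  then have "AE t in lborel. f t = f' t" "AE t in lborel. g t = g' t"
    by (simp_all add: ae_eq_def)
  then have "AE t in lborel. f t + g t = f' t + g' t"
    by eventually_elim simp
  with * show "ae_eq (\<lambda>t. f t + g t) (\<lambda>t. f' t + g' t)"
    by (simp add: ae_eq_def square_integrable_add)
qed

definition uminus_L2 :: "L2 \<Rightarrow> L2" where "uminus_L2 f = scaleC_L2 (- 1) f"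
definition minus_L2 :: "L2 \<Rightarrow> L2 \<Rightarrow> L2" where "minus_L2 f g = f + scaleC_L2 (- 1) g"
definition scaleR_L2 :: "real \<Rightarrow> L2 \<Rightarrow> L2" where "scaleR_L2 r f = scaleC_L2 (of_real r) f"

instance
proof
  have refl: "ae_eq h h'" if "square_integrable h" "h = h'" for h h'
    using that by (simp add: ae_eq_def)
  note intros = refl square_integrable_add square_integrable_scale square_integrable_zero
  fix f g h :: L2 and r s :: real
  show "f + g + h = f + (g + h)"
    by transfer (intro intros ext; simp add: ae_eq_def algebra_simps)
  show "f + g = g + f"
    by transfer (intro intros ext; simp add: ae_eq_def algebra_simps)
  show "0 + f = f"
    by transfer (simp add: ae_eq_def)
  show "- f + f = 0"
    unfolding uminus_L2_def by transfer (simp add: ae_eq_def square_integrable_zero)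
  show "f - g = f + - g"
    by (simp add: minus_L2_def uminus_L2_def)
  show "r *\<^sub>R (f + g) = r *\<^sub>R f + r *\<^sub>R g"
    unfolding scaleR_L2_def
    by transfer (intro intros ext; simp add: ae_eq_def algebra_simps)
  show "(r + s) *\<^sub>R f = r *\<^sub>R f + s *\<^sub>R f"
    unfolding scaleR_L2_def
    by transfer (intro intros ext; simp add: ae_eq_def algebra_simps)
  show "r *\<^sub>R s *\<^sub>R f = (r * s) *\<^sub>R f"
    unfolding scaleR_L2_def
    by transfer (intro intros ext; simp add: ae_eq_def algebra_simps)
  show "1 *\<^sub>R f = f"
    unfolding scaleR_L2_def by transfer (simp add: ae_eq_def)
qed

end

instantiation L2 :: real_inner
begin

definition inner_L2 :: "L2 \<Rightarrow> L2 \<Rightarrow> real" where "inner_L2 f g = Re (cinner_L2 f g)"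
definition norm_L2 :: "L2 \<Rightarrow> real" where "norm_L2 f = sqrt (Re (cinner_L2 f f))"
definition dist_L2 :: "L2 \<Rightarrow> L2 \<Rightarrow> real" where "dist_L2 f g = norm (f - g)"
definition sgn_L2 :: "L2 \<Rightarrow> L2" where "sgn_L2 f = f /\<^sub>R norm f"
definition uniformity_L2 :: "(L2 \<times> L2) filter" where
  "uniformity_L2 = (INF e\<in>{0<..}. principal {(x, y). dist x y < e})"
definition open_L2 :: "L2 set \<Rightarrow> bool" where
  "open_L2 S \<longleftrightarrow> (\<forall>x\<in>S. \<forall>\<^sub>F (x', y) in uniformity. x' = x \<longrightarrow> y \<in> S)"

instance
proof
  fix f g h :: L2 and r :: real and S :: "L2 set"
  show "dist f g = norm (f - g)" by (rule dist_L2_def)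
  show "sgn f = f /\<^sub>R norm f" by (rule sgn_L2_def)
  show "uniformity = (INF e\<in>{0<..}. principal {(x, y :: L2). dist x y < e})"
    by (rule uniformity_L2_def)
  show "open S \<longleftrightarrow> (\<forall>x\<in>S. \<forall>\<^sub>F (x', y) in uniformity. x' = x \<longrightarrow> y \<in> S)"
    by (rule open_L2_def)
  show "norm f = sqrt (f \<bullet> f)" by (simp add: norm_L2_def inner_L2_def)
  show "f \<bullet> g = g \<bullet> f"
    unfolding inner_L2_def
  proof transfer
    fix f g assume "ae_eq f f" "ae_eq g g"
    then have i: "integrable lborel (\<lambda>t. f t * cnj (g t))" "integrable lborel (\<lambda>t. g t * cnj (f t))"
      by (simp_all add: ae_eq_def square_integrable_mult)
    show "Re (integral\<^sup>L lborel (\<lambda>t. f t * cnj (g t))) = Re (integral\<^sup>L lborel (\<lambda>t. g t * cnj (f t)))"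
      unfolding integral_Re[OF i(1), symmetric] integral_Re[OF i(2), symmetric]
      by (simp add: mult.commute)
  qed
  show "(f + g) \<bullet> h = f \<bullet> h + g \<bullet> h"
    unfolding inner_L2_def
  proof transfer
    fix f g h assume "ae_eq f f" "ae_eq g g" "ae_eq h h"
    then have i: "integrable lborel (\<lambda>t. f t * cnj (h t))" "integrable lborel (\<lambda>t. g t * cnj (h t))"
      by (simp_all add: ae_eq_def square_integrable_mult)
    show "Re (integral\<^sup>L lborel (\<lambda>t. (f t + g t) * cnj (h t))) =
      Re (integral\<^sup>L lborel (\<lambda>t. f t * cnj (h t))) + Re (integral\<^sup>L lborel (\<lambda>t. g t * cnj (h t)))"
      using Bochner_Integration.integral_add[OF i] by (simp add: distrib_right)
  qed
  show "(r *\<^sub>R f) \<bullet> g = r * (f \<bullet> g)"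
    unfolding inner_L2_def scaleR_L2_def
    by transfer (simp add: mult.assoc)
  have self: "Re (integral\<^sup>L lborel (\<lambda>t. f t * cnj (f t))) = integral\<^sup>L lborel (\<lambda>t. (cmod (f t))\<^sup>2)"
    for f
    unfolding complex_norm_square[symmetric] by (simp flip: of_real_power)
  show "0 \<le> f \<bullet> f"
    unfolding inner_L2_def by transfer (simp only: self, simp)
  show "f \<bullet> f = 0 \<longleftrightarrow> f = 0"
    unfolding inner_L2_def
  proof transfer
    fix f assume "ae_eq f f"
    then have i: "integrable lborel (\<lambda>t. (cmod (f t))\<^sup>2)" and sq: "square_integrable f"
      by (simp_all add: ae_eq_def square_integrable_def)
    show "Re (integral\<^sup>L lborel (\<lambda>t. f t * cnj (f t))) = 0 \<longleftrightarrow> ae_eq f (\<lambda>t. 0)"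
      unfolding self using integral_nonneg_eq_0_iff_AE[OF i] sq
      by (simp add: ae_eq_def square_integrable_zero)
  qed
qed

end

section \<open>Bounded operators on $L^2(\mathbb{R})$ and the algebra $\mathcal{B}_1$\<close>

(* The library type of bounded real-linear operators carries the operator norm; the
   complex-linear ones are cut out by op_L2. *)
type_synonym op = "L2 \<Rightarrow>\<^sub>L L2"

definition op_L2 :: "op set" where
  "op_L2 = {T. \<forall>c f. blinfun_apply T (scaleC_L2 c f) = scaleC_L2 c (blinfun_apply T f)}"

definition smult_op :: "complex \<Rightarrow> op \<Rightarrow> op" where
  "smult_op c T = Blinfun (\<lambda>f. scaleC_L2 c (blinfun_apply T f))"

definition adj :: "op \<Rightarrow> op" where
  "adj T = (THE S. \<forall>f g. cinner_L2 (blinfun_apply T f) g = cinner_L2 f (blinfun_apply S g))"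

definition star_subalgebra :: "op set \<Rightarrow> bool" where
  "star_subalgebra S \<longleftrightarrow> S \<subseteq> op_L2 \<and> 0 \<in> S \<and>
     (\<forall>a\<in>S. \<forall>b\<in>S. a + b \<in> S \<and> a o\<^sub>L b \<in> S) \<and>
     (\<forall>c. \<forall>a\<in>S. smult_op c a \<in> S) \<and> (\<forall>a\<in>S. adj a \<in> S)"

definition cstar_generated :: "op set \<Rightarrow> op set" where
  "cstar_generated X = \<Inter>{S. star_subalgebra S \<and> closed S \<and> X \<subseteq> S}"

definition mult_op :: "(real \<Rightarrow> complex) \<Rightarrow> op" where
  "mult_op a = Blinfun (\<lambda>f. abs_L2 (\<lambda>t. a t * rep_L2 f t))"

definition alg_A :: "op set" where
  "alg_A = {mult_op a |a. (\<forall>t. a (t + 1) = a t) \<and> continuous_on {0..<1} a \<and>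
     (\<exists>l. (a \<longlongrightarrow> l) (at_left 1))}"

definition gamma1 :: "real \<Rightarrow> real" where
  "gamma1 t = (if frac t \<le> 1/2 then 4 * frac t * (1 - frac t) + 2 * of_int \<lfloor>t\<rfloor>
     else 4 * frac t * (1 - frac t) + 2 * of_int \<lfloor>t\<rfloor> + 1)"

(* gamma1 is measurable and preimages of null sets under it are null, so the class below does
   not depend on the representative; gamma1 need not be differentiable at the half-integers, a
   null set, and is differentiable elsewhere. *)
definition U1 :: op where
  "U1 = Blinfun (\<lambda>f. abs_L2 (\<lambda>t. of_real (sqrt \<bar>deriv gamma1 t\<bar>) * rep_L2 f (gamma1 t)))"

definition op_power :: "op \<Rightarrow> nat \<Rightarrow> op" where
  "op_power T n = ((\<lambda>S. T o\<^sub>L S) ^^ n) id_blinfun"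

definition alg_B1 :: "op set" where
  "alg_B1 = cstar_generated (\<Union>n. (\<lambda>a. op_power (adj U1) n o\<^sub>L a o\<^sub>L op_power U1 n) ` alg_A)"

definition delta1 :: "op \<Rightarrow> op" where
  "delta1 b = U1 o\<^sub>L b o\<^sub>L adj U1"

section \<open>Algebras as structures with carrier\<close>

record 'a star_algebra = "(complex, 'a) module" +
  invol :: "'a \<Rightarrow> 'a"
  nrm :: "'a \<Rightarrow> real"

definition B1 :: "op star_algebra" where
  "B1 = \<lparr>carrier = alg_B1, mult = (o\<^sub>L), one = id_blinfun, zero = 0, add = (+),
     smult = smult_op, invol = adj, nrm = norm\<rparr>"

(* Functions on the subset X are represented as functions on the ambient type that are
   undefined outside X (extensional). *)
definition C_alg :: "'a::topological_space set \<Rightarrow> ('a \<Rightarrow> complex) star_algebra" where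
  "C_alg X = \<lparr>carrier = {f \<in> extensional X. continuous_on X f},
     mult = (\<lambda>f g. \<lambda>x\<in>X. f x * g x), one = (\<lambda>x\<in>X. 1),
     zero = (\<lambda>x\<in>X. 0), add = (\<lambda>f g. \<lambda>x\<in>X. f x + g x),
     smult = (\<lambda>c f. \<lambda>x\<in>X. c * f x), invol = (\<lambda>f. \<lambda>x\<in>X. cnj (f x)),
     nrm = (\<lambda>f. SUP x\<in>X. cmod (f x))\<rparr>"

definition star_iso :: "'a star_algebra \<Rightarrow> 'b star_algebra \<Rightarrow> ('a \<Rightarrow> 'b) set" where
  "star_iso A B = {\<phi> \<in> ring_iso A B.
     (\<forall>c. \<forall>a\<in>carrier A. \<phi> (c \<odot>\<^bsub>A\<^esub> a) = c \<odot>\<^bsub>B\<^esub> \<phi> a) \<and>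
     (\<forall>a\<in>carrier A. \<phi> (invol A a) = invol B (\<phi> a)) \<and>
     (\<forall>a\<in>carrier A. nrm B (\<phi> a) = nrm A a)}"

definition only_trivial_idempotents :: "('a, 'b) ring_scheme \<Rightarrow> bool" where
  "only_trivial_idempotents R \<longleftrightarrow>
     (\<forall>e\<in>carrier R. e \<otimes>\<^bsub>R\<^esub> e = e \<longrightarrow> e = \<zero>\<^bsub>R\<^esub> \<or> e = \<one>\<^bsub>R\<^esub>)"

section \<open>Continua\<close>

definition continuum :: "'a::metric_space set \<Rightarrow> bool" where
  "continuum X \<longleftrightarrow> X \<noteq> {} \<and> compact X \<and> connected X"

definition irreducible_continuum :: "'a::metric_space set \<Rightarrow> bool" where
  "irreducible_continuum X \<longleftrightarrow> continuum X \<and> (\<exists>x\<in>X. \<exists>y\<in>X. x \<noteq> y) \<and>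
     \<not> (\<exists>K L. continuum K \<and> continuum L \<and> K \<subset> X \<and> L \<subset> X \<and> X = K \<union> L)"

definition composant :: "'a::metric_space set \<Rightarrow> 'a \<Rightarrow> 'a set" where
  "composant X p = \<Union>{K. continuum K \<and> K \<subset> X \<and> p \<in> K}"

fun cantor_step :: "nat \<Rightarrow> real set" where
  "cantor_step 0 = {0..1}"
| "cantor_step (Suc n) = (\<lambda>x. x / 3) ` cantor_step n \<union> (\<lambda>x. 2/3 + x / 3) ` cantor_step n"

definition cantor_set :: "real set" where
  "cantor_set = (\<Inter>n. cantor_step n)"

definition upper_half_circle :: "real \<Rightarrow> real \<Rightarrow> (real \<times> real) set" where
  "upper_half_circle c r = {(x, y). (x - c)\<^sup>2 + y\<^sup>2 = r\<^sup>2 \<and> 0 \<le> y}"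

definition lower_half_circle :: "real \<Rightarrow> real \<Rightarrow> (real \<times> real) set" where
  "lower_half_circle c r = {(x, y). (x - c)\<^sup>2 + y\<^sup>2 = r\<^sup>2 \<and> y \<le> 0}"

definition BJK :: "(real \<times> real) set" where
  "BJK = \<Union>{upper_half_circle (1/2) r |r. 0 < r \<and> {1/2 - r, 1/2 + r} \<subseteq> cantor_set} \<union>
     (\<Union>n\<in>{1..}. \<Union>{lower_half_circle (5 / (2 * 3 ^ n)) r |r. 0 < r \<and>
        {5 / (2 * 3 ^ n) - r, 5 / (2 * 3 ^ n) + r} \<subseteq> cantor_set \<inter> {2 / 3 ^ n..1 / 3 ^ (n - 1)}})"

section \<open>The inverse limit and its parametrization\<close>

definition alpha1 :: "real \<Rightarrow> real" where
  "alpha1 x = 4 * x * (1 - x)"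

definition M1 :: "(nat \<Rightarrow> real) set" where
  "M1 = {x. (\<forall>n. x n \<in> {0..1}) \<and> (\<forall>n. alpha1 (x (Suc n)) = x n)}"

definition alpha1_tilde :: "(nat \<Rightarrow> real) \<Rightarrow> (nat \<Rightarrow> real)" where
  "alpha1_tilde x = case_nat (alpha1 (x 0)) x"

definition saw :: "real \<Rightarrow> real" where
  "saw u = infdist u (range (\<lambda>k::int. 2 * of_int k))"

definition hconj :: "real \<Rightarrow> real" where
  "hconj y = (sin (pi * y / 2))\<^sup>2"

definition arc_piece :: "nat \<Rightarrow> (nat \<Rightarrow> real) set" where
  "arc_piece k = {\<lambda>n. hconj (saw (u / 2 ^ n)) |u. u \<in> {real k..real k + 1}}"

(* Only for 0 <= t. An integer t > 0 lies in two intervals [k, k+1]; both conditions then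
   determine the same point. *)
definition rho :: "real \<Rightarrow> (nat \<Rightarrow> real)" where
  "rho t = (THE x. \<forall>k::nat. t \<in> {real k..real k + 1} \<longrightarrow> x \<in> arc_piece k \<and> x 0 = saw t)"

definition g1 :: "real \<Rightarrow> real" where
  "g1 t = (if frac t < 1/2 then 2 * of_int \<lfloor>t\<rfloor> + alpha1 (frac t)
     else 2 * (of_int \<lfloor>t\<rfloor> + 1) - alpha1 (frac t))"

end

theory Submission
  imports Defs
begin

text \<open>Symbolic dynamics carries most of the argument. A point of the inverse limit is determined by its
  zeroth coordinate and by the sequence of branches of the inverse of the logistic map that produce the
  other coordinates.

  For the topology: the Cantor set is the set of points that never escape under the tent map of slope 3,
  and the half-circles of the buckethandle encode changes of a single entry of the itinerary under that
  map, just as changes of a single branch do in the inverse limit. So both continua are the same quotient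
  of the product of the Cantor set and the interval. The conjugacy between the tent map and the logistic
  map turns the composant of the origin into a half-line on which the homeomorphism is doubling.

  For the algebra: reading the branches off the binary digits of the integer part of \<open>t\<close> gives a map from
  the line onto a dense subset of the inverse limit, which turns \<open>gamma1\<close> into \<open>alpha1_tilde\<close>. The
  algebra then consists exactly of the multiplication operators by continuous functions on the inverse
  limit composed with this map. A closed ideal with only trivial idempotents in the quotient is the ideal
  of a closed connected set, and two ideals with zero intersection have zero sets that cover the
  inverse limit.\<close>

section \<open>The inverse limit\<close>

text \<open>Every ambiguity in the coding comes from the value 1: it is the only value whose two
  preimages under \<open>alpha1\<close> coincide, and it is mapped to the fixed point 0. A
  coordinate equal to 1 is therefore preceded by zeros only and occurs at most once in a point, so
  two branch sequences of the same point differ in at most one entry. A single half-circle can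
  realise this: an upper one frees entry 0, a lower one at scale 1/3^(k+1) frees entry k+1. On the
  operator side the obstacle is that the winding map jumps at the integers and intertwines
  \<open>gamma1\<close> with \<open>alpha1_tilde\<close> only off the half-integers. The second
  defect concerns a null set. The first is harmless because the winding map spends an interval of
  positive length in every nonempty open subset of the inverse limit: operator norm and supremum
  norm then agree, and closures can be formed among functions instead of operators.\<close>

definition branch :: "bool \<Rightarrow> real \<Rightarrow> real" where
  "branch b y = (if b then (1 + sqrt (1 - y)) / 2 else (1 - sqrt (1 - y)) / 2)"

primrec thread :: "(nat \<Rightarrow> bool) \<Rightarrow> real \<Rightarrow> nat \<Rightarrow> real" where
  "thread b x 0 = x"
| "thread b x (Suc n) = branch (b n) (thread b x n)"

text \<open>A right inverse of the projection to coordinate \<open>N\<close>. The coordinates below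
  \<open>N\<close> are forced; the lower branch above \<open>N\<close> makes all these arcs start at
  the zero sequence.\<close>

definition section_at :: "nat \<Rightarrow> real \<Rightarrow> nat \<Rightarrow> real" where
  "section_at N y = (alpha1_tilde ^^ N) (thread (\<lambda>_. False) y)"

lemma alpha1_branch: "y \<le> 1 \<Longrightarrow> alpha1 (branch b y) = y"
proof -
  assume "y \<le> 1"
  then have "(sqrt (1 - y))\<^sup>2 = 1 - y" by simp
  then show ?thesis by (auto simp: branch_def alpha1_def field_simps power2_eq_square)
qed

lemma branch_mem: "y \<in> {0..1} \<Longrightarrow> branch b y \<in> {0..1}"
proof -
  assume "y \<in> {0..1}"
  then have "0 \<le> sqrt (1 - y)" "sqrt (1 - y) \<le> 1" by auto
  then show ?thesis by (auto simp: branch_def simp del: real_sqrt_ge_0_iff real_sqrt_le_1_iff)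
qed

lemma alpha1_mem: "y \<in> {0..1} \<Longrightarrow> alpha1 y \<in> {0..1}"
proof -
  assume y: "y \<in> {0..1}"
  have "0 \<le> (1 - 2 * y)\<^sup>2" by simp
  then have "4 * y * (1 - y) \<le> 1" by (simp add: power2_eq_square algebra_simps)
  then show ?thesis using y by (simp add: alpha1_def)
qed

lemma sqrt_one_minus_alpha1: "sqrt (1 - alpha1 x) = \<bar>1 - 2 * x\<bar>"
proof -
  have "1 - alpha1 x = (1 - 2 * x)\<^sup>2" by (simp add: alpha1_def power2_eq_square algebra_simps)
  then show ?thesis by simp
qed

lemma branch_alpha1: "(if b then 1/2 \<le> x else x \<le> 1/2) \<Longrightarrow> branch b (alpha1 x) = x"
  by (auto simp: branch_def sqrt_one_minus_alpha1 split: if_splits)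

lemma branch_bounds:
  assumes "y \<le> 1" shows "if b then 1/2 \<le> branch b y else branch b y \<le> 1/2"
  using assms by (auto simp: branch_def)

lemma branch_eq_iff: "y \<le> 1 \<Longrightarrow> branch b y = branch b' y \<longleftrightarrow> b = b' \<or> y = 1"
  by (auto simp: branch_def)

lemma branch_one [simp]: "branch b 1 = 1/2"
  by (simp add: branch_def)

lemma branch_zero [simp]: "branch b 0 = (if b then 1 else 0)"
  by (simp add: branch_def)

lemma continuous_on_branch [continuous_intros]:
  "continuous_on S f \<Longrightarrow> continuous_on S (\<lambda>x. branch b (f x))"
  by (cases b) (auto simp: branch_def intro!: continuous_intros)

lemma continuous_on_alpha1 [continuous_intros]:
  "continuous_on S f \<Longrightarrow> continuous_on S (\<lambda>x. alpha1 (f x))"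
  by (auto simp: alpha1_def intro!: continuous_intros)

lemma M1_alpha1: "x \<in> M1 \<Longrightarrow> alpha1 (x (Suc n)) = x n"
  by (simp add: M1_def)

lemma M1_bounds: "x \<in> M1 \<Longrightarrow> 0 \<le> x n" "x \<in> M1 \<Longrightarrow> x n \<le> 1"
  by (auto simp: M1_def)

lemma thread_mem: "x \<in> {0..1} \<Longrightarrow> thread b x n \<in> {0..1}"
  by (induction n) (auto simp del: atLeastAtMost_iff intro: branch_mem)

lemma thread_in_M1: "x \<in> {0..1} \<Longrightarrow> thread b x \<in> M1"
  using thread_mem[of x b] by (auto simp: M1_def alpha1_branch)

text \<open>A bit recovers a coordinate from its predecessor as soon as the coordinate lies in the
  corresponding closed half. Weak inequalities admit both bits at 1/2, which is exactly the
  ambiguity of the coding.\<close>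

lemma thread_eqI:
  assumes "y \<in> M1" "\<And>n. if b n then 1/2 \<le> y (Suc n) else y (Suc n) \<le> 1/2"
  shows "thread b (y 0) = y"
proof
  fix n show "thread b (y 0) n = y n"
  proof (induction n)
    case (Suc n)
    have "thread b (y 0) (Suc n) = branch (b n) (alpha1 (y (Suc n)))"
      using Suc M1_alpha1[OF assms(1)] by simp
    also have "\<dots> = y (Suc n)" using assms(2) by (rule branch_alpha1)
    finally show ?case .
  qed simp
qed

lemma M1_eq_thread: "y \<in> M1 \<Longrightarrow> thread (\<lambda>n. 1/2 < y (Suc n)) (y 0) = y"
  by (rule thread_eqI) auto

lemma thread_cong: "(\<And>i. i < n \<Longrightarrow> b i = b' i) \<Longrightarrow> thread b x n = thread b' x n"
  by (induction n) auto

lemma continuous_on_thread_coord: "continuous_on S (\<lambda>x. thread b x n)"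
  by (induction n) (auto intro!: continuous_intros)

lemma continuous_on_thread: "continuous_on S (thread b)"
  by (intro continuous_on_coordinatewise_then_product continuous_on_thread_coord)

lemma M1_agree:
  assumes "x \<in> M1" "y \<in> M1" "x N = y N" "n \<le> N" shows "x n = y n"
  using assms(4,3)
proof (induction rule: inc_induct)
  case (step m)
  then show ?case using M1_alpha1[OF assms(1), of m] M1_alpha1[OF assms(2), of m] by simp
qed simp

lemma alpha1_tilde_in_M1: "x \<in> M1 \<Longrightarrow> alpha1_tilde x \<in> M1"
  using alpha1_mem[of "x 0"]
  by (auto simp: M1_def alpha1_tilde_def split: nat.splits)

lemma continuous_on_alpha1_tilde: "continuous_on S alpha1_tilde"
  unfolding alpha1_tilde_def
proof (rule continuous_on_coordinatewise_then_product)
  show "continuous_on S (\<lambda>x. (case i of 0 \<Rightarrow> alpha1 (x 0) | Suc n \<Rightarrow> x n))" for i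
    by (cases i) (auto intro!: continuous_intros continuous_on_subset[OF continuous_on_product_coordinates])
qed

definition unshift :: "(nat \<Rightarrow> real) \<Rightarrow> (nat \<Rightarrow> real)" where
  "unshift x = (\<lambda>n. x (Suc n))"

lemma unshift_in_M1: "x \<in> M1 \<Longrightarrow> unshift x \<in> M1"
  by (auto simp: M1_def unshift_def)

lemma continuous_on_unshift: "continuous_on S unshift"
  unfolding unshift_def
  by (rule continuous_on_coordinatewise_then_product)
     (rule continuous_on_subset[OF continuous_on_product_coordinates subset_UNIV])

lemma unshift_alpha1_tilde [simp]: "unshift (alpha1_tilde x) = x"
  by (simp add: unshift_def alpha1_tilde_def)

lemma alpha1_tilde_unshift: "x \<in> M1 \<Longrightarrow> alpha1_tilde (unshift x) = x"
  by (auto simp: unshift_def alpha1_tilde_def M1_alpha1 split: nat.splits)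

lemma homeomorphism_alpha1_tilde: "homeomorphism M1 M1 alpha1_tilde unshift"
  by (rule homeomorphismI)
     (auto simp: alpha1_tilde_in_M1 unshift_in_M1 alpha1_tilde_unshift
       intro: continuous_on_alpha1_tilde continuous_on_unshift)

lemma section_at_in_M1: "y \<in> {0..1} \<Longrightarrow> section_at N y \<in> M1"
  unfolding section_at_def by (induction N) (auto simp: thread_in_M1 alpha1_tilde_in_M1)

lemma section_at_same [simp]: "section_at N y N = y"
  unfolding section_at_def by (induction N) (auto simp: alpha1_tilde_def)

lemma continuous_on_section_at: "continuous_on S (section_at N)"
  unfolding section_at_def
proof (induction N)
  case (Suc N)
  show ?case
    using continuous_on_compose[OF Suc continuous_on_alpha1_tilde] by (simp add: o_def)
qed (simp add: continuous_on_thread)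

lemma section_at_agree:
  assumes "x \<in> M1" "n \<le> N" shows "section_at N (x N) n = x n"
  by (rule M1_agree[OF section_at_in_M1 assms(1) _ assms(2)])
     (use M1_bounds[OF assms(1)] in auto)

lemma zero_in_M1: "(\<lambda>_. 0) \<in> M1"
  by (simp add: M1_def alpha1_def)

lemma section_at_zero: "section_at N 0 = (\<lambda>_. 0)"
proof -
  have "thread (\<lambda>_. False) 0 = (\<lambda>_. 0)"
    using thread_eqI[OF zero_in_M1, of "\<lambda>_. False"] by simp
  moreover have "alpha1_tilde (\<lambda>_. 0) = (\<lambda>_. 0)"
    by (auto simp: alpha1_tilde_def alpha1_def split: nat.splits)
  ultimately show ?thesis unfolding section_at_def by (induction N) auto
qed

section \<open>Compactness, connectedness and irreducibility\<close>

lemma dist_fun_small: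
  assumes "0 < (e::real)"
  shows "\<exists>N. \<forall>x y :: nat \<Rightarrow> real. (\<forall>n\<le>N. x n = y n) \<longrightarrow> dist x y < e"
proof -
  obtain M where M: "(1/2) ^ M < e" using real_arch_pow_inv[OF assms, of "1/2"] by auto
  \<comment> \<open>The metric on sequences gives the weight \<open>(1/2) ^ n\<close> to the
    coordinate \<open>from_nat n\<close>, not to \<open>n\<close>; the maximum covers every index
    that this enumeration produces up to \<open>M\<close>.\<close>
  define N where "N = Max ((from_nat :: nat \<Rightarrow> nat) ` {..M})"
  have "dist x y < e" if *: "\<And>n. n \<le> N \<Longrightarrow> x n = y n" for x y :: "nat \<Rightarrow> real"
  proof -
    have "from_nat n \<le> N" if "n \<le> M" for n
      unfolding N_def by (rule Max_ge) (use that in auto)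
    then have eq: "x (from_nat n) = y (from_nat n)" if "n \<le> M" for n using * that by blast
    have "{dist (x (from_nat n)) (y (from_nat n)) |n. n \<le> M} = (\<lambda>n. dist (x (from_nat n)) (y (from_nat n))) ` {..M}"
      by auto
    also have "\<dots> = (\<lambda>_. 0) ` {..M}" by (rule image_cong) (simp_all add: eq)
    also have "\<dots> = {0}" by auto
    finally have "{dist (x (from_nat n)) (y (from_nat n)) |n. n \<le> M} = {0}" .
    then show ?thesis using dist_fun_le_dist_first_terms[of x y M] M by simp
  qed
  then show ?thesis by blast
qed

lemma compact_M1: "compact M1"
proof -
  have "compactin (product_topology (\<lambda>_. euclidean) UNIV) (PiE (UNIV::nat set) (\<lambda>_. {0..1::real}))"
    unfolding compactin_PiE by simp
  then have c: "compact (PiE (UNIV::nat set) (\<lambda>_. {0..1::real}))"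
    by (simp add: euclidean_product_topology)
  have cl: "closed {x :: nat \<Rightarrow> real. alpha1 (x (Suc n)) = x n}" for n
    by (intro closed_Collect_eq continuous_intros continuous_on_product_coordinates)
  have "closed (\<Inter>n. {x :: nat \<Rightarrow> real. alpha1 (x (Suc n)) = x n})"
    using cl by blast
  then have "compact (PiE UNIV (\<lambda>_. {0..1}) \<inter> (\<Inter>n. {x :: nat \<Rightarrow> real. alpha1 (x (Suc n)) = x n}))"
    by (rule compact_Int_closed[OF c])
  also have "PiE UNIV (\<lambda>_. {0..1}) \<inter> (\<Inter>n. {x. alpha1 (x (Suc n)) = x n}) = M1"
    by (auto simp: M1_def PiE_def)
  finally show ?thesis .
qed

lemma approx_by_section:
  assumes "x \<in> M1" "0 < e" shows "\<exists>N. dist (section_at N (x N)) x < e"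
  using dist_fun_small[OF assms(2)] section_at_agree[OF assms(1)] by blast

text \<open>The arcs given by \<open>section_at\<close> share the zero sequence, so their union is
  connected; it is dense in \<open>M1\<close>, and closures of connected sets are connected.\<close>

lemma connected_M1: "connected M1"
proof -
  let ?A = "\<Union>N. section_at N ` {0..1}"
  have "connected ?A"
  proof (rule connected_Union)
    show "connected s" if "s \<in> range (\<lambda>N. section_at N ` {0..1})" for s
      using that by (auto intro!: connected_continuous_image continuous_on_section_at)
    have "(\<lambda>_. 0) \<in> section_at N ` {0..1}" for N
      using section_at_zero[of N] by (metis atLeastAtMost_iff image_eqI order_refl zero_le_one)
    then show "\<Inter> (range (\<lambda>N. section_at N ` {0..1})) \<noteq> {}" by blast
  qed
  moreover have "closure ?A = M1"
  proof
    have "?A \<subseteq> M1" using section_at_in_M1 by auto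
    then show "closure ?A \<subseteq> M1"
      by (rule closure_minimal) (rule compact_imp_closed[OF compact_M1])
    show "M1 \<subseteq> closure ?A"
    proof
      fix x assume x: "x \<in> M1"
      have "\<exists>y\<in>?A. dist y x < e" if e: "0 < e" for e
      proof -
        obtain N where N: "dist (section_at N (x N)) x < e" using approx_by_section[OF x e] by blast
        have "x N \<in> {0..1}" using M1_bounds[OF x] by simp
        then show ?thesis using N by blast
      qed
      then show "x \<in> closure ?A" by (simp add: closure_approachable)
    qed
  qed
  ultimately show ?thesis using connected_imp_connected_closure by metis
qed

text \<open>A late coordinate determines all earlier ones, hence the point up to a small distance.
  Full projections at arbitrarily late coordinates make \<open>K\<close> dense, and \<open>K\<close>
  is closed.\<close>

lemma continuum_full_projections:
  assumes "K \<subseteq> M1" "compact K" "\<And>N. \<exists>n\<ge>N. (\<lambda>x. x n) ` K = {0..1}"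
  shows "K = M1"
proof
  show "M1 \<subseteq> K"
  proof
    fix x assume x: "x \<in> M1"
    have "\<exists>y\<in>K. dist y x < e" if "0 < e" for e
    proof -
      obtain N where N: "\<And>u v :: nat \<Rightarrow> real. (\<forall>n\<le>N. u n = v n) \<Longrightarrow> dist u v < e"
        using dist_fun_small[OF \<open>0 < e\<close>] by blast
      obtain n where n: "n \<ge> N" "(\<lambda>x. x n) ` K = {0..1}" using assms(3) by blast
      have "x n \<in> (\<lambda>x. x n) ` K" unfolding n(2) using M1_bounds[OF x] by simp
      then obtain y where y: "y \<in> K" "y n = x n" by auto
      have "\<forall>i\<le>N. y i = x i"
        using M1_agree[of y x n] y x assms(1) n(1) by auto
      then show ?thesis using N y(1) by blast
    qed
    then have "x \<in> closure K" by (simp add: closure_approachable)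
    then show "x \<in> K" using compact_imp_closed[OF assms(2)] by simp
  qed
qed fact

text \<open>Between any two of the values 0, 1/2, 1 lies a whole monotone piece of
  \<open>alpha1\<close>, [0, 1/2] or [1/2, 1], and either one is mapped onto the unit
  interval.\<close>

lemma projection_full_step:
  assumes K: "K \<subseteq> M1" "connected K"
    and ab: "a \<in> (\<lambda>x. x (Suc n)) ` K" "b \<in> (\<lambda>x. x (Suc n)) ` K" "a < b"
      "a \<in> {0, 1/2, 1}" "b \<in> {0, 1/2, 1}"
  shows "(\<lambda>x. x n) ` K = {0..1}"
proof
  show "(\<lambda>x. x n) ` K \<subseteq> {0..1}" using K(1) M1_bounds by auto
  have "connected ((\<lambda>x. x (Suc n)) ` K)"
    using K(2) by (rule connected_continuous_image[rotated])
      (rule continuous_on_subset[OF continuous_on_product_coordinates subset_UNIV])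
  then have sub: "{a..b} \<subseteq> (\<lambda>x. x (Suc n)) ` K"
    using ab(1,2) connected_contains_Icc by blast
  have "a \<le> 0 \<and> 1/2 \<le> b \<or> a \<le> 1/2 \<and> 1 \<le> b" using ab by auto
  then obtain c where c: "\<And>y. y \<in> {0..1} \<Longrightarrow> branch c y \<in> {a..b}"
    using branch_mem branch_bounds
    by (smt (verit, ccfv_threshold) atLeastAtMost_iff)
  show "{0..1} \<subseteq> (\<lambda>x. x n) ` K"
  proof
    fix y :: real assume y: "y \<in> {0..1}"
    then obtain x where x: "x \<in> K" "x (Suc n) = branch c y" using c sub by (metis (no_types, lifting) imageE subsetD)
    then have "x n = y" using M1_alpha1[of x n] K(1) alpha1_branch[of y c] y by auto
    then show "y \<in> (\<lambda>x. x n) ` K" using x(1) by blast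
  qed
qed

lemma proper_subcontinuum_projection:
  assumes "continuum K" "K \<subset> M1"
  shows "\<exists>N. \<forall>n\<ge>N. (\<lambda>x. x n) ` K \<noteq> {0..1}"
  using continuum_full_projections[of K] assms unfolding continuum_def by blast

lemma M1_surj_coord: "y \<in> {0..1} \<Longrightarrow> \<exists>x\<in>M1. x n = y"
  using section_at_in_M1 section_at_same by blast

text \<open>Of two subcontinua that cover \<open>M1\<close>, one takes at least two of the values 0,
  1/2, 1 in a given coordinate, so its projection to the preceding coordinate is full. For a proper
  subcontinuum this is impossible in late coordinates.\<close>

lemma irreducible_continuum_M1: "irreducible_continuum M1"
  unfolding irreducible_continuum_def
proof (intro conjI)
  show "continuum M1" using compact_M1 connected_M1 zero_in_M1 by (auto simp: continuum_def)
  obtain x where x: "x \<in> M1" "x 0 = 1" using M1_surj_coord[of 1 0] by auto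
  then have "x \<noteq> (\<lambda>_. 0)" by auto
  then show "\<exists>x\<in>M1. \<exists>y\<in>M1. x \<noteq> y" using x zero_in_M1 by blast
  show "\<not> (\<exists>K L. continuum K \<and> continuum L \<and> K \<subset> M1 \<and> L \<subset> M1 \<and> M1 = K \<union> L)"
  proof (rule notI, elim exE conjE)
    fix K L assume KL: "continuum K" "continuum L" "K \<subset> M1" "L \<subset> M1" "M1 = K \<union> L"
    obtain N1 N2 where "\<forall>n\<ge>N1. (\<lambda>x. x n) ` K \<noteq> {0..1}" "\<forall>n\<ge>N2. (\<lambda>x. x n) ` L \<noteq> {0..1}"
      using proper_subcontinuum_projection KL by meson
    then have N: "(\<lambda>x. x (max N1 N2)) ` K \<noteq> {0..1}" "(\<lambda>x. x (max N1 N2)) ` L \<noteq> {0..1}" by auto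
    let ?P = "\<lambda>S. (\<lambda>x. x (Suc (max N1 N2))) ` S"
    have "y \<in> ?P K \<or> y \<in> ?P L" if "y \<in> {0..1}" for y
      using M1_surj_coord[OF that, of "Suc (max N1 N2)"] KL(5) by blast
    then have *: "0 \<in> ?P K \<or> 0 \<in> ?P L" "1/2 \<in> ?P K \<or> 1/2 \<in> ?P L" "1 \<in> ?P K \<or> 1 \<in> ?P L"
      by auto
    have no: "\<not> (a \<in> ?P S \<and> b \<in> ?P S)"
      if "S = K \<or> S = L" "a < b" "a \<in> {0, 1/2, 1}" "b \<in> {0, 1/2, 1}" for S a b
      using projection_full_step[of S a "max N1 N2" b] that N KL unfolding continuum_def by blast
    show False
      using * no[of K 0 "1/2"] no[of K 0 1] no[of K "1/2" 1] no[of L 0 "1/2"] no[of L 0 1] no[of L "1/2" 1]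
      by auto
  qed
qed

section \<open>The buckethandle continuum\<close>

text \<open>Itineraries under the tent map of slope 3 replace ternary digits: the reflection of a part of the
  Cantor set that a half-circle encodes changes one entry of the itinerary, but infinitely many digits.\<close>

definition tent3 :: "real \<Rightarrow> real" where
  "tent3 c = 3 * min c (1 - c)"

definition itin :: "real \<Rightarrow> nat \<Rightarrow> bool" where
  "itin c n \<longleftrightarrow> 1/2 < (tent3 ^^ n) c"

lemma tent3_reflect: "tent3 (1 - c) = tent3 c"
  by (simp add: tent3_def min.commute)

lemma tent3_low: "c \<le> 1/2 \<Longrightarrow> tent3 c = 3 * c"
  and tent3_high: "1/2 \<le> c \<Longrightarrow> tent3 c = 3 - 3 * c"
  by (auto simp: tent3_def min_def)

lemma tent3_mem: "tent3 c \<in> {0..1} \<Longrightarrow> c \<in> {0..1}"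
  by (auto simp: tent3_def min_def split: if_splits)

section \<open>The Cantor set as the non-escaping set of \<open>tent3\<close>\<close>

lemma cantor_step_subset: "cantor_step n \<subseteq> {0..1}"
  by (induction n) (force simp: image_subset_iff)+

lemma cantor_step_reflect: "1 - c \<in> cantor_step n \<longleftrightarrow> c \<in> cantor_step n"
proof -
  have "1 - c \<in> cantor_step n" if "c \<in> cantor_step n" for c
    using that
  proof (induction n arbitrary: c)
    case (Suc n)
    then consider y where "y \<in> cantor_step n" "c = y / 3" | y where "y \<in> cantor_step n" "c = 2/3 + y / 3"
      by auto
    then show ?case
    proof cases
      case 1
      then have "1 - c = 2/3 + (1 - y) / 3" by (simp add: field_simps)
      then have "1 - c \<in> (\<lambda>x. 2/3 + x / 3) ` cantor_step n" using Suc.IH[OF 1(1)] by (rule image_eqI)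
      then show ?thesis by simp
    next
      case 2
      then have "1 - c = (1 - y) / 3" by (simp add: field_simps)
      then have "1 - c \<in> (\<lambda>x. x / 3) ` cantor_step n" using Suc.IH[OF 2(1)] by (rule image_eqI)
      then show ?thesis by simp
    qed
  qed auto
  from this[of c] this[of "1 - c"] show ?thesis by auto
qed

text \<open>The two similarities that build the next stage invert 3x and 3x - 2. Since each stage is
  symmetric under reflection, 3x - 2 may be replaced by 3 - 3x, the falling branch of
  \<open>tent3\<close>; the branch not chosen by the minimum leaves the unit interval or gives the
  same value.\<close>

lemma cantor_step_Suc_iff: "c \<in> cantor_step (Suc n) \<longleftrightarrow> tent3 c \<in> cantor_step n"
proof -
  have "c \<in> cantor_step (Suc n) \<longleftrightarrow> 3 * c \<in> cantor_step n \<or> 3 * c - 2 \<in> cantor_step n"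
  proof -
    have "c \<in> (\<lambda>x. x / 3) ` cantor_step n \<longleftrightarrow> 3 * c \<in> cantor_step n"
      by (auto simp: image_iff mult.commute intro!: bexI[of _ "3 * c"])
    moreover have "c \<in> (\<lambda>x. 2/3 + x / 3) ` cantor_step n \<longleftrightarrow> 3 * c - 2 \<in> cantor_step n"
      by (auto simp: image_iff field_simps intro!: bexI[of _ "3 * c - 2"])
    ultimately show ?thesis by simp
  qed
  also have "\<dots> \<longleftrightarrow> 3 * c \<in> cantor_step n \<or> 3 - 3 * c \<in> cantor_step n"
    using cantor_step_reflect[of "3 * c - 2" n] by (simp add: algebra_simps)
  also have "\<dots> \<longleftrightarrow> tent3 c \<in> cantor_step n"
    using cantor_step_subset[of n] by (auto simp: tent3_def min_def algebra_simps)
  finally show ?thesis .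
qed

lemma cantor_step_iff: "c \<in> cantor_step n \<longleftrightarrow> (tent3 ^^ n) c \<in> {0..1}"
proof (induction n arbitrary: c)
  case (Suc n)
  show ?case unfolding cantor_step_Suc_iff Suc funpow_Suc_right by simp
qed simp

lemma cantor_iff: "c \<in> cantor_set \<longleftrightarrow> (\<forall>n. (tent3 ^^ n) c \<in> {0..1})"
  by (auto simp: cantor_set_def cantor_step_iff)

lemma tent3_in_cantor_iff: "tent3 c \<in> cantor_set \<longleftrightarrow> c \<in> cantor_set"
proof -
  have "(\<forall>n. (tent3 ^^ n) (tent3 c) \<in> {0..1}) \<longleftrightarrow> (\<forall>n. (tent3 ^^ Suc n) c \<in> {0..1})"
    by (simp add: funpow_Suc_right del: funpow.simps)
  also have "\<dots> \<longleftrightarrow> (\<forall>n. (tent3 ^^ n) c \<in> {0..1})"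
  proof
    assume *: "\<forall>n. (tent3 ^^ Suc n) c \<in> {0..1}"
    show "\<forall>n. (tent3 ^^ n) c \<in> {0..1}"
    proof
      fix n show "(tent3 ^^ n) c \<in> {0..1}"
        using * tent3_mem[of "(tent3 ^^ n) c"] by simp
    qed
  qed blast
  finally show ?thesis unfolding cantor_iff .
qed

lemma funpow_tent3_in_cantor_iff: "(tent3 ^^ n) c \<in> cantor_set \<longleftrightarrow> c \<in> cantor_set"
  by (induction n) (auto simp: tent3_in_cantor_iff)

lemma cantor_bounds: "c \<in> cantor_set \<Longrightarrow> 0 \<le> c" "c \<in> cantor_set \<Longrightarrow> c \<le> 1"
  unfolding cantor_iff by (metis atLeastAtMost_iff funpow_0)+

lemma cantor_reflect: "1 - c \<in> cantor_set \<longleftrightarrow> c \<in> cantor_set"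
  using tent3_in_cantor_iff[of c] tent3_in_cantor_iff[of "1 - c"] by (simp add: tent3_reflect)

lemma zero_in_cantor: "0 \<in> cantor_set"
proof -
  have "(tent3 ^^ n) 0 = 0" for n by (induction n) (auto simp: tent3_def)
  then show ?thesis by (simp add: cantor_iff)
qed

lemma cantor_gap:
  assumes "c \<in> cantor_set" shows "c \<le> 1/3 \<or> 2/3 \<le> c"
proof -
  have "tent3 c \<le> 1" using cantor_bounds(2) assms tent3_in_cantor_iff by blast
  then show ?thesis by (auto simp: tent3_def min_def split: if_splits)
qed

lemma itin_True: "c \<in> cantor_set \<Longrightarrow> itin c n \<Longrightarrow> 2/3 \<le> (tent3 ^^ n) c"
  and itin_False: "c \<in> cantor_set \<Longrightarrow> \<not> itin c n \<Longrightarrow> (tent3 ^^ n) c \<le> 1/3"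
  using cantor_gap[of "(tent3 ^^ n) c"] by (auto simp: itin_def funpow_tent3_in_cantor_iff)

lemma continuous_on_funpow_tent3: "continuous_on S (tent3 ^^ n)"
proof (induction n)
  case (Suc n)
  have "continuous_on T tent3" for T
    unfolding tent3_def by (intro continuous_intros)
  then show ?case using continuous_on_compose[OF Suc, of tent3] by simp
qed (simp add: id_def)

lemma compact_cantor: "compact cantor_set"
proof -
  have "closed {c. (tent3 ^^ n) c \<in> {0..1}}" for n
    using continuous_closed_vimage[OF closed_atLeastAtMost, of "tent3 ^^ n" 0 1]
      continuous_on_funpow_tent3[of UNIV n]
    by (simp add: vimage_def continuous_on_eq_continuous_at)
  then have "closed (\<Inter>n. {c. (tent3 ^^ n) c \<in> {0..1}})" by blast
  moreover have "(\<Inter>n. {c. (tent3 ^^ n) c \<in> {0..1}}) = cantor_set" by (auto simp: cantor_iff)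
  moreover have "bounded cantor_set"
    using cantor_bounds by (intro bounded_subset[OF bounded_closed_interval[of 0 1]]) auto
  ultimately show ?thesis by (simp add: compact_eq_bounded_closed)
qed

lemma itin_Suc: "itin c (Suc n) = itin (tent3 c) n"
  unfolding itin_def by (subst funpow_Suc_right) simp

text \<open>While the itineraries agree, both orbits follow the same branch of slope 3 or -3, so
  their distance triples at every step; yet it never exceeds 1.\<close>

lemma cantor_eqI:
  assumes c: "c \<in> cantor_set" "c' \<in> cantor_set" and eq: "\<And>n. itin c n = itin c' n"
  shows "c = c'"
proof (rule ccontr)
  assume "c \<noteq> c'"
  have *: "\<bar>(tent3 ^^ n) c - (tent3 ^^ n) c'\<bar> = 3 ^ n * \<bar>c - c'\<bar>" for n
  proof (induction n)
    case (Suc n)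
    have "\<bar>tent3 ((tent3 ^^ n) c) - tent3 ((tent3 ^^ n) c')\<bar> = 3 * \<bar>(tent3 ^^ n) c - (tent3 ^^ n) c'\<bar>"
      using eq[of n] by (auto simp: itin_def tent3_def min_def abs_if)
    then show ?case using Suc by simp
  qed simp
  obtain n where "1 / \<bar>c - c'\<bar> < 3 ^ n"
    using real_arch_pow[of 3 "1 / \<bar>c - c'\<bar>"] by auto
  then have "1 < 3 ^ n * \<bar>c - c'\<bar>" using \<open>c \<noteq> c'\<close> by (simp add: field_simps)
  moreover have "\<bar>(tent3 ^^ n) c - (tent3 ^^ n) c'\<bar> \<le> 1"
    using cantor_bounds[of "(tent3 ^^ n) c"] cantor_bounds[of "(tent3 ^^ n) c'"] c
    by (simp add: funpow_tent3_in_cantor_iff)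
  ultimately show False using *[of n] by simp
qed

text \<open>The points with a prescribed initial segment form a decreasing sequence of compact sets.
  They are nonempty because a segment can be pulled back through the inverse branches c/3 and 1 -
  c/3 of \<open>tent3\<close>.\<close>

lemma itin_surj: "\<exists>c\<in>cantor_set. itin c = b"
proof -
  define F where "F n = {c \<in> cantor_set. \<forall>i<n. itin c i = b i}" for n
  have "compact (F n)" for n
  proof -
    \<comment> \<open>Since the Cantor set has no point strictly between 1/3 and 2/3, the strict
      condition of \<open>itin\<close> and its negation can both be replaced by closed
      conditions.\<close>
    let ?H = "\<lambda>i. {c. if b i then 1/2 \<le> (tent3 ^^ i) c else (tent3 ^^ i) c \<le> 1/2}"
    have "closed (?H i)" for i
      by (cases "b i") (auto intro!: closed_Collect_le continuous_intros continuous_on_funpow_tent3)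
    then have "closed (\<Inter>i\<in>{..<n}. ?H i)" by blast
    moreover have "itin c i = b i \<longleftrightarrow> c \<in> ?H i" if "c \<in> cantor_set" for c i
      using itin_True[OF that, of i] itin_False[OF that, of i] unfolding itin_def by (cases "b i"; simp; linarith)
    then have "cantor_set \<inter> (\<Inter>i\<in>{..<n}. ?H i) = F n" unfolding F_def by blast
    ultimately show ?thesis using compact_Int_closed[OF compact_cantor, of "\<Inter>i\<in>{..<n}. ?H i"] by (simp only:)
  qed
  moreover have "F n \<noteq> {}" for n
  proof -
    have "\<exists>c\<in>cantor_set. \<forall>i<n. itin c i = b i" for b
    proof (induction n arbitrary: b)
      case (Suc n)
      obtain c' where c': "c' \<in> cantor_set" "\<And>i. i < n \<Longrightarrow> itin c' i = b (Suc i)"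
        using Suc[of "\<lambda>i. b (Suc i)"] by blast
      define c where "c = (if b 0 then 1 - c' / 3 else c' / 3)"
      have t: "tent3 c = c'"
        using cantor_bounds[OF c'(1)] by (auto simp: tent3_def c_def min_def)
      then have "c \<in> cantor_set" using tent3_in_cantor_iff[of c] c'(1) by simp
      moreover have "itin c i = b i" if "i < Suc n" for i
      proof (cases i)
        case 0
        then show ?thesis using cantor_bounds[OF c'(1)] by (auto simp: itin_def c_def)
      next
        case (Suc j)
        then show ?thesis using c'(2)[of j] that by (simp add: itin_Suc t)
      qed
      ultimately show ?case by blast
    qed (use zero_in_cantor in auto)
    then show ?thesis by (auto simp: F_def)
  qed
  ultimately have "\<Inter> (range F) \<noteq> {}"
    by (intro compact_nest) (auto simp: F_def)
  then obtain c where "\<And>n. c \<in> F n" by blast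
  then have "c \<in> cantor_set" "itin c i = b i" for i using lessI[of i] unfolding F_def by blast+
  then show ?thesis by blast
qed

section \<open>Reflections of the Cantor set that change one entry of the itinerary\<close>

lemma itin_reflect: "c \<in> cantor_set \<Longrightarrow> itin (1 - c) i = (if i = 0 then \<not> itin c 0 else itin c i)"
proof (cases i)
  case 0
  assume "c \<in> cantor_set"
  then show ?thesis using 0 cantor_gap[of c] by (auto simp: itin_def)
qed (simp add: itin_Suc tent3_reflect)

lemma initial_zeros:
  assumes "c \<in> cantor_set" "\<And>i. i < k \<Longrightarrow> \<not> itin c i"
  shows "(tent3 ^^ k) c = 3 ^ k * c" "c \<le> 1 / 3 ^ k"
proof -
  show *: "(tent3 ^^ k) c = 3 ^ k * c"
    using assms(2)
  proof (induction k)
    case (Suc k)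
    have "(tent3 ^^ k) c \<le> 1/2" using Suc.prems[of k] by (simp add: itin_def not_less)
    moreover have "(tent3 ^^ k) c = 3 ^ k * c" using Suc by simp
    ultimately have "(tent3 ^^ k) c = 3 ^ k * c" "3 ^ k * c \<le> 1/2" by auto
    then show ?case by (simp add: tent3_low)
  qed simp
  have "(tent3 ^^ k) c \<le> 1" using cantor_bounds[of "(tent3 ^^ k) c"] assms(1) by (simp add: funpow_tent3_in_cantor_iff)
  then show "c \<le> 1 / 3 ^ k" unfolding * by (simp add: field_simps)
qed

text \<open>For positive \<open>k\<close> this is the middle gap scaled by a power of 3. These gaps
  separate the blocks that carry the lower half-circles of different sizes.\<close>

lemma cantor_less_imp_le: "c \<in> cantor_set \<Longrightarrow> c < 2 / 3 ^ k \<Longrightarrow> c \<le> 1 / 3 ^ k"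
proof (induction k arbitrary: c)
  case 0
  then show ?case using cantor_bounds(2) by simp
next
  case (Suc k)
  have "(1::real) \<le> 3 ^ k" by simp
  then have "2 / 3 ^ Suc k \<le> (2/3 :: real)" by (simp add: field_simps)
  then have "c \<le> 1/3" using cantor_gap[OF Suc.prems(1)] Suc.prems(2) by linarith
  then have t: "tent3 c = 3 * c" by (simp add: tent3_def)
  have "3 * c < 2 / 3 ^ k" using Suc.prems(2) by (simp add: field_simps)
  moreover have "3 * c \<in> cantor_set" using tent3_in_cantor_iff[of c] Suc.prems(1) t by simp
  ultimately have "3 * c \<le> 1 / 3 ^ k" using Suc.IH by blast
  then show ?case by (simp add: field_simps)
qed

lemma small_not_itin:
  assumes "0 \<le> c" "c \<le> 1 / 3 ^ k" "i < k" shows "\<not> itin c i \<and> (tent3 ^^ Suc i) c = 3 ^ Suc i * c"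
  using assms(3)
proof (induction i)
  case 0
  have "(1::real) * 3 \<le> 3 ^ k" using 0 self_le_power[of 3 k] by (cases k) auto
  then have "1 / 3 ^ k \<le> (1/3 :: real)" by (simp add: field_simps)
  then have "c \<le> 1/3" using assms(2) by linarith
  then show ?case by (simp add: itin_def tent3_def)
next
  case (Suc i)
  have "(3::real) ^ (Suc i + 1) \<le> 3 ^ k" using Suc.prems by (intro power_increasing) auto
  moreover have "3 ^ k * c \<le> 1" using assms(2) by (simp add: field_simps)
  moreover have "3 ^ (Suc i + 1) * c \<le> 3 ^ k * c" using calculation(1) assms(1) by (rule mult_right_mono)
  ultimately have "3 ^ Suc i * c \<le> 1/3" by simp
  moreover have v: "(tent3 ^^ Suc i) c = 3 ^ Suc i * c" using Suc by simp
  moreover have "(tent3 ^^ Suc (Suc i)) c = tent3 ((tent3 ^^ Suc i) c)" by simp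
  then have "(tent3 ^^ Suc (Suc i)) c = tent3 (3 ^ Suc i * c)" by (simp only: v)
  ultimately have "3 ^ Suc i * c \<le> 1/3" "(tent3 ^^ Suc (Suc i)) c = tent3 (3 ^ Suc i * c)" by blast+
  then show ?case using v by (simp add: itin_def tent3_low del: funpow.simps)
qed

text \<open>The block [2/3^(k+1), 3/3^(k+1)] holds the Cantor points whose itinerary begins with
  False \<open>k\<close> times and then True. On it \<open>tent3 ^^ Suc k\<close> is the decreasing
  affine map onto [0, 1], which turns the reflection in the midpoint 5/(2 * 3^(k+1)) into x -> 1 -
  x. Hence exactly entry \<open>Suc k\<close> changes.\<close>

lemma itin_reflect_lower:
  assumes c: "c \<in> cantor_set" "2 / 3 ^ Suc k \<le> c" "c \<le> 3 / 3 ^ Suc k"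
  defines "c' \<equiv> 5 / 3 ^ Suc k - c"
  shows "c' \<in> cantor_set"
    and "itin c' i = (if i = Suc k then \<not> itin c i else itin c i)"
    and "i \<le> k \<Longrightarrow> itin c i \<longleftrightarrow> i = k"
proof -
  have val: "(tent3 ^^ k) x = 3 ^ k * x" "itin x k" "(tent3 ^^ Suc k) x = 3 - 3 ^ Suc k * x"
    "\<And>i. i < k \<Longrightarrow> \<not> itin x i"
    if "2 / 3 ^ Suc k \<le> x" "x \<le> 3 / 3 ^ Suc k" for x
  proof -
    have "0 \<le> x" using that(1) by (rule order_trans[rotated]) simp
    moreover have le: "x \<le> 1 / 3 ^ k" using that(2) by simp
    ultimately have s: "\<And>i. i < k \<Longrightarrow> \<not> itin x i \<and> (tent3 ^^ Suc i) x = 3 ^ Suc i * x"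
      by (rule small_not_itin)
    then show "\<And>i. i < k \<Longrightarrow> \<not> itin x i" by blast
    show v: "(tent3 ^^ k) x = 3 ^ k * x" using s by (cases k) auto
    have ge: "2/3 \<le> 3 ^ k * x" using that(1) by (simp add: field_simps)
    then show "itin x k" by (simp add: itin_def v)
    show "(tent3 ^^ Suc k) x = 3 - 3 ^ Suc k * x" using ge by (simp add: v tent3_high)
  qed
  have c': "2 / 3 ^ Suc k \<le> c'" "c' \<le> 3 / 3 ^ Suc k"
    using c(2,3) unfolding c'_def by (auto simp: field_simps)
  note v = val[OF c(2,3)] and v' = val[OF c']
  have "3 ^ Suc k * c' = 5 - 3 ^ Suc k * c" unfolding c'_def right_diff_distrib by simp
  then have r: "(tent3 ^^ Suc k) c' = 1 - (tent3 ^^ Suc k) c"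
    unfolding v(3) v'(3) by simp
  have m: "(tent3 ^^ Suc k) c \<in> cantor_set" using c(1) funpow_tent3_in_cantor_iff by blast
  then show "c' \<in> cantor_set" using r cantor_reflect funpow_tent3_in_cantor_iff by metis
  have "itin c' (Suc k + j) = (if j = 0 then \<not> itin c (Suc k + j) else itin c (Suc k + j))" for j
  proof -
    have eq: "itin x (Suc k + j) = itin ((tent3 ^^ Suc k) x) j" for x
      unfolding itin_def by (subst add.commute) (simp only: funpow_add o_apply)
    show ?thesis unfolding eq r using itin_reflect[OF m, of j] by (auto simp del: funpow.simps)
  qed
  from this[of "i - Suc k"] v v' show "itin c' i = (if i = Suc k then \<not> itin c i else itin c i)"
    by (cases i k rule: linorder_cases) auto
  show "i \<le> k \<Longrightarrow> itin c i \<longleftrightarrow> i = k" using v by (cases "i = k") auto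
qed

text \<open>Both branches take the value 1/2 at 1, so the choice made there is invisible, and all
  other choices agree.\<close>

lemma thread_flip:
  assumes "\<And>i. i \<noteq> n \<Longrightarrow> b i = b' i" "thread b x n = 1"
  shows "thread b x = thread b' x"
proof
  fix m
  have eq: "thread b x i = thread b' x i" if "i \<le> n" for i
    by (rule thread_cong) (use assms(1) that in auto)
  have "thread b x (n + j) = thread b' x (n + j)" for j
  proof (induction j)
    case (Suc j)
    show ?case
    proof (cases "j = 0")
      case True
      then show ?thesis using assms(2) eq[of n] by simp
    next
      case False
      then show ?thesis using Suc assms(1)[of "n + j"] by simp
    qed
  qed (simp add: eq)
  from this[of "m - n"] show "thread b x m = thread b' x m"
    using eq[of m] by (cases "m \<le> n") auto
qed

text \<open>This is the orbit 1, 0, 0, ... of \<open>alpha1\<close>. Consequently at most one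
  coordinate of a point of \<open>M1\<close> equals 1.\<close>

lemma M1_one_imp_zero:
  assumes "y \<in> M1" "y n = 1" "i < n" shows "y i = 0"
proof -
  obtain k where n: "n = Suc k" using assms(3) by (cases n) auto
  have "y k = 0" using M1_alpha1[OF assms(1), of k] assms(2) by (simp add: n alpha1_def)
  moreover have "i \<le> k" using assms(3) n by simp
  ultimately show ?thesis using M1_agree[OF assms(1) zero_in_M1, of k i] by simp
qed

text \<open>Two codes of one point can differ only where the coordinate is 1, and there is at most
  one such place.\<close>

lemma thread_eq_cases:
  assumes x: "x \<in> {0..1}" and eq: "thread b x = thread b' x"
  shows "b = b' \<or> (\<exists>n. thread b x n = 1 \<and> (\<forall>i. b' i = (if i = n then \<not> b i else b i)))"
proof (cases "b = b'")
  case False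
  have *: "thread b x n = 1" if "b n \<noteq> b' n" for n
    using fun_cong[OF eq, of "Suc n"] fun_cong[OF eq, of n] branch_eq_iff[of "thread b x n" "b n" "b' n"]
      thread_mem[OF x, of b n] that by simp
  obtain n where n: "b n \<noteq> b' n" using False by blast
  have "b' i = (if i = n then \<not> b i else b i)" for i
  proof (cases "b i = b' i")
    case False
    have "i = n" using M1_one_imp_zero[OF thread_in_M1[OF x, of b]] *[OF n] *[OF False]
      by (metis linorder_neqE_nat zero_neq_one)
    then show ?thesis using False by simp
  qed (use n in auto)
  then show ?thesis using *[OF n] by blast
qed simp

text \<open>The points of the buckethandle that lie over the itinerary of \<open>c\<close>: as \<open>x\<close> decreases from 1 to 0,
  the point moves down the half of an upper half-circle that ends at \<open>c\<close>, and from there, starting at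
  \<open>x = c / 2\<close>, along a quarter of a lower circle. The crossing time \<open>c / 2\<close> tends to 0 with \<open>c\<close>,
  because there is no lower half-circle at 0.\<close>

definition quarter :: "real \<Rightarrow> real \<Rightarrow> real \<Rightarrow> real \<Rightarrow> real \<times> real" where
  "quarter s m c z = (m + (c - m) * (1 - z), s * sqrt ((c - m)\<^sup>2 - ((c - m) * (1 - z))\<^sup>2))"

text \<open>For a positive Cantor point this is the index of the block containing it, and so of the
  lower half-circles that end there. At 0 no \<open>n\<close> qualifies and the value is
  unspecified; \<open>bjk_point\<close> does not consult it there for nonnegative
  \<open>x\<close>.\<close>

definition level :: "real \<Rightarrow> nat" where
  "level c = (LEAST n. 2 / 3 ^ n \<le> c)"

definition bjk_point :: "real \<Rightarrow> real \<Rightarrow> real \<times> real" where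
  "bjk_point c x = (if c / 2 \<le> x then quarter 1 (1/2) c ((x - c / 2) / (1 - c / 2))
     else quarter (- 1) (5 / (2 * 3 ^ level c)) c (1 - 2 * x / c))"

lemma bjk_point_half: "bjk_point c (c / 2) = (c, 0)"
  unfolding bjk_point_def quarter_def by simp

lemma level_eqI:
  assumes "2 / 3 ^ n \<le> c" "c \<le> 3 / 3 ^ n" shows "level c = n"
  unfolding level_def
proof (rule Least_equality)
  fix m assume m: "2 / 3 ^ m \<le> c"
  show "n \<le> m"
  proof (rule ccontr)
    assume "\<not> n \<le> m"
    then have "(3::real) ^ (m + 1) \<le> 3 ^ n" by (intro power_increasing) auto
    then have "3 / 3 ^ n \<le> 3 / (3::real) ^ (m + 1)" by (intro divide_left_mono) auto
    also have "\<dots> < 2 / 3 ^ m" by (simp add: field_simps)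
    finally show False using m assms(2) by simp
  qed
qed fact

lemma level_exists:
  assumes "c \<in> cantor_set" "0 < c"
  shows "\<exists>k. level c = Suc k \<and> 2 / 3 ^ Suc k \<le> c \<and> c \<le> 3 / 3 ^ Suc k"
proof -
  obtain n where "(1/3::real) ^ n < c / 2" using real_arch_pow_inv[of "c/2" "1/3"] assms(2) by auto
  then have "2 / 3 ^ n \<le> c" by (simp add: power_divide)
  then have L: "2 / 3 ^ level c \<le> c" unfolding level_def by (rule LeastI)
  then have "level c \<noteq> 0" using cantor_bounds[OF assms(1)] by (cases "level c") auto
  then obtain k where k: "level c = Suc k" using not0_implies_Suc by blast
  then have "\<not> 2 / 3 ^ k \<le> c" using not_less_Least[of k "\<lambda>n. 2 / 3 ^ n \<le> c"] by (simp add: level_def)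
  then have "c \<le> 1 / 3 ^ k" using cantor_less_imp_le[OF assms(1)] by simp
  then show ?thesis using L k by auto
qed

lemma quarter_circle:
  assumes "z \<in> {0..1}" "quarter s m c z = (X, Y)" "s\<^sup>2 = 1"
  shows "(X - m)\<^sup>2 + Y\<^sup>2 = (c - m)\<^sup>2" "0 \<le> s * Y"
proof -
  have "(c - m)\<^sup>2 * (1 - z)\<^sup>2 \<le> (c - m)\<^sup>2 * 1"
    by (intro mult_left_mono power_le_one) (use assms(1) in auto)
  then have le: "((c - m) * (1 - z))\<^sup>2 \<le> (c - m)\<^sup>2" by (simp add: power_mult_distrib)
  show "(X - m)\<^sup>2 + Y\<^sup>2 = (c - m)\<^sup>2"
    using assms(2,3) le by (auto simp: quarter_def power_mult_distrib)
  have "s * Y = s\<^sup>2 * sqrt ((c - m)\<^sup>2 - ((c - m) * (1 - z))\<^sup>2)"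
    using assms(2) by (auto simp: quarter_def power2_eq_square)
  then show "0 \<le> s * Y" using le assms(3) by simp
qed

lemma quarter_snd_eq_0:
  assumes "z \<in> {0..1}" "c \<noteq> m" "s\<^sup>2 = 1" "snd (quarter s m c z) = 0"
  shows "z = 0"
proof -
  have "(c - m)\<^sup>2 = (c - m)\<^sup>2 * (1 - z)\<^sup>2"
    using assms(3,4) by (auto simp: quarter_def power_mult_distrib)
  then have "(1 - z)\<^sup>2 = 1" using assms(2) by simp
  then show ?thesis using assms(1) by (auto simp: power2_eq_1_iff)
qed

text \<open>Equal distance from the common centre makes the endpoints equal or mirror images. In the
  mirrored case the two quarters lie on opposite sides of the centre and meet only at
  \<open>z = 1\<close>, the point farthest from the axis.\<close>

lemma quarter_eqD:
  assumes "z \<in> {0..1}" "z' \<in> {0..1}" "c \<noteq> m" "c' \<noteq> m" "s\<^sup>2 = 1" "quarter s m c z = quarter s m c' z'"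
  shows "c = c' \<and> z = z' \<or> c + c' = 2 * m \<and> z = 1 \<and> z' = 1"
proof -
  obtain X Y where XY: "quarter s m c z = (X, Y)" by fastforce
  have "(c - m)\<^sup>2 = (c' - m)\<^sup>2"
    using quarter_circle(1)[OF assms(1) XY assms(5)] quarter_circle(1)[OF assms(2) XY[unfolded assms(6)] assms(5)] by simp
  then consider "c - m = c' - m" | "c - m = - (c' - m)" by (auto simp: power2_eq_iff)
  moreover have e: "(c - m) * (1 - z) = (c' - m) * (1 - z')" using assms(6) by (simp add: quarter_def)
  ultimately show ?thesis
  proof cases
    case 1
    then show ?thesis using e assms(4) by simp
  next
    case 2
    have "(c' - m) * ((1 - z) + (1 - z')) = 0" using e unfolding 2 by (simp add: algebra_simps)
    then have "(1 - z) + (1 - z') = 0" using assms(4) by simp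
    then show ?thesis using 2 assms(1,2) by auto
  qed
qed

lemma quarter_surj:
  assumes "(X - m)\<^sup>2 + Y\<^sup>2 = r\<^sup>2" "0 < r" "0 \<le> s * Y" "s\<^sup>2 = 1"
  shows "\<exists>c\<in>{m - r, m + r}. \<exists>z\<in>{0..1}. quarter s m c z = (X, Y)"
proof -
  have le: "\<bar>X - m\<bar> \<le> r"
    using assms(1,2) abs_le_square_iff[of "X - m" r] zero_le_power2[of Y] by simp
  define c where "c = (if m \<le> X then m + r else m - r)"
  define z where "z = 1 - \<bar>X - m\<bar> / r"
  have cz: "(c - m) * (1 - z) = X - m" using assms(2) by (auto simp: c_def z_def)
  have "(c - m)\<^sup>2 = r\<^sup>2" by (auto simp: c_def)
  then have "(c - m)\<^sup>2 - (X - m)\<^sup>2 = (s * Y)\<^sup>2" using assms(1,4) by (simp add: power_mult_distrib)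
  then have "s * sqrt ((c - m)\<^sup>2 - (X - m)\<^sup>2) = s * (s * Y)" using assms(3) by simp
  also have "\<dots> = Y" using assms(4) by (simp add: power2_eq_square flip: mult.assoc)
  finally have "quarter s m c z = (X, Y)" unfolding quarter_def cz by simp
  moreover have "z \<in> {0..1}" using le assms(2) by (auto simp: z_def)
  moreover have "c \<in> {m - r, m + r}" by (simp add: c_def)
  ultimately show ?thesis by blast
qed

lemma cantor_neq_half: "c \<in> cantor_set \<Longrightarrow> c \<noteq> 1/2"
  using cantor_gap[of c] by auto

text \<open>A centre in the Cantor set would be fixed by the reflection, which nevertheless changes
  entry \<open>Suc k\<close> of its itinerary.\<close>

lemma cantor_neq_centre:
  assumes "c \<in> cantor_set" "2 / 3 ^ Suc k \<le> c" "c \<le> 3 / 3 ^ Suc k"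
  shows "c \<noteq> 5 / (2 * 3 ^ Suc k)"
proof
  assume "c = 5 / (2 * 3 ^ Suc k)"
  then have "5 / 3 ^ Suc k - c = c" by (simp add: field_simps)
  then show False using itin_reflect_lower(2)[OF assms, of "Suc k"] by simp
qed

section \<open>The common fibres of the two quotient maps\<close>

definition bjk_dom :: "(real \<times> real) set" where
  "bjk_dom = cantor_set \<times> {0..1}"

text \<open>At \<open>x = 1\<close> entry 0 is free, and the point is the top of an upper
  half-circle. At \<open>x = 0\<close>, with the first True of the itinerary at position
  \<open>k\<close>, entry \<open>Suc k\<close> is free, and the point is the bottom of a lower
  half-circle. Only \<open>c\<close> has to be placed in the block: its mirror image then lies there
  as well.\<close>

definition glued :: "real \<Rightarrow> real \<Rightarrow> real \<Rightarrow> real \<Rightarrow> bool" where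
  "glued c x c' x' \<longleftrightarrow> c = c' \<and> x = x' \<or> x = 1 \<and> x' = 1 \<and> c + c' = 1 \<or>
     x = 0 \<and> x' = 0 \<and> (\<exists>k. c \<in> {2 / 3 ^ Suc k..3 / 3 ^ Suc k} \<and> c + c' = 5 / 3 ^ Suc k)"

lemma thread_eq_iff_glued:
  assumes c: "c \<in> cantor_set" "c' \<in> cantor_set" and x: "x \<in> {0..1}" "x' \<in> {0..1}"
  shows "thread (itin c) x = thread (itin c') x' \<longleftrightarrow> glued c x c' x'"
proof
  assume eq: "thread (itin c) x = thread (itin c') x'"
  have xx: "x = x'" using fun_cong[OF eq, of 0] by simp
  from thread_eq_cases[OF x(1) eq[folded xx]]
  show "glued c x c' x'"
  proof
    assume "itin c = itin c'"
    then show ?thesis using cantor_eqI[OF c] xx by (simp add: glued_def)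
  next
    assume "\<exists>n. thread (itin c) x n = 1 \<and> (\<forall>i. itin c' i = (if i = n then \<not> itin c i else itin c i))"
    then obtain n where n: "thread (itin c) x n = 1" "\<And>i. itin c' i = (if i = n then \<not> itin c i else itin c i)"
      by blast
    show ?thesis
    proof (cases n)
      case 0
      have "1 - c = c'"
        by (rule cantor_eqI) (use c cantor_reflect itin_reflect[OF c(1)] n(2) 0 in auto)
      then show ?thesis using n(1) 0 xx by (auto simp: glued_def)
    next
      case (Suc k)
      have z: "thread (itin c) x i = 0" if "i \<le> k" for i
        using M1_one_imp_zero[OF thread_in_M1[OF x(1)] n(1)] that Suc by simp
      \<comment> \<open>Coordinates up to \<open>k\<close> are 0 and the next one is 1, so the code
        selects the branch that keeps 0 at 0 before position \<open>k\<close> and the one that lifts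
        0 to 1 at \<open>k\<close>. This places \<open>c\<close> in its block.\<close>
      have b: "itin c i \<longleftrightarrow> i = k" if "i \<le> k" for i
      proof (cases "i = k")
        case True
        then show ?thesis using n(1) z[of k] by (simp add: Suc split: if_splits)
      next
        case False
        then show ?thesis using z[of i] z[of "Suc i"] that by (simp split: if_splits)
      qed
      have "(tent3 ^^ k) c = 3 ^ k * c" "c \<le> 1 / 3 ^ k"
        using initial_zeros[OF c(1), of k] b by auto
      moreover have "2/3 \<le> (tent3 ^^ k) c" using itin_True[OF c(1)] b by blast
      ultimately have cc: "2 / 3 ^ Suc k \<le> c" "c \<le> 3 / 3 ^ Suc k" by (auto simp: field_simps)
      have "5 / 3 ^ Suc k - c = c'"
        by (rule cantor_eqI) (use c itin_reflect_lower[OF c(1) cc] n(2) Suc in auto)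
      moreover have "x = 0" using z[of 0] by simp
      ultimately show ?thesis using xx cc by (auto simp: glued_def)
    qed
  qed
next
  assume "glued c x c' x'"
  then consider "c = c'" "x = x'" | "x = 1" "x' = 1" "c' = 1 - c"
    | k where "x = 0" "x' = 0" "2 / 3 ^ Suc k \<le> c" "c \<le> 3 / 3 ^ Suc k" "c' = 5 / 3 ^ Suc k - c"
    by (auto simp: glued_def algebra_simps)
  then show "thread (itin c) x = thread (itin c') x'"
  proof cases
    case 2
    have "thread (itin c) 1 = thread (itin c') 1"
      by (rule thread_flip[of 0]) (use itin_reflect[OF c(1)] 2 in auto)
    then show ?thesis using 2 by simp
  next
    case 3
    note i = itin_reflect_lower[OF c(1) 3(3,4), folded 3(5)]
    have "thread (itin c) 0 i = 0" if "i \<le> k" for i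
      using that by (induction i) (auto simp: i(3))
    then have "thread (itin c) 0 (Suc k) = 1" using i(3)[of k] by simp
    then have "thread (itin c) 0 = thread (itin c') 0"
      by (intro thread_flip[of "Suc k"]) (use i(2) in auto)
    then show ?thesis using 3 by simp
  qed simp
qed

lemma bjk_point_upper:
  assumes "c \<in> cantor_set" "x \<in> {0..1}" "c / 2 \<le> x"
  shows "(x - c / 2) / (1 - c / 2) \<in> {0..1}"
    and "bjk_point c x = quarter 1 (1/2) c ((x - c / 2) / (1 - c / 2))"
  using assms cantor_bounds[OF assms(1)] by (auto simp: bjk_point_def field_simps)

lemma bjk_point_lower:
  assumes "c \<in> cantor_set" "x \<in> {0..1}" "\<not> c / 2 \<le> x"
  obtains k where "level c = Suc k" "2 / 3 ^ Suc k \<le> c" "c \<le> 3 / 3 ^ Suc k"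
    "1 - 2 * x / c \<in> {0<..1}" "bjk_point c x = quarter (- 1) (5 / (2 * 3 ^ Suc k)) c (1 - 2 * x / c)"
proof -
  have c: "0 < c" using assms cantor_bounds[OF assms(1)] by auto
  have "1 - 2 * x / c \<in> {0<..1}" using c assms by (auto simp: field_simps)
  then show ?thesis using level_exists[OF assms(1) c] that assms(3) by (auto simp: bjk_point_def)
qed

lemma quarter_fst_between:
  assumes "z \<in> {0..1}" "c \<in> {l..u}" "m \<in> {l..u}"
  shows "fst (quarter s m c z) \<in> {l..u}"
proof -
  have "fst (quarter s m c z) = z *\<^sub>R m + (1 - z) *\<^sub>R c" by (simp add: quarter_def algebra_simps)
  also have "\<dots> \<in> {l..u}"
    using convexD[OF convex_closed_interval[of l u] , of m c z "1 - z"] assms by simp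
  finally show ?thesis .
qed

text \<open>The sign of the second coordinate separates upper from lower arcs, with points on the
  axis counted as upper. The horizontal extent of a lower arc stays within its block and so reveals
  the level. What remains is to compare circles with one common centre.\<close>

lemma bjk_point_eq_iff_glued:
  assumes c: "c \<in> cantor_set" "c' \<in> cantor_set" and x: "x \<in> {0..1}" "x' \<in> {0..1}"
  shows "bjk_point c x = bjk_point c' x' \<longleftrightarrow> glued c x c' x'"
proof
  assume eq: "bjk_point c x = bjk_point c' x'"
  have up: "0 \<le> snd (bjk_point c x)" if "c \<in> cantor_set" "x \<in> {0..1}" "c / 2 \<le> x" for c x
    using bjk_point_upper[OF that] quarter_circle(2)[of _ 1] by (metis mult_1 one_power2 prod.collapse)
  have low: "snd (bjk_point c x) < 0" if h: "c \<in> cantor_set" "x \<in> {0..1}" "\<not> c / 2 \<le> x" for c x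
  proof -
    obtain k where k: "2 / 3 ^ Suc k \<le> c" "c \<le> 3 / 3 ^ Suc k"
      "1 - 2 * x / c \<in> {0<..1}" "bjk_point c x = quarter (- 1) (5 / (2 * 3 ^ Suc k)) c (1 - 2 * x / c)"
      using bjk_point_lower[OF h] by metis
    have "0 \<le> - snd (bjk_point c x)" using quarter_circle(2)[of "1 - 2 * x / c" "- 1" _ c] k(3,4)
      by (metis atLeastAtMost_iff greaterThanAtMost_iff less_imp_le mult_minus1 power2_minus one_power2 prod.collapse)
    moreover have "snd (bjk_point c x) \<noteq> 0"
      using quarter_snd_eq_0[of "1 - 2 * x / c" c "5 / (2 * 3 ^ Suc k)" "- 1"] k cantor_neq_centre[OF h(1) k(1,2)] by auto
    ultimately show ?thesis by simp
  qed
  show "glued c x c' x'"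
  proof (cases "c / 2 \<le> x")
    case True
    then have T': "c' / 2 \<le> x'" using up[OF c(1) x(1)] low[OF c(2) x(2)] eq by fastforce
    note u = bjk_point_upper[OF c(1) x(1) True] and u' = bjk_point_upper[OF c(2) x(2) T']
    have d: "1 - c / 2 > 0" "1 - c' / 2 > 0" using cantor_bounds c by force+
    have "c = c' \<and> (x - c / 2) / (1 - c / 2) = (x' - c' / 2) / (1 - c' / 2) \<or>
        c + c' = 2 * (1/2) \<and> (x - c / 2) / (1 - c / 2) = 1 \<and> (x' - c' / 2) / (1 - c' / 2) = 1"
      using quarter_eqD[OF u(1) u'(1), of c "1/2" c' 1] eq u(2) u'(2) cantor_neq_half c by simp
    then show ?thesis using d by (auto simp: glued_def divide_eq_eq)
  next
    case False
    then have F': "\<not> c' / 2 \<le> x'" using up[OF c(2) x(2)] low[OF c(1) x(1)] eq by fastforce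
    obtain k where k: "2 / 3 ^ Suc k \<le> c" "c \<le> 3 / 3 ^ Suc k"
      "1 - 2 * x / c \<in> {0<..1}" "bjk_point c x = quarter (- 1) (5 / (2 * 3 ^ Suc k)) c (1 - 2 * x / c)"
      using bjk_point_lower[OF c(1) x(1) False] by metis
    obtain k' where k': "2 / 3 ^ Suc k' \<le> c'" "c' \<le> 3 / 3 ^ Suc k'"
      "1 - 2 * x' / c' \<in> {0<..1}" "bjk_point c' x' = quarter (- 1) (5 / (2 * 3 ^ Suc k')) c' (1 - 2 * x' / c')"
      using bjk_point_lower[OF c(2) x(2) F'] by metis
    have m: "5 / (2 * 3 ^ Suc j) \<in> {2 / 3 ^ Suc j..(3::real) / 3 ^ Suc j}" for j by (simp add: field_simps)
    have z: "1 - 2 * x / c \<in> {0..1}" "1 - 2 * x' / c' \<in> {0..1}" using k(3) k'(3) by auto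
    have "fst (bjk_point c x) \<in> {2 / 3 ^ Suc k..3 / 3 ^ Suc k}"
      unfolding k(4) by (rule quarter_fst_between) (use k z m in auto)
    moreover have "fst (bjk_point c x) \<in> {2 / 3 ^ Suc k'..3 / 3 ^ Suc k'}"
      unfolding eq k'(4) by (rule quarter_fst_between) (use k' z m in auto)
    ultimately have "Suc k = Suc k'" using level_eqI by (metis atLeastAtMost_iff)
    then have kk: "k' = k" by simp
    have "c = c' \<and> 1 - 2 * x / c = 1 - 2 * x' / c' \<or>
        c + c' = 2 * (5 / (2 * 3 ^ Suc k)) \<and> 1 - 2 * x / c = 1 \<and> 1 - 2 * x' / c' = 1"
      using quarter_eqD[OF z, of c "5 / (2 * 3 ^ Suc k)" c' "- 1"] eq k(4) k'(4)
        cantor_neq_centre[OF c(1) k(1,2)] cantor_neq_centre[OF c(2) k'(1,2)] unfolding kk by simp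
    moreover have "0 < c" "0 < c'" using False F' x by auto
    ultimately show ?thesis using k(1,2) by (auto simp: glued_def divide_eq_eq)
  qed
next
  have refl1: "quarter s m c 1 = quarter s m c' 1" if "c + c' = 2 * m" for s m c c'
  proof -
    have "c - m = - (c' - m)" using that by simp
    then have sq: "(c - m)\<^sup>2 = (c' - m)\<^sup>2" by (metis power2_minus)
    show ?thesis unfolding quarter_def by (simp add: sq del: real_sqrt_abs)
  qed
  assume "glued c x c' x'"
  then consider "c = c'" "x = x'" | "x = 1" "x' = 1" "c + c' = 1"
    | k where "x = 0" "x' = 0" "2 / 3 ^ Suc k \<le> c" "c \<le> 3 / 3 ^ Suc k" "c' = 5 / 3 ^ Suc k - c"
    by (auto simp: glued_def algebra_simps)
  then show "bjk_point c x = bjk_point c' x'"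
  proof cases
    case 2
    then show ?thesis using refl1[of c c' "1/2" 1] cantor_bounds c by (force simp: bjk_point_def)
  next
    case 3
    then have c': "2 / 3 ^ Suc k \<le> c'" "c' \<le> 3 / 3 ^ Suc k" by (auto simp: field_simps)
    have "(0::real) < 2 / 3 ^ Suc k" by simp
    then have "0 < c" "0 < c'" using 3(3) c'(1) by linarith+
    then show ?thesis
      using refl1[of c c' "5 / (2 * 3 ^ Suc k)" "- 1"] level_eqI[OF 3(3,4)] level_eqI[OF c'] 3(1,2,5)
      by (simp add: bjk_point_def)
  qed simp
qed

lemma bjk_point_image: "(\<lambda>(c, x). bjk_point c x) ` bjk_dom = BJK"
proof
  show "(\<lambda>(c, x). bjk_point c x) ` bjk_dom \<subseteq> BJK"
  proof (clarsimp simp: bjk_dom_def)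
    fix c x :: real assume c: "c \<in> cantor_set" and "0 \<le> x" "x \<le> 1"
    then have x: "x \<in> {0..1}" by simp
    obtain X Y where XY: "bjk_point c x = (X, Y)" by fastforce
    show "bjk_point c x \<in> BJK"
    proof (cases "c / 2 \<le> x")
      case True
      note u = bjk_point_upper[OF c x True]
      have "(X - 1/2)\<^sup>2 + Y\<^sup>2 = (c - 1/2)\<^sup>2" "0 \<le> 1 * Y"
        using quarter_circle[OF u(1), of 1 "1/2" c X Y] u(2) XY by auto
      then have "(X, Y) \<in> upper_half_circle (1/2) \<bar>c - 1/2\<bar>" by (simp add: upper_half_circle_def)
      moreover have "0 < \<bar>c - 1/2\<bar>" using cantor_neq_half[OF c] by simp
      moreover have "{1/2 - \<bar>c - 1/2\<bar>, 1/2 + \<bar>c - 1/2\<bar>} = {c, 1 - c}" by (auto simp: abs_if)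
      then have "{1/2 - \<bar>c - 1/2\<bar>, 1/2 + \<bar>c - 1/2\<bar>} \<subseteq> cantor_set" using c cantor_reflect by simp
      ultimately show ?thesis unfolding XY BJK_def by blast
    next
      case False
      obtain k where k: "2 / 3 ^ Suc k \<le> c" "c \<le> 3 / 3 ^ Suc k"
        "1 - 2 * x / c \<in> {0<..1}" "bjk_point c x = quarter (- 1) (5 / (2 * 3 ^ Suc k)) c (1 - 2 * x / c)"
        using bjk_point_lower[OF c x False] by metis
      define m :: real where "m = 5 / (2 * 3 ^ Suc k)"
      have m2: "2 * m = 5 / 3 ^ Suc k" by (simp add: m_def)
      have "(X - m)\<^sup>2 + Y\<^sup>2 = (c - m)\<^sup>2" "0 \<le> - 1 * Y"
        using quarter_circle[of "1 - 2 * x / c" "- 1" m c X Y] k(3,4) XY by (auto simp: m_def)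
      then have "(X, Y) \<in> lower_half_circle m \<bar>c - m\<bar>" by (simp add: lower_half_circle_def)
      moreover have "0 < \<bar>c - m\<bar>" using cantor_neq_centre[OF c k(1,2)] by (simp add: m_def)
      moreover have "{m - \<bar>c - m\<bar>, m + \<bar>c - m\<bar>} = {c, 5 / 3 ^ Suc k - c}"
        unfolding m2[symmetric] by (auto simp: abs_if)
      then have "{m - \<bar>c - m\<bar>, m + \<bar>c - m\<bar>} \<subseteq> cantor_set \<inter> {2 / 3 ^ Suc k..1 / 3 ^ (Suc k - 1)}"
        using c itin_reflect_lower(1)[OF c k(1,2)] k(1,2) by (auto simp: field_simps)
      ultimately show ?thesis unfolding XY BJK_def m_def
        by (intro UnI2 UN_I[of "Suc k"] UnionI) auto
    qed
  qed
  have mem: "p \<in> (\<lambda>(c, x). bjk_point c x) ` bjk_dom"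
    if "c \<in> cantor_set" "x \<in> {0..1}" "bjk_point c x = p" for c x p
    using that by (force simp: bjk_dom_def)
  show "BJK \<subseteq> (\<lambda>(c, x). bjk_point c x) ` bjk_dom"
  proof
    fix p assume p: "p \<in> BJK"
    obtain X Y where XY: "p = (X, Y)" by fastforce
    from p consider r where "0 < r" "{1/2 - r, 1/2 + r} \<subseteq> cantor_set" "p \<in> upper_half_circle (1/2) r"
      | n r where "n \<ge> 1" "0 < r" "p \<in> lower_half_circle (5 / (2 * 3 ^ n)) r"
        "{5 / (2 * 3 ^ n) - r, 5 / (2 * 3 ^ n) + r} \<subseteq> cantor_set \<inter> {2 / 3 ^ n..1 / 3 ^ (n - 1)}"
      unfolding BJK_def by blast
    then show "p \<in> (\<lambda>(c, x). bjk_point c x) ` bjk_dom"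
    proof cases
      case 1
      then obtain c z where cz: "c \<in> cantor_set" "z \<in> {0..1}" "quarter 1 (1/2) c z = p"
        using quarter_surj[of X "1/2" Y r 1] by (force simp: XY upper_half_circle_def)
      define x where "x = c / 2 + z * (1 - c / 2)"
      have d: "0 < 1 - c / 2" "0 \<le> c" using cantor_bounds[OF cz(1)] by auto
      then have le: "c / 2 \<le> x" using cz(2) by (simp add: x_def)
      moreover have "0 \<le> (1 - z) * (1 - c / 2)" using cz(2) d by simp
      then have "x \<le> 1" by (simp add: x_def field_simps)
      ultimately have "x \<in> {0..1}" using d by simp
      moreover have "bjk_point c x = p" using le d cz(3) by (simp add: bjk_point_def x_def)
      ultimately show ?thesis using mem cz(1) by blast
    next
      case 2
      then obtain k where n: "n = Suc k" by (cases n) auto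
      obtain c z where cz: "c \<in> {5 / (2 * 3 ^ n) - r, 5 / (2 * 3 ^ n) + r}" "z \<in> {0..1}"
          "quarter (- 1) (5 / (2 * 3 ^ n)) c z = p"
        using quarter_surj[of X "5 / (2 * 3 ^ n)" Y r "- 1"] 2(2,3) by (force simp: XY lower_half_circle_def)
      have c: "c \<in> cantor_set" "2 / 3 ^ n \<le> c" "c \<le> 3 / 3 ^ n" using cz(1) 2(4) by (auto simp: n)
      have "(0::real) < 2 / 3 ^ n" by simp
      then have c0: "0 < c" using c(2) by linarith
      define x where "x = c / 2 * (1 - z)"
      have z: "1 - 2 * x / c = z" using c0 by (simp add: x_def)
      have x: "x \<le> c / 2" "0 \<le> x" using c0 cz(2) by (auto simp: x_def mult_le_cancel_left1)
      then have "x \<in> {0..1}" using cantor_bounds[OF c(1)] by simp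
      moreover have "bjk_point c x = p"
      \<comment> \<open>At \<open>z = 0\<close> the lower arc reaches the axis and
        \<open>x = c / 2\<close> falls under the upper formula of \<open>bjk_point\<close>, which
        gives the same point.\<close>
      proof (cases "z = 0")
        case True
        then have "x = c / 2" "p = (c, 0)" using cz(3) by (simp_all add: x_def quarter_def)
        then show ?thesis using bjk_point_half by blast
      next
        case False
        then have "\<not> c / 2 \<le> x" using c0 cz(2) by (auto simp: x_def)
        then show ?thesis using cz(3) z level_eqI[OF c(2,3)] by (simp add: bjk_point_def)
      qed
      ultimately show ?thesis using mem c(1) by blast
    qed
  qed
qed

section \<open>Continuity of the two quotient maps\<close>

lemma continuous_on_quarter [continuous_intros]:
  assumes "continuous_on S f" "continuous_on S g"
  shows "continuous_on S (\<lambda>p. quarter s m (f p) (g p))"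
  unfolding quarter_def by (intro continuous_intros assms)

text \<open>The centre and the radius of a lower circle are bounded by multiples of
  \<open>c\<close>, so the lower arcs shrink to the origin. This gives continuity there, where
  infinitely many levels accumulate. The 4 is the sum of the bounds \<open>2 * c\<close> for the two
  coordinates.\<close>

lemma bjk_point_lower_bound:
  assumes "c \<in> cantor_set" "x \<in> {0..1}" "x \<le> c / 2"
  shows "norm (bjk_point c x) \<le> 4 * c"
proof (cases "c / 2 \<le> x")
  case True
  then have x: "x = c / 2" using assms(3) by simp
  have "bjk_point c x = (c, 0)" unfolding x by (rule bjk_point_half)
  then show ?thesis using cantor_bounds[OF assms(1)] by simp
next
  case False
  obtain k where k: "2 / 3 ^ Suc k \<le> c" "c \<le> 3 / 3 ^ Suc k"
    "1 - 2 * x / c \<in> {0<..1}" "bjk_point c x = quarter (- 1) (5 / (2 * 3 ^ Suc k)) c (1 - 2 * x / c)"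
    using bjk_point_lower[OF assms(1,2) False] by metis
  define m :: real where "m = 5 / (2 * 3 ^ Suc k)"
  obtain X Y where XY: "bjk_point c x = (X, Y)" by fastforce
  have "(X - m)\<^sup>2 + Y\<^sup>2 = (c - m)\<^sup>2"
    using quarter_circle(1)[of "1 - 2 * x / c" "- 1" m c X Y] k(3,4) XY by (auto simp: m_def)
  then have "\<bar>X - m\<bar> \<le> \<bar>c - m\<bar>" "\<bar>Y\<bar> \<le> \<bar>c - m\<bar>"
    unfolding abs_le_square_iff using zero_le_power2[of Y] zero_le_power2[of "X - m"] by linarith+
  moreover have "0 < m" "m \<le> 5 / 4 * c" "c \<le> 6 / 5 * m" using k(1,2) by (auto simp: m_def field_simps)
  ultimately have "\<bar>X\<bar> \<le> 2 * c" "\<bar>Y\<bar> \<le> 2 * c" by linarith+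
  then show ?thesis unfolding XY using norm_Pair_le[of X Y] by (simp add: real_norm_def)
qed

lemma continuous_on_bjk_point: "continuous_on bjk_dom (\<lambda>p. bjk_point (fst p) (snd p))"
proof -
  define U where "U = {p \<in> bjk_dom. fst p / 2 \<le> snd p}"
  define L where "L = {p \<in> bjk_dom. snd p \<le> fst p / 2}"
  have cl: "closed bjk_dom"
    unfolding bjk_dom_def by (intro closed_Times compact_imp_closed compact_cantor compact_Icc)
  have "closed U" unfolding U_def by (intro closed_Collect_conj closed_Collect_le continuous_intros) (auto simp: cl)
  moreover have "closed L" unfolding L_def by (intro closed_Collect_conj closed_Collect_le continuous_intros) (auto simp: cl)
  moreover have "continuous_on U (\<lambda>p. bjk_point (fst p) (snd p))"
  proof -
    have "continuous_on U (\<lambda>p. quarter 1 (1/2) (fst p) ((snd p - fst p / 2) / (1 - fst p / 2)))"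
      using cantor_bounds(2) by (intro continuous_intros) (force simp: U_def bjk_dom_def)+
    then show ?thesis
      by (rule continuous_on_eq) (auto simp: U_def bjk_point_def)
  qed
  moreover have "continuous_on L (\<lambda>p. bjk_point (fst p) (snd p))"
    unfolding continuous_on_eq_continuous_within
  proof
    fix p assume p: "p \<in> L"
    then have pc: "fst p \<in> cantor_set" "snd p \<in> {0..1}" "snd p \<le> fst p / 2" by (auto simp: L_def bjk_dom_def)
    show "continuous (at p within L) (\<lambda>p. bjk_point (fst p) (snd p))"
    proof (cases "fst p = 0")
      case True
      then have "snd p = 0" using pc by auto
      then have p0: "bjk_point (fst p) (snd p) = 0" using True by (simp add: bjk_point_def quarter_def zero_prod_def)
      have "((\<lambda>q. bjk_point (fst q) (snd q)) \<longlongrightarrow> 0) (at p within L)"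
      proof (rule Lim_null_comparison)
        show "\<forall>\<^sub>F q in at p within L. norm (bjk_point (fst q) (snd q)) \<le> 4 * fst q"
          unfolding eventually_at_filter
          by (rule always_eventually) (auto simp: L_def bjk_dom_def intro: bjk_point_lower_bound)
        have "((\<lambda>q. 4 * fst q) \<longlongrightarrow> 4 * fst p) (at p within L)" by (intro tendsto_intros)
        then show "((\<lambda>q. 4 * fst q) \<longlongrightarrow> 0) (at p within L)" using True by simp
      qed
      then show ?thesis unfolding continuous_within p0 .
    next
      case False
      then have c0: "0 < fst p" using cantor_bounds[OF pc(1)] by simp
      obtain k where k: "2 / 3 ^ Suc k \<le> fst p" "fst p \<le> 3 / 3 ^ Suc k"
        using level_exists[OF pc(1) c0] by auto
      \<comment> \<open>Strictly between 1/3^(k+1) and 2/3^k the Cantor set has no points outside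
        the block of \<open>fst p\<close>. So \<open>level\<close> is constant there and the formula
        with a fixed centre applies.\<close>
      define N where "N = {q :: real \<times> real. 1 / 3 ^ Suc k < fst q \<and> fst q < 2 / 3 ^ k}"
      have "open N" unfolding N_def by (intro open_Collect_conj open_Collect_less continuous_intros)
      moreover have "p \<in> N" using k by (auto simp: N_def field_simps)
      moreover have "continuous_on (L \<inter> N) (\<lambda>p. bjk_point (fst p) (snd p))"
      proof -
        have "continuous_on (L \<inter> N) (\<lambda>q. quarter (- 1) (5 / (2 * 3 ^ Suc k)) (fst q) (1 - 2 * snd q / fst q))"
        proof (intro continuous_intros ballI)
          fix q assume "q \<in> L \<inter> N"
          then have "1 / 3 ^ Suc k < fst q" by (simp add: N_def)
          moreover have "(0::real) < 1 / 3 ^ Suc k" by simp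
          ultimately show "fst q \<noteq> 0" by linarith
        qed
        then show ?thesis
        proof (rule continuous_on_eq)
          fix q assume q: "q \<in> L \<inter> N"
          then have qc: "fst q \<in> cantor_set" "snd q \<le> fst q / 2" by (auto simp: L_def bjk_dom_def)
          have "fst q \<le> 1 / 3 ^ k" using q qc cantor_less_imp_le by (auto simp: N_def)
          moreover have "2 / 3 ^ Suc k \<le> fst q"
            using q cantor_less_imp_le[OF qc(1), of "Suc k"] unfolding N_def by force
          ultimately have "level (fst q) = Suc k" by (intro level_eqI) auto
          moreover have "(0::real) < 2 / 3 ^ Suc k" by simp
          then have "0 < fst q" using \<open>2 / 3 ^ Suc k \<le> fst q\<close> by linarith
          ultimately show "quarter (- 1) (5 / (2 * 3 ^ Suc k)) (fst q) (1 - 2 * snd q / fst q) = bjk_point (fst q) (snd q)"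
            using qc(2) by (auto simp: bjk_point_def quarter_def)
        qed
      qed
      ultimately have "continuous (at p within (L \<inter> N)) (\<lambda>p. bjk_point (fst p) (snd p))"
        using p by (simp add: continuous_on_eq_continuous_within)
      moreover have "at p within (L \<inter> N) = at p within L"
        by (rule at_within_nhd[OF \<open>p \<in> N\<close> \<open>open N\<close>]) blast
      ultimately show ?thesis by simp
    qed
  qed
  moreover have "bjk_dom = U \<union> L" by (auto simp: U_def L_def)
  ultimately show ?thesis using continuous_on_closed_Un[of U L] by simp
qed

lemma continuous_on_thread_itin: "continuous_on bjk_dom (\<lambda>p. thread (itin (fst p)) (snd p))"
proof (rule continuous_on_coordinatewise_then_product)
  fix n
  \<comment> \<open>A continuous ramp, equal to 0 up to 1/3 and to 1 from 2/3 on. Orbits of Cantor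
    points avoid the gap, so along them the ramp agrees with the discontinuous itinerary, and
    \<open>f\<close> agrees with \<open>thread\<close>.\<close>
  define \<beta> where "\<beta> c = max 0 (min 1 (3 * c - 1))" for c :: real
  define f where "f = rec_nat (\<lambda>p. snd p) (\<lambda>n g p. (1 - (1 - 2 * \<beta> ((tent3 ^^ n) (fst p))) * sqrt (1 - g p)) / 2)"
  have f0: "f 0 p = snd p"
    and fS: "f (Suc n) p = (1 - (1 - 2 * \<beta> ((tent3 ^^ n) (fst p))) * sqrt (1 - f n p)) / 2" for n p
    by (simp_all add: f_def)
  have "continuous_on bjk_dom (f n)" for n
  proof (induction n)
    case 0
    then show ?case unfolding f0 by (intro continuous_intros)
  next
    case (Suc n)
    have t: "continuous_on bjk_dom (\<lambda>p. (tent3 ^^ n) (fst p))"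
      by (rule continuous_on_compose2[OF continuous_on_funpow_tent3[of UNIV]]) (auto intro!: continuous_intros)
    show ?case unfolding fS \<beta>_def by (intro continuous_intros t Suc) auto
  qed
  moreover have "f n p = thread (itin (fst p)) (snd p) n" if "p \<in> bjk_dom" for p
  proof (induction n)
    case (Suc n)
    have c: "fst p \<in> cantor_set" using that by (auto simp: bjk_dom_def)
    have "\<beta> ((tent3 ^^ n) (fst p)) = (if itin (fst p) n then 1 else 0)"
      using itin_True[OF c, of n] itin_False[OF c, of n] by (auto simp: \<beta>_def)
    then show ?case unfolding fS Suc by (simp add: branch_def)
  qed (simp add: f0)
  ultimately show "continuous_on bjk_dom (\<lambda>p. thread (itin (fst p)) (snd p) n)"
    by (rule continuous_on_eq)
qed

lemma thread_itin_image: "(\<lambda>p. thread (itin (fst p)) (snd p)) ` bjk_dom = M1"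
proof
  show "(\<lambda>p. thread (itin (fst p)) (snd p)) ` bjk_dom \<subseteq> M1"
    using thread_in_M1 by (force simp: bjk_dom_def)
  show "M1 \<subseteq> (\<lambda>p. thread (itin (fst p)) (snd p)) ` bjk_dom"
  proof
    fix y assume y: "y \<in> M1"
    obtain c where c: "c \<in> cantor_set" "itin c = (\<lambda>n. 1/2 < y (Suc n))" using itin_surj by blast
    have "thread (itin c) (y 0) = y" using M1_eq_thread[OF y] c(2) by simp
    moreover have "(c, y 0) \<in> bjk_dom" using c(1) M1_bounds[OF y] by (simp add: bjk_dom_def)
    ultimately show "y \<in> (\<lambda>p. thread (itin (fst p)) (snd p)) ` bjk_dom" by force
  qed
qed

text \<open>Both spaces are quotients of the product of the Cantor set and the interval with the same fibres,
  so that the compact set of pairs of corresponding points projects injectively onto either of them.\<close>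

theorem M1_homeomorphic_BJK: "M1 homeomorphic BJK"
proof -
  define q where "q p = (thread (itin (fst p)) (snd p), bjk_point (fst p) (snd p))" for p
  have comp: "compact (q ` bjk_dom)"
    unfolding q_def
    by (intro compact_continuous_image continuous_on_Pair continuous_on_thread_itin continuous_on_bjk_point)
       (simp add: bjk_dom_def compact_Times compact_cantor)
  have "inj_on fst (q ` bjk_dom)" "inj_on snd (q ` bjk_dom)"
    using thread_eq_iff_glued bjk_point_eq_iff_glued by (auto simp: inj_on_def q_def bjk_dom_def)
  moreover have "fst ` q ` bjk_dom = M1" "snd ` q ` bjk_dom = BJK"
    using thread_itin_image bjk_point_image by (auto simp: image_image q_def case_prod_beta)
  ultimately have "q ` bjk_dom homeomorphic M1" "q ` bjk_dom homeomorphic BJK"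
    using homeomorphic_compact[OF comp] continuous_on_fst[OF continuous_on_id] continuous_on_snd[OF continuous_on_id]
    by metis+
  then show ?thesis using homeomorphic_sym homeomorphic_trans by metis
qed

section \<open>The composant of the origin\<close>

definition hinv :: "real \<Rightarrow> real" where
  "hinv w = 2 / pi * arcsin (sqrt w)"

definition ray :: "real \<Rightarrow> nat \<Rightarrow> real" where
  "ray u n = hconj (u / 2 ^ n)"

text \<open>The change of parameter from \<open>t\<close>, for which the zeroth coordinate is
  \<open>saw t\<close>, to the parameter in which the homeomorphism doubles. It preserves every
  interval between consecutive integers.\<close>

definition unroll :: "real \<Rightarrow> real" where
  "unroll t = of_int \<lfloor>t\<rfloor> + hinv (frac t)"

lemma hconj_cos: "hconj y = (1 - cos (pi * y)) / 2"
  using cos_double_sin[of "pi * y / 2"] by (simp add: hconj_def field_simps)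

lemma hconj_mem: "hconj y \<in> {0..1}"
  using cos_le_one[of "pi * y"] cos_ge_minus_one[of "pi * y"] by (simp add: hconj_cos)

lemma hconj_simps [simp]: "hconj 0 = 0" "hconj 1 = 1"
  by (auto simp: hconj_def)

lemma hconj_half: "hconj (1/2) = 1/2"
  by (simp add: hconj_cos)

lemma hconj_minus [simp]: "hconj (- y) = hconj y"
  by (simp add: hconj_cos)

lemma hconj_one_minus: "hconj (1 - y) = 1 - hconj y"
  by (simp add: hconj_cos right_diff_distrib cos_diff field_simps)

lemma hconj_add_even: "hconj (y + 2 * of_int m) = hconj y"
proof -
  have "cos (pi * (y + 2 * of_int m)) = cos (pi * y + 2 * pi * of_int m)" by (simp add: algebra_simps)
  also have "\<dots> = cos (pi * y)" by (simp add: cos_add)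
  finally show ?thesis by (simp add: hconj_cos)
qed

lemma alpha1_hconj: "alpha1 (hconj y) = hconj (2 * y)"
proof -
  have "cos (pi * (2 * y)) = 2 * (cos (pi * y))\<^sup>2 - 1"
    using cos_double_cos[of "pi * y"] by (simp add: mult.left_commute)
  then show ?thesis by (simp add: hconj_cos alpha1_def power2_eq_square field_simps)
qed

lemma hconj_strict_mono: "0 \<le> x \<Longrightarrow> x < y \<Longrightarrow> y \<le> 1 \<Longrightarrow> hconj x < hconj y"
  using cos_monotone_0_pi[of "pi * x" "pi * y"] by (simp add: hconj_cos)

lemma hconj_inj: "x \<in> {0..1} \<Longrightarrow> y \<in> {0..1} \<Longrightarrow> hconj x = hconj y \<Longrightarrow> x = y"
  using hconj_strict_mono[of x y] hconj_strict_mono[of y x] by (cases x y rule: linorder_cases) auto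

lemma hinv_mem: "w \<in> {0..1} \<Longrightarrow> hinv w \<in> {0..1}"
proof -
  assume "w \<in> {0..1}"
  then have w: "0 \<le> sqrt w" "sqrt w \<le> 1" by auto
  have "0 \<le> arcsin (sqrt w)" using w arcsin_le_arcsin[of 0 "sqrt w"] by simp
  moreover have "arcsin (sqrt w) \<le> pi / 2" by (rule arcsin_ubound) (use w in linarith)+
  ultimately show ?thesis by (simp add: hinv_def field_simps)
qed

lemma hconj_hinv: "w \<in> {0..1} \<Longrightarrow> hconj (hinv w) = w"
proof -
  assume w: "w \<in> {0..1}"
  then have "0 \<le> sqrt w" "sqrt w \<le> 1" by auto
  then have "sin (arcsin (sqrt w)) = sqrt w" by (intro sin_arcsin) linarith+
  then show ?thesis using w by (simp add: hconj_def hinv_def)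
qed

lemma hinv_hconj: "y \<in> {0..1} \<Longrightarrow> hinv (hconj y) = y"
  using hconj_inj[OF hinv_mem[OF hconj_mem]] hconj_hinv[OF hconj_mem] by blast

lemma hinv_0 [simp]: "hinv 0 = 0" and hinv_1 [simp]: "hinv 1 = 1"
  using hinv_hconj[of 0] hinv_hconj[of 1] by auto

lemma continuous_on_hinv: "continuous_on {0..1} hinv"
proof -
  have "- 1 \<le> sqrt w \<and> sqrt w \<le> 1" if "w \<in> {0..1}" for w :: real
    using that order_trans[of "-1" 0 "sqrt w"] by auto
  then show ?thesis
    unfolding hinv_def by (intro continuous_intros) auto
qed

lemma saw_eq:
  assumes "2 * of_int m - 1 \<le> t" "t \<le> 2 * of_int m + 1"
  shows "saw t = \<bar>t - 2 * of_int m\<bar>"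
  unfolding saw_def
proof (rule antisym)
  show "infdist t (range (\<lambda>k::int. 2 * of_int k)) \<le> \<bar>t - 2 * of_int m\<bar>"
    unfolding dist_real_def[symmetric] by (rule infdist_le) blast
  show "\<bar>t - 2 * of_int m\<bar> \<le> infdist t (range (\<lambda>k::int. 2 * of_int k))"
  proof (subst infdist_notempty)
    show "\<bar>t - 2 * of_int m\<bar> \<le> (INF a\<in>range (\<lambda>k::int. 2 * of_int k). dist t a)"
    proof (rule cINF_greatest)
      fix a assume "a \<in> range (\<lambda>k::int. 2 * real_of_int k)"
      then obtain k :: int where k: "a = 2 * of_int k" by blast
      consider "k = m" | "of_int k \<le> (of_int m :: real) - 1" | "of_int m + 1 \<le> (of_int k :: real)"
        by (metis (mono_tags, opaque_lifting) linorder_neqE_linordered_idom int_less_real_le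
            le_diff_eq of_int_1 of_int_less_iff)
      then show "\<bar>t - 2 * of_int m\<bar> \<le> dist t a"
        by cases (use assms in \<open>auto simp: dist_real_def k abs_if\<close>)
    qed simp
  qed simp
qed

lemma hconj_saw: "hconj (saw u) = hconj u"
proof -
  define m where "m = \<lfloor>(u + 1) / 2\<rfloor>"
  have m: "of_int m \<le> (u + 1) / 2" "(u + 1) / 2 < of_int m + 1"
    unfolding m_def by linarith+
  have "2 * of_int m - 1 \<le> u" "u \<le> 2 * of_int m + 1" using m by (auto simp: field_simps)
  then have "saw u = \<bar>u - 2 * of_int m\<bar>" by (rule saw_eq)
  then have "hconj (saw u) = hconj (u - 2 * of_int m)" by (simp add: abs_if flip: hconj_minus[of "u - 2 * of_int m"])
  also have "\<dots> = hconj u" using hconj_add_even[of u "- m"] by simp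
  finally show ?thesis .
qed

lemma hconj_of_int_add:
  "hconj (of_int k + y) = (if even k then hconj y else 1 - hconj y)"
proof (cases "even k")
  case True
  then obtain m where "k = 2 * m" by auto
  then show ?thesis using hconj_add_even[of y m] by (simp add: add.commute)
next
  case False
  then obtain m where k: "k = 2 * m + 1" by (rule oddE)
  have "hconj (of_int k + y) = hconj (y + 1)" using hconj_add_even[of "y + 1" m] by (simp add: k algebra_simps)
  also have "\<dots> = 1 - hconj y" using hconj_one_minus[of "- y"] by (simp add: add.commute)
  finally show ?thesis using False by simp
qed

lemma frac_mem: "frac (t::real) \<in> {0..1}"
  using frac_ge_0[of t] frac_lt_1[of t] by simp

text \<open>On the intervals that start at an odd integer both \<open>saw\<close> and
  \<open>hconj\<close> are replaced by 1 minus their values on the even ones, so the parity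
  cancels.\<close>

lemma hconj_unroll: "hconj (unroll t) = saw t"
proof -
  have h: "hconj (hinv (frac t)) = frac t" using hconj_hinv[OF frac_mem] .
  have f: "t = of_int \<lfloor>t\<rfloor> + frac t" by (simp add: frac_def)
  show ?thesis
  proof (cases "even \<lfloor>t\<rfloor>")
    case True
    then obtain m where m: "\<lfloor>t\<rfloor> = 2 * m" by auto
    have "t = 2 * of_int m + frac t" using f m by simp
    then have "2 * of_int m - 1 \<le> t" "t \<le> 2 * of_int m + 1"
      using frac_ge_0[of t] frac_lt_1[of t] by linarith+
    then have "saw t = \<bar>t - 2 * of_int m\<bar>" by (rule saw_eq)
    then have "saw t = frac t" using f m frac_ge_0[of t] by simp
    then show ?thesis using True unfolding unroll_def hconj_of_int_add h by simp
  next
    case False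
    then obtain m where "\<lfloor>t\<rfloor> = 2 * m + 1" by (rule oddE)
    then have m: "\<lfloor>t\<rfloor> = 2 * (m + 1) - 1" by simp
    have "t = 2 * of_int (m + 1) - 1 + frac t" using f m by simp
    then have "2 * of_int (m + 1) - 1 \<le> t" "t \<le> 2 * of_int (m + 1) + 1"
      using frac_ge_0[of t] frac_lt_1[of t] by linarith+
    then have "saw t = \<bar>t - 2 * of_int (m + 1)\<bar>" by (rule saw_eq)
    then have "saw t = 1 - frac t" using f m frac_lt_1[of t] by simp
    then show ?thesis using False unfolding unroll_def hconj_of_int_add h by simp
  qed
qed

lemma ray_saw: "(\<lambda>n. hconj (saw (u / 2 ^ n))) = ray u"
  by (simp add: ray_def hconj_saw fun_eq_iff)

lemma hconj_inj_piece:
  assumes "u \<in> {of_int k..of_int k + 1}" "v \<in> {of_int k..of_int k + 1}" "hconj u = hconj v"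
  shows "u = v"
proof -
  have "hconj (of_int k + (u - of_int k)) = hconj (of_int k + (v - of_int k))" using assms(3) by simp
  then have "hconj (u - of_int k) = hconj (v - of_int k)"
    unfolding hconj_of_int_add by (simp split: if_splits)
  then have "u - of_int k = v - of_int k"
    by (rule hconj_inj[rotated 2]) (use assms in auto)
  then show ?thesis by simp
qed

lemma unroll_mem:
  assumes "t \<in> {real k..real k + 1}" shows "unroll t \<in> {real k..real k + 1}"
proof (cases "t = real k + 1")
  case True
  then have "t = of_int (int k + 1)" by simp
  then have "\<lfloor>t\<rfloor> = int k + 1" and fr: "frac t = 0" by (simp_all add: frac_eq_0_iff del: of_int_add)
  then show ?thesis by (simp add: unroll_def fr)
next
  case False
  then have "\<lfloor>t\<rfloor> = int k" using assms by (simp add: floor_eq_iff)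
  then show ?thesis using hinv_mem[OF frac_mem, of t] by (simp add: unroll_def)
qed

section \<open>The parametrization as a reparametrized ray\<close>

lemma rho_eq:
  assumes "0 \<le> t" shows "rho t = ray (unroll t)"
  unfolding rho_def arc_piece_def ray_saw
proof (rule the_equality)
  show "\<forall>k::nat. t \<in> {real k..real k + 1} \<longrightarrow>
      ray (unroll t) \<in> {ray u |u. u \<in> {real k..real k + 1}} \<and> ray (unroll t) 0 = saw t"
    using unroll_mem by (auto simp: ray_def hconj_unroll)
next
  fix x assume *: "\<forall>k::nat. t \<in> {real k..real k + 1} \<longrightarrow> x \<in> {ray u |u. u \<in> {real k..real k + 1}} \<and> x 0 = saw t"
  define k where "k = nat \<lfloor>t\<rfloor>"
  have k: "t \<in> {real k..real k + 1}" using assms unfolding k_def atLeastAtMost_iff by linarith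
  then obtain v where v: "v \<in> {real k..real k + 1}" "x = ray v" "x 0 = saw t" using * by blast
  have "hconj v = hconj (unroll t)" using v by (simp add: ray_def hconj_unroll)
  then have "v = unroll t" using hconj_inj_piece[of v "int k" "unroll t"] v(1) unroll_mem[OF k] by simp
  then show "x = ray (unroll t)" using v(2) by simp
qed

lemma unroll_nonneg: "0 \<le> t \<Longrightarrow> 0 \<le> unroll t"
  using hinv_mem[OF frac_mem, of t] by (simp add: unroll_def)

lemma hinv_less_1: "w \<in> {0..<1} \<Longrightarrow> hinv w < 1"
  using hinv_mem[of w] hconj_hinv[of w] by (cases "hinv w = 1") auto

lemma bij_betw_unroll: "bij_betw unroll {0..} {0..}"
proof (rule bij_betwI[where g = "\<lambda>v. of_int \<lfloor>v\<rfloor> + hconj (frac v)"])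
  show "unroll \<in> {0..} \<rightarrow> {0..}" using unroll_nonneg by auto
  show "(\<lambda>v. of_int \<lfloor>v\<rfloor> + hconj (frac v)) \<in> {0..} \<rightarrow> {0..}"
    using hconj_mem by fastforce
  show "of_int \<lfloor>unroll t\<rfloor> + hconj (frac (unroll t)) = t" for t
  proof -
    have m: "hinv (frac t) \<in> {0..<1}"
      using hinv_mem[OF frac_mem, of t] hinv_less_1[of "frac t"] frac_ge_0[of t] frac_lt_1[of t] by auto
    then have "\<lfloor>unroll t\<rfloor> = \<lfloor>t\<rfloor>" by (simp add: unroll_def floor_eq_iff)
    then have "frac (unroll t) = hinv (frac t)" by (simp add: unroll_def frac_def)
    then show ?thesis using \<open>\<lfloor>unroll t\<rfloor> = \<lfloor>t\<rfloor>\<close> hconj_hinv[OF frac_mem] by (simp add: frac_def)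
  qed
  show "unroll (of_int \<lfloor>v\<rfloor> + hconj (frac v)) = v" for v
  proof -
    have "hconj (frac v) < hconj 1" by (rule hconj_strict_mono) (use frac_mem[of v] frac_lt_1[of v] in auto)
    then have m: "0 \<le> hconj (frac v)" "hconj (frac v) < 1" using hconj_mem[of "frac v"] by auto
    then have fl: "\<lfloor>of_int \<lfloor>v\<rfloor> + hconj (frac v)\<rfloor> = \<lfloor>v\<rfloor>" by (simp add: floor_eq_iff)
    then have "frac (of_int \<lfloor>v\<rfloor> + hconj (frac v)) = hconj (frac v)" by (simp add: frac_def)
    then show ?thesis using fl hinv_hconj[OF frac_mem] by (simp add: unroll_def) (simp add: frac_def)
  qed
qed

text \<open>The floor hides the continuity of \<open>unroll\<close>. In the sum, completed intervals
  contribute 1, the current one contributes a clamped \<open>hinv\<close>, and later ones contribute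
  0; every summand is continuous.\<close>

lemma unroll_eq_sum:
  "t \<in> {0..real N} \<Longrightarrow> unroll t = (\<Sum>k<N. hinv (max 0 (min 1 (t - real k))))"
proof (induction N)
  case 0
  then show ?case by (simp add: unroll_def)
next
  case (Suc N)
  show ?case
  proof (cases "t \<le> real N")
    case True
    then show ?thesis using Suc by simp
  next
    case False
    then have tN: "real N < t" "t \<le> real N + 1" using Suc.prems by auto
    have "(\<Sum>k<N. hinv (max 0 (min 1 (t - real k)))) = (\<Sum>k<N. 1)"
    proof (rule sum.cong)
      fix k assume "k \<in> {..<N}"
      then have "real k + 1 \<le> real N" by (simp add: Suc_leI flip: of_nat_Suc)
      then have "max 0 (min 1 (t - real k)) = 1" using tN by simp
      then show "hinv (max 0 (min 1 (t - real k))) = 1" by simp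
    qed simp
    moreover have "unroll t = real N + hinv (max 0 (min 1 (t - real N)))"
    proof (cases "t = real N + 1")
      case True
      then have "t = of_int (int N + 1)" by simp
      then have "\<lfloor>t\<rfloor> = int N + 1" and fr: "frac t = 0" by (simp_all add: frac_eq_0_iff del: of_int_add)
      then have "unroll t = real N + 1" by (simp add: unroll_def fr)
      then show ?thesis using True by simp
    next
      case False
      then have "\<lfloor>t\<rfloor> = int N" using tN by (simp add: floor_eq_iff)
      then show ?thesis using tN by (simp add: unroll_def frac_def)
    qed
    ultimately show ?thesis by simp
  qed
qed

lemma continuous_on_unroll: "continuous_on {0..} unroll"
  unfolding continuous_on_eq_continuous_within
proof
  fix t :: real assume t: "t \<in> {0..}"
  obtain N where N: "t < real N" using reals_Archimedean2 by blast
  have c: "continuous_on {0..real N} (\<lambda>t. hinv (max 0 (min 1 (t - real k))))" for k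
    by (rule continuous_on_compose2[OF continuous_on_hinv]) (auto intro!: continuous_intros)
  have "continuous_on {0..real N} (\<lambda>t. \<Sum>k<N. hinv (max 0 (min 1 (t - real k))))"
    by (intro continuous_on_sum c)
  then have "continuous_on {0..real N} unroll"
    by (rule continuous_on_eq) (rule unroll_eq_sum[symmetric])
  then have "continuous (at t within {0..real N}) unroll"
    using t N by (auto simp: continuous_on_eq_continuous_within)
  moreover have "at t within {0..real N} = at t within {0..}"
    by (rule at_within_nhd[of t "{..<real N}"]) (use N in auto)
  ultimately show "continuous (at t within {0..}) unroll" by simp
qed

lemma continuous_on_ray: "continuous_on S ray"
proof (rule continuous_on_coordinatewise_then_product)
  show "continuous_on S (\<lambda>u. ray u n)" for n
    unfolding ray_def hconj_def by (intro continuous_intros) auto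
qed

lemma continuous_on_rho: "continuous_on {0..} rho"
proof -
  have "continuous_on {0..} (\<lambda>t. ray (unroll t))"
    by (rule continuous_on_compose2[OF continuous_on_ray continuous_on_unroll]) blast
  then show ?thesis by (rule continuous_on_eq) (simp add: rho_eq)
qed

lemma ray_in_M1: "ray u \<in> M1"
  using hconj_mem by (auto simp: M1_def ray_def alpha1_hconj)

lemma alpha1_tilde_ray: "alpha1_tilde (ray u) = ray (2 * u)"
  by (auto simp: alpha1_tilde_def ray_def alpha1_hconj fun_eq_iff split: nat.splits)

lemma unroll_of_int_add:
  assumes "r \<in> {0..<1}" shows "unroll (of_int k + r) = of_int k + hinv r"
proof -
  have "\<lfloor>of_int k + r\<rfloor> = k" using assms by (simp add: floor_eq_iff)
  then show ?thesis unfolding unroll_def frac_def by simp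
qed

text \<open>Write y for \<open>hinv (frac t)\<close>. Doubling the parameter doubles the integer
  part and turns y into 2y, with a carry exactly when y \<ge> 1/2. Since \<open>hconj\<close> fixes
  1/2, the carry is the case distinction of \<open>g1\<close>; after a carry the interval is an odd
  one, which accounts for the minus sign.\<close>

lemma unroll_g1: "unroll (g1 t) = 2 * unroll t"
proof -
  define y where "y = hinv (frac t)"
  have y: "y \<in> {0..1}" "hconj y = frac t"
    using hinv_mem[OF frac_mem, of t] hconj_hinv[OF frac_mem, of t] by (auto simp: y_def)
  have a: "alpha1 (frac t) = hconj (2 * y)" by (simp add: alpha1_hconj flip: y(2))
  show ?thesis
  proof (cases "frac t < 1/2")
    case True
    have "y < 1/2"
      using hconj_strict_mono[of "1/2" y] y True hconj_half
      by (cases "1/2::real" y rule: linorder_cases) auto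
    then have h: "hconj (2 * y) < 1" "hinv (hconj (2 * y)) = 2 * y"
      using hconj_strict_mono[of "2 * y" 1] y(1) by (auto intro!: hinv_hconj)
    have "g1 t = of_int (2 * \<lfloor>t\<rfloor>) + hconj (2 * y)" using True by (simp add: g1_def a)
    moreover have "unroll (of_int (2 * \<lfloor>t\<rfloor>) + hconj (2 * y)) = of_int (2 * \<lfloor>t\<rfloor>) + 2 * y"
      using unroll_of_int_add[of "hconj (2 * y)" "2 * \<lfloor>t\<rfloor>"] h hconj_mem[of "2 * y"]
      by (simp del: of_int_mult)
    ultimately show ?thesis by (simp add: unroll_def[of t] flip: y_def)
  next
    case False
    have "1/2 \<le> y"
      using hconj_strict_mono[of y "1/2"] y False hconj_half
      by (cases y "1/2::real" rule: linorder_cases) auto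
    then have h: "0 < hconj (2 - 2 * y) \<or> y = 1" "hinv (hconj (2 * y - 1)) = 2 * y - 1"
      using hconj_strict_mono[of 0 "2 - 2 * y"] y(1) by (auto intro!: hinv_hconj)
    have "y \<noteq> 1" using y(2) frac_lt_1[of t] by auto
    have e: "1 - hconj (2 * y) = hconj (2 * y - 1)"
      using hconj_one_minus[of "2 * y"] hconj_minus[of "2 * y - 1"] by simp
    have "hconj (2 - 2 * y) = hconj (2 * y)" using hconj_add_even[of "- (2 * y)" 1] by (simp add: add.commute)
    then have h1: "hconj (2 * y - 1) < 1" using h(1) \<open>y \<noteq> 1\<close> e by simp
    have "g1 t = of_int (2 * \<lfloor>t\<rfloor> + 1) + hconj (2 * y - 1)" using False by (simp add: g1_def a flip: e)
    moreover have "unroll (of_int (2 * \<lfloor>t\<rfloor> + 1) + hconj (2 * y - 1)) = of_int (2 * \<lfloor>t\<rfloor> + 1) + (2 * y - 1)"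
      using unroll_of_int_add[of "hconj (2 * y - 1)" "2 * \<lfloor>t\<rfloor> + 1"] h1 h(2) hconj_mem[of "2 * y - 1"]
      by (simp del: of_int_mult of_int_add)
    ultimately show ?thesis by (simp add: unroll_def[of t] flip: y_def)
  qed
qed

lemma alpha1_tilde_rho:
  assumes "0 \<le> t" shows "alpha1_tilde (rho t) = rho (g1 t)"
proof -
  have "0 \<le> g1 t"
  proof -
    have "0 \<le> real_of_int \<lfloor>t\<rfloor>" using assms by simp
    moreover have "0 \<le> alpha1 (frac t)" "alpha1 (frac t) \<le> 1" using alpha1_mem[OF frac_mem, of t] by auto
    ultimately show ?thesis unfolding g1_def by (auto simp del: of_int_0_le_iff zero_le_floor)
  qed
  then show ?thesis using assms by (simp add: rho_eq alpha1_tilde_ray unroll_g1)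
qed

text \<open>A late coordinate scales both parameters into [0, 1], where \<open>hconj\<close> is
  injective.\<close>

lemma ray_inj: "inj_on ray {0..}"
proof (rule inj_onI)
  fix u v :: real assume uv: "u \<in> {0..}" "v \<in> {0..}" "ray u = ray v"
  obtain n where n: "max u v < 2 ^ n" using real_arch_pow[of 2 "max u v"] by auto
  have "hconj (u / 2 ^ n) = hconj (v / 2 ^ n)" using fun_cong[OF uv(3), of n] by (simp add: ray_def)
  then have "u / 2 ^ n = v / 2 ^ n" by (rule hconj_inj[rotated 2]) (use uv n in auto)
  then show "u = v" by simp
qed

lemma ray_zero: "ray 0 = (\<lambda>_. 0)"
  by (simp add: ray_def fun_eq_iff)

section \<open>The ray and the composant\<close>

lemma ray_in_composant:
  assumes "0 \<le> u" shows "ray u \<in> composant M1 (\<lambda>_. 0)"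
proof -
  obtain n where n: "u < 2 ^ n" using real_arch_pow[of 2 u] by auto
  have "continuum (ray ` {0..u})"
    unfolding continuum_def
    using assms by (auto intro!: compact_continuous_image connected_continuous_image continuous_on_ray)
  \<comment> \<open>Since \<open>u < 2 ^ n\<close>, coordinate \<open>n\<close> never reaches 1 on
    this arc, so the arc is a proper subcontinuum.\<close>
  moreover have "ray ` {0..u} \<noteq> M1"
  proof
    assume eq: "ray ` {0..u} = M1"
    obtain x where "x \<in> M1" "x n = 1" using M1_surj_coord[of 1 n] by auto
    then obtain v where v: "v \<in> {0..u}" "hconj (v / 2 ^ n) = 1" unfolding eq[symmetric] ray_def by auto
    have "hconj (v / 2 ^ n) < hconj 1" by (rule hconj_strict_mono) (use v n in auto)
    then show False using v by simp
  qed
  moreover have "ray ` {0..u} \<subseteq> M1" using ray_in_M1 by blast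
  moreover have "(\<lambda>_. 0) \<in> ray ` {0..u}" using assms by (intro image_eqI[of _ _ 0]) (auto simp: ray_zero)
  moreover have "ray u \<in> ray ` {0..u}" using assms by simp
  ultimately show ?thesis unfolding composant_def by blast
qed

text \<open>A proper subcontinuum through the zero sequence cannot reach 1/2 in a late coordinate,
  for then the preceding projection would be full. So all late branches are the lower one, on which
  \<open>hconj w\<close> passes to \<open>hconj (w / 2)\<close>; the point is \<open>ray\<close> at
  \<open>2 ^ Suc N * w\<close>.\<close>

lemma composant_zero_subset: "composant M1 (\<lambda>_. 0) \<subseteq> ray ` {0..}"
proof
  fix x assume "x \<in> composant M1 (\<lambda>_. 0)"
  then obtain K where K: "continuum K" "K \<subset> M1" "(\<lambda>_. 0) \<in> K" "x \<in> K"
    unfolding composant_def by blast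
  obtain N where N: "\<And>n. N \<le> n \<Longrightarrow> (\<lambda>x. x n) ` K \<noteq> {0..1}"
    using proper_subcontinuum_projection[OF K(1,2)] by blast
  have xM: "x \<in> M1" using K by blast
  have low: "x (Suc n) \<le> 1/2" if n: "N \<le> n" for n
  proof (rule ccontr)
    assume "\<not> x (Suc n) \<le> 1/2"
    moreover have z: "0 \<in> (\<lambda>x. x (Suc n)) ` K" using K(3) by (rule rev_image_eqI) simp
    moreover have "connected ((\<lambda>x. x (Suc n)) ` K)"
      using K(1) unfolding continuum_def
      by (intro connected_continuous_image continuous_on_subset[OF continuous_on_product_coordinates subset_UNIV]) auto
    then have "{0..x (Suc n)} \<subseteq> (\<lambda>x. x (Suc n)) ` K"
      using z K(4) connected_contains_Icc by blast
    ultimately have "1/2 \<in> (\<lambda>x. x (Suc n)) ` K" by auto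
    then have "(\<lambda>x. x n) ` K = {0..1}"
      using projection_full_step[of K 0 n "1/2"] z K(1,2) unfolding continuum_def by auto
    then show False using N[OF n] by blast
  qed
  define w where "w = hinv (x (Suc N))"
  have xm: "x (Suc N) \<in> {0..1}" using M1_bounds[OF xM] by simp
  have w: "w \<in> {0..1}" "hconj w = x (Suc N)" using hinv_mem[OF xm] hconj_hinv[OF xm] by (auto simp: w_def)
  have tail: "x (Suc N + j) = hconj (w / 2 ^ j)" for j
  proof (induction j)
    case (Suc j)
    have "x (Suc N + Suc j) = branch False (x (Suc N + j))"
      using branch_alpha1[of False "x (Suc N + Suc j)"] low[of "Suc N + j"] M1_alpha1[OF xM, of "Suc N + j"] by simp
    also have "\<dots> = branch False (alpha1 (hconj (w / 2 ^ Suc j)))" using Suc by (simp add: alpha1_hconj)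
    also have "\<dots> = hconj (w / 2 ^ Suc j)"
    proof (rule branch_alpha1)
      have "w / 2 ^ Suc j \<le> 1/2"
        using order_trans[of w 1 "2 ^ j"] w(1) by (simp add: field_simps)
      then have "hconj (w / 2 ^ Suc j) \<le> hconj (1/2)"
        using hconj_strict_mono[of "w / 2 ^ Suc j" "1/2"] w(1) by (cases "w / 2 ^ Suc j = 1/2") auto
      then show "if False then 1/2 \<le> hconj (w / 2 ^ Suc j) else hconj (w / 2 ^ Suc j) \<le> 1/2"
        by (simp add: hconj_half)
    qed
    finally show ?case .
  qed (simp add: w)
  have "x n = ray (2 ^ Suc N * w) n" for n
  proof (rule M1_agree[OF xM ray_in_M1])
    show "x (Suc N + n) = ray (2 ^ Suc N * w) (Suc N + n)"
      unfolding tail ray_def by (simp add: power_add)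
  qed simp
  then have "x = ray (2 ^ Suc N * w)" by blast
  then show "x \<in> ray ` {0..}" using w(1) by simp
qed

lemma bij_betw_rho: "bij_betw rho {0..} (composant M1 (\<lambda>n. 0))"
proof -
  have "ray ` {0..} = composant M1 (\<lambda>n. 0)"
    using composant_zero_subset ray_in_composant by auto
  then have "bij_betw ray {0..} (composant M1 (\<lambda>n. 0))" using ray_inj by (simp add: bij_betw_def)
  then have "bij_betw (ray \<circ> unroll) {0..} (composant M1 (\<lambda>n. 0))"
    by (rule bij_betw_trans[OF bij_betw_unroll])
  moreover have "(ray \<circ> unroll) t = rho t" if "t \<in> {0..}" for t using that by (simp add: rho_eq)
  ultimately show ?thesis using bij_betw_cong by blast
qed

section \<open>Weighted composition operators\<close>

lemma L2_rep: "square_integrable (rep_L2 f)"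
  using Quotient_rep_reflp[OF Quotient_L2] by (auto simp: ae_eq_def)

lemma abs_rep_L2: "abs_L2 (rep_L2 f) = f"
  by (rule Quotient_abs_rep[OF Quotient_L2])

lemma abs_L2_eqI:
  assumes "square_integrable f" "square_integrable g" "AE t in lborel. f t = g t"
  shows "abs_L2 f = abs_L2 g"
  by (rule Quotient_rel_abs[OF Quotient_L2]) (use assms in \<open>simp add: ae_eq_def\<close>)

lemma rep_abs_L2:
  assumes "square_integrable f" shows "AE t in lborel. rep_L2 (abs_L2 f) t = f t"
  using Quotient_rep_abs[OF Quotient_L2, of f] assms by (simp add: ae_eq_def)

lemma abs_L2_add:
  "square_integrable f \<Longrightarrow> square_integrable g \<Longrightarrow> abs_L2 f + abs_L2 g = abs_L2 (\<lambda>t. f t + g t)"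
  by (rule plus_L2.abs_eq) (auto simp: ae_eq_def)

lemma abs_L2_scaleC:
  "square_integrable f \<Longrightarrow> scaleC_L2 c (abs_L2 f) = abs_L2 (\<lambda>t. c * f t)"
  by (rule scaleC_L2.abs_eq) (auto simp: ae_eq_def)

lemma cinner_abs_L2:
  "square_integrable f \<Longrightarrow> square_integrable g \<Longrightarrow>
    cinner_L2 (abs_L2 f) (abs_L2 g) = (\<integral>t. f t * cnj (g t) \<partial>lborel)"
  by (rule cinner_L2.abs_eq) (auto simp: ae_eq_def)

lemma norm_abs_L2:
  assumes "square_integrable f"
  shows "ennreal ((norm (abs_L2 f))\<^sup>2) = (\<integral>\<^sup>+t. ennreal ((cmod (f t))\<^sup>2) \<partial>lborel)"
proof -
  have i: "integrable lborel (\<lambda>t. (cmod (f t))\<^sup>2)" using assms by (simp add: square_integrable_def)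
  have "cinner_L2 (abs_L2 f) (abs_L2 f) = (\<integral>t. complex_of_real ((cmod (f t))\<^sup>2) \<partial>lborel)"
    unfolding cinner_abs_L2[OF assms assms] complex_norm_square[symmetric] by (simp only: of_real_power)
  then have "Re (cinner_L2 (abs_L2 f) (abs_L2 f)) = (\<integral>t. (cmod (f t))\<^sup>2 \<partial>lborel)"
    by (simp del: of_real_power)
  then have "(norm (abs_L2 f))\<^sup>2 = (\<integral>t. (cmod (f t))\<^sup>2 \<partial>lborel)" by (simp add: norm_L2_def)
  then show ?thesis using nn_integral_eq_integral[OF i] by simp
qed

lemma square_integrable_iff:
  "square_integrable f \<longleftrightarrow> f \<in> borel_measurable borel \<and> (\<integral>\<^sup>+t. ennreal ((cmod (f t))\<^sup>2) \<partial>lborel) < \<infinity>"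
  unfolding square_integrable_def by (auto simp: integrable_iff_bounded)

text \<open>The bound is required for all measurable \<open>F\<close>, not only for the squared moduli of functions in the
  Hilbert space: applied to a function that vanishes almost everywhere, it shows that the operator does
  not depend on the choice of representatives.\<close>

definition weighted :: "(real \<Rightarrow> complex) \<Rightarrow> (real \<Rightarrow> real) \<Rightarrow> real \<Rightarrow> bool" where
  "weighted m \<phi> B \<longleftrightarrow> m \<in> borel_measurable borel \<and> \<phi> \<in> borel_measurable borel \<and> 0 \<le> B \<and>
     (\<forall>F::real \<Rightarrow> ennreal. F \<in> borel_measurable borel \<longrightarrow>
       (\<integral>\<^sup>+t. ennreal ((cmod (m t))\<^sup>2) * F (\<phi> t) \<partial>lborel) \<le> ennreal (B\<^sup>2) * (\<integral>\<^sup>+t. F t \<partial>lborel))"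

text \<open>The common form of \<open>mult_op\<close>, \<open>U1\<close> and the adjoint of
  \<open>U1\<close>, so that boundedness, products and changes on null sets are treated once for all
  of them.\<close>

definition wcomp :: "(real \<Rightarrow> complex) \<Rightarrow> (real \<Rightarrow> real) \<Rightarrow> op" where
  "wcomp m \<phi> = Blinfun (\<lambda>f. abs_L2 (\<lambda>t. m t * rep_L2 f (\<phi> t)))"

lemma weightedD:
  assumes "weighted m \<phi> B"
  shows "m \<in> borel_measurable borel" "\<phi> \<in> borel_measurable borel" "0 \<le> B"
    "F \<in> borel_measurable borel \<Longrightarrow>
       (\<integral>\<^sup>+t. ennreal ((cmod (m t))\<^sup>2) * F (\<phi> t) \<partial>lborel) \<le> ennreal (B\<^sup>2) * (\<integral>\<^sup>+t. F t \<partial>lborel)"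
  using assms by (auto simp: weighted_def)

lemma weighted_bound:
  assumes w: "weighted m \<phi> B" and f: "f \<in> borel_measurable borel"
  shows "(\<lambda>t. m t * f (\<phi> t)) \<in> borel_measurable borel"
    "(\<integral>\<^sup>+t. ennreal ((cmod (m t * f (\<phi> t)))\<^sup>2) \<partial>lborel) \<le>
       ennreal (B\<^sup>2) * (\<integral>\<^sup>+t. ennreal ((cmod (f t))\<^sup>2) \<partial>lborel)"
proof -
  note [measurable] = weightedD(1,2)[OF w] f
  show "(\<lambda>t. m t * f (\<phi> t)) \<in> borel_measurable borel" by measurable
  have "(\<integral>\<^sup>+t. ennreal ((cmod (m t * f (\<phi> t)))\<^sup>2) \<partial>lborel) =
      (\<integral>\<^sup>+t. ennreal ((cmod (m t))\<^sup>2) * ennreal ((cmod (f (\<phi> t)))\<^sup>2) \<partial>lborel)"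
    by (simp add: norm_mult power_mult_distrib ennreal_mult)
  also have "\<dots> \<le> ennreal (B\<^sup>2) * (\<integral>\<^sup>+t. ennreal ((cmod (f t))\<^sup>2) \<partial>lborel)"
    by (rule weightedD(4)[OF w]) measurable
  finally show "(\<integral>\<^sup>+t. ennreal ((cmod (m t * f (\<phi> t)))\<^sup>2) \<partial>lborel) \<le>
       ennreal (B\<^sup>2) * (\<integral>\<^sup>+t. ennreal ((cmod (f t))\<^sup>2) \<partial>lborel)" .
qed

lemma weighted_square_integrable:
  assumes "weighted m \<phi> B" "square_integrable f"
  shows "square_integrable (\<lambda>t. m t * f (\<phi> t))"
proof -
  have f: "f \<in> borel_measurable borel" "(\<integral>\<^sup>+t. ennreal ((cmod (f t))\<^sup>2) \<partial>lborel) < \<infinity>"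
    using assms(2) by (auto simp: square_integrable_iff)
  have "ennreal (B\<^sup>2) * (\<integral>\<^sup>+t. ennreal ((cmod (f t))\<^sup>2) \<partial>lborel) < \<infinity>"
    using f(2) by (simp add: ennreal_mult_less_top)
  then show ?thesis
    using weighted_bound[OF assms(1) f(1)] by (auto simp: square_integrable_iff)
qed

lemma weighted_cong:
  assumes w: "weighted m \<phi> B" and fg: "f \<in> borel_measurable borel" "g \<in> borel_measurable borel"
    and ae: "AE t in lborel. f t = (g t :: complex)"
  shows "AE t in lborel. m t * f (\<phi> t) = m t * g (\<phi> t)"
proof -
  note [measurable] = weightedD(1,2)[OF w] fg
  let ?F = "\<lambda>t. ennreal (cmod (f t - g t))"
  have "(\<integral>\<^sup>+t. ennreal ((cmod (m t))\<^sup>2) * ?F (\<phi> t) \<partial>lborel) \<le> ennreal (B\<^sup>2) * (\<integral>\<^sup>+t. ?F t \<partial>lborel)"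
    by (rule weightedD(4)[OF w]) measurable
  also have "(\<integral>\<^sup>+t. ?F t \<partial>lborel) = 0"
    by (subst nn_integral_0_iff_AE) (use ae in auto)
  finally have "(\<integral>\<^sup>+t. ennreal ((cmod (m t))\<^sup>2) * ?F (\<phi> t) \<partial>lborel) = 0" by simp
  then have "AE t in lborel. ennreal ((cmod (m t))\<^sup>2) * ?F (\<phi> t) = 0"
    by (subst (asm) nn_integral_0_iff_AE) auto
  then show ?thesis by eventually_elim (auto simp: ennreal_eq_0_iff)
qed

lemma wcomp_aux:
  assumes w: "weighted m \<phi> B"
  defines "T \<equiv> \<lambda>f. abs_L2 (\<lambda>t. m t * rep_L2 f (\<phi> t))"
  shows "square_integrable f \<Longrightarrow> T (abs_L2 f) = abs_L2 (\<lambda>t. m t * f (\<phi> t))"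
    and "norm (T h) \<le> B * norm h" and "bounded_linear T"
    and "T (scaleC_L2 c h) = scaleC_L2 c (T h)"
proof -
  have m: "f \<in> borel_measurable borel" if "square_integrable f" for f
    using that by (simp add: square_integrable_def)
  note sq = weighted_square_integrable[OF w]
  show app: "T (abs_L2 f) = abs_L2 (\<lambda>t. m t * f (\<phi> t))" if f: "square_integrable f" for f
    unfolding T_def
    by (rule abs_L2_eqI) (use sq f L2_rep weighted_cong[OF w m[OF L2_rep] m[OF f] rep_abs_L2[OF f]] in auto)
  show nrm: "norm (T h) \<le> B * norm h" for h
  proof -
    have "ennreal ((norm (T h))\<^sup>2) \<le> ennreal (B\<^sup>2) * ennreal ((norm h)\<^sup>2)"
      using weighted_bound(2)[OF w m[OF L2_rep[of h]]]
      unfolding T_def norm_abs_L2[OF sq[OF L2_rep]] norm_abs_L2[OF L2_rep[of h], unfolded abs_rep_L2] .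
    then have "(norm (T h))\<^sup>2 \<le> (B * norm h)\<^sup>2"
      by (simp add: power_mult_distrib flip: ennreal_mult)
    then show ?thesis by (rule power2_le_imp_le) (use weightedD(3)[OF w] in simp)
  qed
  show sc: "T (scaleC_L2 c h) = scaleC_L2 c (T h)" for c h
  proof -
    have "T (scaleC_L2 c h) = T (abs_L2 (\<lambda>t. c * rep_L2 h t))"
      using abs_L2_scaleC[OF L2_rep, of c h] by (simp add: abs_rep_L2)
    also have "\<dots> = abs_L2 (\<lambda>t. c * (m t * rep_L2 h (\<phi> t)))"
      by (subst app) (auto intro: square_integrable_scale L2_rep simp: mult.left_commute)
    also have "\<dots> = scaleC_L2 c (T h)" unfolding T_def by (rule abs_L2_scaleC[symmetric]) (rule sq[OF L2_rep])
    finally show ?thesis .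
  qed
  show "bounded_linear T"
  proof (rule bounded_linear_intro)
    show "T (f + g) = T f + T g" for f g
    proof -
      have "T (f + g) = T (abs_L2 (\<lambda>t. rep_L2 f t + rep_L2 g t))"
        using abs_L2_add[OF L2_rep L2_rep, of f g] by (simp add: abs_rep_L2)
      also have "\<dots> = abs_L2 (\<lambda>t. m t * rep_L2 f (\<phi> t) + m t * rep_L2 g (\<phi> t))"
        by (subst app) (auto intro: square_integrable_add L2_rep simp: distrib_left)
      also have "\<dots> = T f + T g" unfolding T_def by (rule abs_L2_add[symmetric]) (rule sq[OF L2_rep])+
      finally show ?thesis .
    qed
    show "T (r *\<^sub>R f) = r *\<^sub>R T f" for r f unfolding scaleR_L2_def by (rule sc)
    show "norm (T f) \<le> norm f * B" for f using nrm[of f] by (simp add: mult.commute)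
  qed
qed

lemma wcomp_abs_L2:
  assumes "weighted m \<phi> B" "square_integrable f"
  shows "blinfun_apply (wcomp m \<phi>) (abs_L2 f) = abs_L2 (\<lambda>t. m t * f (\<phi> t))"
  unfolding wcomp_def bounded_linear_Blinfun_apply[OF wcomp_aux(3)[OF assms(1)]]
  by (rule wcomp_aux(1)[OF assms])

lemma wcomp_apply:
  assumes "weighted m \<phi> B"
  shows "blinfun_apply (wcomp m \<phi>) f = abs_L2 (\<lambda>t. m t * rep_L2 f (\<phi> t))"
  unfolding wcomp_def bounded_linear_Blinfun_apply[OF wcomp_aux(3)[OF assms(1)]] by (rule refl)

lemma norm_wcomp_le:
  assumes "weighted m \<phi> B" shows "norm (wcomp m \<phi>) \<le> B"
proof (rule norm_blinfun_bound)
  show "norm (blinfun_apply (wcomp m \<phi>) x) \<le> B * norm x" for x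
    unfolding wcomp_apply[OF assms] by (rule wcomp_aux(2)[OF assms])
qed (rule weightedD(3)[OF assms])

lemma wcomp_in_op_L2: "weighted m \<phi> B \<Longrightarrow> wcomp m \<phi> \<in> op_L2"
  unfolding op_L2_def using wcomp_aux(4) by (simp add: wcomp_apply)

lemma weighted_compose:
  assumes "weighted m \<phi> B" "weighted m' \<phi>' B'"
  shows "weighted (\<lambda>t. m t * m' (\<phi> t)) (\<lambda>t. \<phi>' (\<phi> t)) (B * B')"
  unfolding weighted_def
proof (intro conjI allI impI)
  note [measurable] = weightedD(1,2)[OF assms(1)] weightedD(1,2)[OF assms(2)]
  show "(\<lambda>t. m t * m' (\<phi> t)) \<in> borel_measurable borel" "(\<lambda>t. \<phi>' (\<phi> t)) \<in> borel_measurable borel"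
    by measurable
  show "0 \<le> B * B'" using weightedD(3) assms by simp
  fix F :: "real \<Rightarrow> ennreal" assume [measurable]: "F \<in> borel_measurable borel"
  have "(\<integral>\<^sup>+t. ennreal ((cmod (m t * m' (\<phi> t)))\<^sup>2) * F (\<phi>' (\<phi> t)) \<partial>lborel) =
      (\<integral>\<^sup>+t. ennreal ((cmod (m t))\<^sup>2) * (ennreal ((cmod (m' (\<phi> t)))\<^sup>2) * F (\<phi>' (\<phi> t))) \<partial>lborel)"
    by (simp add: norm_mult power_mult_distrib ennreal_mult mult.assoc)
  also have "\<dots> \<le> ennreal (B\<^sup>2) * (\<integral>\<^sup>+t. ennreal ((cmod (m' t))\<^sup>2) * F (\<phi>' t) \<partial>lborel)"
    by (rule weightedD(4)[OF assms(1), of "\<lambda>t. ennreal ((cmod (m' t))\<^sup>2) * F (\<phi>' t)"]) measurable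
  also have "\<dots> \<le> ennreal (B\<^sup>2) * (ennreal (B'\<^sup>2) * (\<integral>\<^sup>+t. F t \<partial>lborel))"
    by (intro mult_left_mono weightedD(4)[OF assms(2)]) auto
  also have "\<dots> = ennreal ((B * B')\<^sup>2) * (\<integral>\<^sup>+t. F t \<partial>lborel)"
    by (simp add: power_mult_distrib ennreal_mult mult.assoc)
  finally show "(\<integral>\<^sup>+t. ennreal ((cmod (m t * m' (\<phi> t)))\<^sup>2) * F (\<phi>' (\<phi> t)) \<partial>lborel) \<le>
      ennreal ((B * B')\<^sup>2) * (\<integral>\<^sup>+t. F t \<partial>lborel)" .
qed

lemma wcomp_compose:
  assumes "weighted m \<phi> B" "weighted m' \<phi>' B'"
  shows "wcomp m \<phi> o\<^sub>L wcomp m' \<phi>' = wcomp (\<lambda>t. m t * m' (\<phi> t)) (\<lambda>t. \<phi>' (\<phi> t))"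
proof (rule blinfun_eqI)
  fix f
  show "blinfun_apply (wcomp m \<phi> o\<^sub>L wcomp m' \<phi>') f =
      blinfun_apply (wcomp (\<lambda>t. m t * m' (\<phi> t)) (\<lambda>t. \<phi>' (\<phi> t))) f"
    by (simp add: wcomp_apply[OF assms(2)] wcomp_apply[OF weighted_compose[OF assms]]
        wcomp_abs_L2[OF assms(1) weighted_square_integrable[OF assms(2) L2_rep]] mult.assoc)
qed

lemma wcomp_cong_AE:
  assumes w: "weighted m \<phi> B" and m: "m' \<in> borel_measurable borel" "\<phi>' \<in> borel_measurable borel"
    and ae: "AE t in lborel. m t = m' t \<and> \<phi> t = \<phi>' t"
  shows "weighted m' \<phi>' B" "wcomp m \<phi> = wcomp m' \<phi>'"
proof -
  show w': "weighted m' \<phi>' B"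
    unfolding weighted_def
  proof (intro conjI allI impI m weightedD(3)[OF w])
    fix F :: "real \<Rightarrow> ennreal" assume F: "F \<in> borel_measurable borel"
    have "(\<integral>\<^sup>+t. ennreal ((cmod (m' t))\<^sup>2) * F (\<phi>' t) \<partial>lborel) = (\<integral>\<^sup>+t. ennreal ((cmod (m t))\<^sup>2) * F (\<phi> t) \<partial>lborel)"
      by (rule nn_integral_cong_AE) (use ae in eventually_elim, simp)
    then show "(\<integral>\<^sup>+t. ennreal ((cmod (m' t))\<^sup>2) * F (\<phi>' t) \<partial>lborel) \<le> ennreal (B\<^sup>2) * (\<integral>\<^sup>+t. F t \<partial>lborel)"
      using weightedD(4)[OF w F] by simp
  qed
  show "wcomp m \<phi> = wcomp m' \<phi>'"
  proof (rule blinfun_eqI)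
    fix f
    have "abs_L2 (\<lambda>t. m t * rep_L2 f (\<phi> t)) = abs_L2 (\<lambda>t. m' t * rep_L2 f (\<phi>' t))"
    proof (rule abs_L2_eqI)
      show "AE t in lborel. m t * rep_L2 f (\<phi> t) = m' t * rep_L2 f (\<phi>' t)"
        using ae by eventually_elim simp
    qed (rule weighted_square_integrable[OF w L2_rep] weighted_square_integrable[OF w' L2_rep])+
    then show "blinfun_apply (wcomp m \<phi>) f = blinfun_apply (wcomp m' \<phi>') f"
      by (simp add: wcomp_apply[OF w] wcomp_apply[OF w'])
  qed
qed

lemma wcomp_id: "wcomp (\<lambda>_. 1) (\<lambda>t. t) = id_blinfun"
proof -
  have w: "weighted (\<lambda>_. 1) (\<lambda>t. t) 1" by (simp add: weighted_def)
  show ?thesis by (rule blinfun_eqI) (simp add: wcomp_apply[OF w] abs_rep_L2)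
qed

text \<open>\<open>adj\<close> is a definite description. Uniqueness holds because the real part of
  \<open>cinner_L2\<close> is the real inner product of the type, which is nondegenerate.\<close>

lemma adj_eqI:
  assumes "\<And>f g. cinner_L2 (blinfun_apply T f) g = cinner_L2 f (blinfun_apply S g)"
  shows "adj T = S"
  unfolding adj_def
proof (rule the_equality)
  fix S' assume "\<forall>f g. cinner_L2 (blinfun_apply T f) g = cinner_L2 f (blinfun_apply S' g)"
  then have "f \<bullet> blinfun_apply S' g = f \<bullet> blinfun_apply S g" for f g
    using assms unfolding inner_L2_def by simp
  then have "f \<bullet> (blinfun_apply S' g - blinfun_apply S g) = 0" for f g
    by (simp add: inner_diff_right)
  then have "blinfun_apply S' g = blinfun_apply S g" for g
    using inner_eq_zero_iff[of "blinfun_apply S' g - blinfun_apply S g"] by simp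
  then show "S' = S" by (rule blinfun_eqI)
qed (use assms in blast)

lemma mult_op_eq_wcomp: "mult_op a = wcomp a (\<lambda>t. t)"
  by (simp add: mult_op_def wcomp_def)

lemma weighted_mult:
  assumes "a \<in> borel_measurable borel" "\<And>t. cmod (a t) \<le> B"
  shows "weighted a (\<lambda>t. t) B"
  unfolding weighted_def
proof (intro conjI allI impI)
  show "0 \<le> B" using assms(2)[of 0] norm_ge_zero[of "a 0"] by linarith
  fix F :: "real \<Rightarrow> ennreal" assume F: "F \<in> borel_measurable borel"
  have "(\<integral>\<^sup>+t. ennreal ((cmod (a t))\<^sup>2) * F t \<partial>lborel) \<le> (\<integral>\<^sup>+t. ennreal (B\<^sup>2) * F t \<partial>lborel)"
    by (intro nn_integral_mono mult_right_mono ennreal_leI power_mono assms(2)) auto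
  also have "\<dots> = ennreal (B\<^sup>2) * (\<integral>\<^sup>+t. F t \<partial>lborel)"
    by (rule nn_integral_cmult) (use F in simp)
  finally show "(\<integral>\<^sup>+t. ennreal ((cmod (a t))\<^sup>2) * F t \<partial>lborel) \<le> ennreal (B\<^sup>2) * (\<integral>\<^sup>+t. F t \<partial>lborel)" .
qed (use assms in auto)

lemma adj_mult_op:
  assumes a: "a \<in> borel_measurable borel" "\<And>t. cmod (a t) \<le> B"
  shows "adj (mult_op a) = mult_op (\<lambda>t. cnj (a t))"
proof (rule adj_eqI)
  fix f g
  note w = weighted_mult[OF a]
  have w': "weighted (\<lambda>t. cnj (a t)) (\<lambda>t. t) B"
    using a measurable_compose[OF a(1) borel_measurable_continuous_onI[OF continuous_on_cnj[OF continuous_on_id]]]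
    by (intro weighted_mult) auto
  have "cinner_L2 (blinfun_apply (mult_op a) (abs_L2 (rep_L2 f))) (abs_L2 (rep_L2 g)) =
      cinner_L2 (abs_L2 (rep_L2 f)) (blinfun_apply (mult_op (\<lambda>t. cnj (a t))) (abs_L2 (rep_L2 g)))"
    unfolding mult_op_eq_wcomp wcomp_abs_L2[OF w L2_rep] wcomp_abs_L2[OF w' L2_rep]
    by (simp add: cinner_abs_L2 L2_rep weighted_square_integrable[OF w] weighted_square_integrable[OF w'] mult.left_commute mult.assoc)
  then show "cinner_L2 (blinfun_apply (mult_op a) f) g = cinner_L2 f (blinfun_apply (mult_op (\<lambda>t. cnj (a t))) g)"
    by (simp add: abs_rep_L2)
qed

lemma smult_wcomp:
  assumes "weighted m \<phi> B" shows "smult_op c (wcomp m \<phi>) = wcomp (\<lambda>t. c * m t) \<phi>"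
  unfolding smult_op_def wcomp_apply[OF assms] wcomp_def[of "\<lambda>t. c * m t"]
  by (simp add: abs_L2_scaleC[OF weighted_square_integrable[OF assms L2_rep]] mult.assoc)

lemma add_mult_op:
  assumes "a \<in> borel_measurable borel" "\<And>t. cmod (a t) \<le> B" "b \<in> borel_measurable borel" "\<And>t. cmod (b t) \<le> B'"
  shows "mult_op a + mult_op b = mult_op (\<lambda>t. a t + b t)"
proof (rule blinfun_eqI)
  note w = weighted_mult[OF assms(1,2)] and w' = weighted_mult[OF assms(3,4)]
  have "cmod (a t + b t) \<le> B + B'" for t using norm_triangle_mono assms(2,4) by blast
  then have w'': "weighted (\<lambda>t. a t + b t) (\<lambda>t. t) (B + B')" by (intro weighted_mult) (use assms in auto)
  show "blinfun_apply (mult_op a + mult_op b) f = blinfun_apply (mult_op (\<lambda>t. a t + b t)) f" for f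
    unfolding mult_op_eq_wcomp plus_blinfun.rep_eq wcomp_apply[OF w] wcomp_apply[OF w'] wcomp_apply[OF w'']
    by (simp add: abs_L2_add weighted_square_integrable[OF w L2_rep] weighted_square_integrable[OF w' L2_rep] distrib_right)
qed

text \<open>The indicator function of the interval is a nonzero vector that the operator stretches
  by at least \<open>c\<close>.\<close>

lemma norm_mult_op_ge:
  assumes a: "a \<in> borel_measurable borel" "\<And>t. cmod (a t) \<le> B"
    and lu: "l < u" "0 \<le> c" "\<And>t. t \<in> {l<..<u} \<Longrightarrow> c \<le> cmod (a t)"
  shows "c \<le> norm (mult_op a)"
proof -
  note w = weighted_mult[OF a]
  define f where "f = (indicator {l<..<u} :: real \<Rightarrow> complex)"
  have i: "(\<integral>\<^sup>+t. ennreal ((cmod (f t))\<^sup>2) \<partial>lborel) = ennreal (u - l)"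
  proof -
    have "(\<integral>\<^sup>+t. ennreal ((cmod (f t))\<^sup>2) \<partial>lborel) = (\<integral>\<^sup>+t. indicator {l<..<u} t \<partial>lborel)"
      by (rule nn_integral_cong) (auto simp: f_def indicator_def)
    then show ?thesis using lu(1) by simp
  qed
  have f: "square_integrable f"
    unfolding square_integrable_iff i by (simp add: f_def)
  have "ennreal ((c * norm (abs_L2 f))\<^sup>2) = ennreal (c\<^sup>2) * (\<integral>\<^sup>+t. ennreal ((cmod (f t))\<^sup>2) \<partial>lborel)"
    by (simp add: power_mult_distrib ennreal_mult flip: norm_abs_L2[OF f])
  also have "\<dots> = (\<integral>\<^sup>+t. ennreal (c\<^sup>2) * ennreal ((cmod (f t))\<^sup>2) \<partial>lborel)"
    by (rule nn_integral_cmult[symmetric]) (simp add: f_def)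
  also have "\<dots> \<le> (\<integral>\<^sup>+t. ennreal ((cmod (a t * f t))\<^sup>2) \<partial>lborel)"
  proof (rule nn_integral_mono)
    fix t
    have "c\<^sup>2 * (cmod (f t))\<^sup>2 \<le> (cmod (a t * f t))\<^sup>2"
      using lu(2) lu(3)[of t] by (auto simp: f_def indicator_def power_mono)
    then show "ennreal (c\<^sup>2) * ennreal ((cmod (f t))\<^sup>2) \<le> ennreal ((cmod (a t * f t))\<^sup>2)"
      by (simp flip: ennreal_mult)
  qed
  also have "\<dots> = ennreal ((norm (blinfun_apply (mult_op a) (abs_L2 f)))\<^sup>2)"
    unfolding mult_op_eq_wcomp wcomp_abs_L2[OF w f]
    by (rule norm_abs_L2[symmetric]) (rule weighted_square_integrable[OF w f])
  finally have "(c * norm (abs_L2 f))\<^sup>2 \<le> (norm (blinfun_apply (mult_op a) (abs_L2 f)))\<^sup>2"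
    by (simp add: ennreal_le_iff)
  then have "c * norm (abs_L2 f) \<le> norm (blinfun_apply (mult_op a) (abs_L2 f))"
    by (rule power2_le_imp_le) simp
  also have "\<dots> \<le> norm (mult_op a) * norm (abs_L2 f)" by (rule norm_blinfun)
  finally have le: "c * norm (abs_L2 f) \<le> norm (mult_op a) * norm (abs_L2 f)" .
  have "ennreal ((norm (abs_L2 f))\<^sup>2) = ennreal (u - l)" unfolding norm_abs_L2[OF f] i ..
  then have "norm (abs_L2 f) \<noteq> 0" using lu(1) by auto
  then show ?thesis using le by simp
qed

section \<open>The unitary operator\<close>

text \<open>The modulus of the derivative of \<open>gamma1\<close> off the half-integers; unlike
  \<open>deriv\<close>, it has an explicit value everywhere.\<close>

definition weight :: "real \<Rightarrow> real" where
  "weight t = \<bar>4 - 8 * frac t\<bar>"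

text \<open>The inverse of \<open>gamma1\<close> off the half-integers. The two halves of [k, k+1]
  go to [2k, 2k+1] and [2k+1, 2k+2], so the parity of the integer part tells in which half the
  preimage lies.\<close>

definition ginv :: "real \<Rightarrow> real" where
  "ginv s = of_int (\<lfloor>s\<rfloor> div 2) + branch (odd \<lfloor>s\<rfloor>) (frac s)"

definition half_ints :: "real set" where
  "half_ints = range (\<lambda>k::int. of_int k / 2)"

lemma nn_integral_partition:
  fixes \<phi> :: "real \<Rightarrow> int" and G :: "real \<Rightarrow> ennreal"
  assumes [measurable]: "\<phi> \<in> measurable borel (count_space UNIV)" "G \<in> borel_measurable borel"
  shows "(\<integral>\<^sup>+x. G x \<partial>lborel) = (\<integral>\<^sup>+k. (\<integral>\<^sup>+x. G x * indicator {x. \<phi> x = k} x \<partial>lborel) \<partial>count_space UNIV)"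
proof -
  have "(\<integral>\<^sup>+x. G x \<partial>lborel) = (\<integral>\<^sup>+x. (\<integral>\<^sup>+k. G x * indicator {x. \<phi> x = k} x \<partial>count_space UNIV) \<partial>lborel)"
  proof (rule nn_integral_cong)
    fix x
    have "(\<integral>\<^sup>+k. G x * indicator {x. \<phi> x = k} x \<partial>count_space UNIV) = (\<Sum>k\<in>{\<phi> x}. G x * indicator {x. \<phi> x = k} x)"
      by (rule nn_integral_count_space') auto
    then show "G x = (\<integral>\<^sup>+k. G x * indicator {x. \<phi> x = k} x \<partial>count_space UNIV)" by simp
  qed
  also have "\<dots> = (\<integral>\<^sup>+k. (\<integral>\<^sup>+x. G x * indicator {x. \<phi> x = k} x \<partial>lborel) \<partial>count_space UNIV)"
    by (rule nn_integral_count_space_nn_integral) auto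
  finally show ?thesis .
qed

lemma nn_integral_gamma1_piece:
  fixes F :: "real \<Rightarrow> ennreal" and c d :: real
  assumes "F \<in> borel_measurable borel"
  shows "(\<integral>\<^sup>+t. F (4 * (t - c) * (1 - (t - c)) + d) * ennreal (4 - 8 * (t - c)) * indicator {c..c + 1/2} t \<partial>lborel)
    = (\<integral>\<^sup>+t. F t * indicator {d..d + 1} t \<partial>lborel)"
proof -
  let ?g = "\<lambda>t. 4 * (t - c) * (1 - (t - c)) + d"
  have H: "(\<integral>\<^sup>+t. F t * indicator {?g c..?g (c + 1/2)} t \<partial>lborel) =
      (\<integral>\<^sup>+t. F (?g t) * ennreal (4 - 8 * (t - c)) * indicator {c..c + 1/2} t \<partial>lborel)"
  proof (rule nn_integral_substitution_aux)
    show "(?g has_real_derivative 4 - 8 * (t - c)) (at t)" for t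
      by (auto intro!: derivative_eq_intros simp: algebra_simps)
    show "continuous_on {c..c + 1/2} (\<lambda>t. 4 - 8 * (t - c))" by (intro continuous_intros)
  qed (use assms in auto)
  have e: "?g c = d" "?g (c + 1/2) = d + 1" by (simp_all add: field_simps)
  show ?thesis using H unfolding e by (rule sym)
qed

lemma borel_measurable_frac [measurable]: "(frac :: real \<Rightarrow> real) \<in> borel_measurable borel"
  unfolding frac_def by measurable

lemma weight_measurable [measurable]: "weight \<in> borel_measurable borel"
  unfolding weight_def by measurable

lemma gamma1_measurable [measurable]: "gamma1 \<in> borel_measurable borel"
  unfolding gamma1_def by measurable

lemma ginv_measurable [measurable]: "ginv \<in> borel_measurable borel"
proof -
  have [measurable]: "(\<lambda>s::real. h \<lfloor>s\<rfloor>) \<in> borel_measurable borel" for h :: "int \<Rightarrow> real"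
  proof -
    have [measurable]: "h \<in> borel_measurable (count_space UNIV)" by simp
    show ?thesis by measurable
  qed
  have [measurable]: "branch b \<in> borel_measurable borel" for b
    by (intro borel_measurable_continuous_onI continuous_intros)
  have "(\<lambda>s. of_int (\<lfloor>s\<rfloor> div 2) + (if odd \<lfloor>s\<rfloor> then branch True (frac s) else branch False (frac s)))
      \<in> borel_measurable borel"
    by measurable
  also have "(\<lambda>s. of_int (\<lfloor>s\<rfloor> div 2) + (if odd \<lfloor>s\<rfloor> then branch True (frac s) else branch False (frac s))) = ginv"
    by (auto simp: ginv_def fun_eq_iff)
  finally show ?thesis .
qed

lemma floor_frac_eq:
  assumes "t = of_int k + r" "0 \<le> r" "r < 1" shows "\<lfloor>t\<rfloor> = k" "frac t = r"
proof -
  show "\<lfloor>t\<rfloor> = k" using assms by (simp add: floor_eq_iff)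
  then show "frac t = r" using assms(1) by (simp add: frac_def)
qed

lemma half_ints_iff: "t \<in> half_ints \<longleftrightarrow> frac t = 0 \<or> frac t = 1/2"
proof
  assume "t \<in> half_ints"
  then obtain k :: int where k: "t = of_int k / 2" by (auto simp: half_ints_def)
  show "frac t = 0 \<or> frac t = 1/2"
  proof (cases "even k")
    case True
    then obtain m where "k = 2 * m" by auto
    then show ?thesis using floor_frac_eq(2)[of t m 0] k by simp
  next
    case False
    then obtain m where "k = 2 * m + 1" by (rule oddE)
    then have "t = of_int m + 1/2" using k by simp
    then have "frac t = 1/2" by (rule floor_frac_eq(2)) auto
    then show ?thesis ..
  qed
next
  assume "frac t = 0 \<or> frac t = 1/2"
  then have "t = of_int (2 * \<lfloor>t\<rfloor>) / 2 \<or> t = of_int (2 * \<lfloor>t\<rfloor> + 1) / 2" by (auto simp: frac_def)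
  then show "t \<in> half_ints" unfolding half_ints_def by blast
qed

lemma not_half_intsD:
  assumes "t \<notin> half_ints" shows "0 < frac t" "frac t < 1" "frac t \<noteq> 1/2" "0 < weight t"
  using assms frac_ge_0[of t] frac_lt_1[of t] unfolding half_ints_iff weight_def by auto

lemma countable_half_ints: "countable half_ints"
  by (simp add: half_ints_def)

lemma AE_not_half_ints: "AE t in lborel. t \<notin> half_ints"
  by (rule AE_not_in[OF countable_imp_null_set_lborel[OF countable_half_ints]])

text \<open>Change of variables on each unit interval: \<open>gamma1\<close> stretches its halves
  monotonically over the two unit intervals that make up [2k, 2k+2]. Common endpoints form null
  sets.\<close>

lemma nn_integral_gamma1:
  fixes F :: "real \<Rightarrow> ennreal"
  assumes F [measurable]: "F \<in> borel_measurable borel"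
  shows "(\<integral>\<^sup>+t. ennreal (weight t) * F (gamma1 t) \<partial>lborel) = (\<integral>\<^sup>+t. F t \<partial>lborel)"
proof -
  let ?G = "\<lambda>t. ennreal (weight t) * F (gamma1 t)"
  have "(\<integral>\<^sup>+t. ?G t * indicator {t. \<lfloor>t\<rfloor> = k} t \<partial>lborel) = (\<integral>\<^sup>+t. F t * indicator {t. \<lfloor>t / 2\<rfloor> = k} t \<partial>lborel)" for k
  proof -
    let ?c = "of_int k :: real"
    let ?P = "\<lambda>d t. F (4 * (t - ?c) * (1 - (t - ?c)) + d) * ennreal (4 - 8 * (t - ?c)) * indicator {?c..?c + 1/2} t"
    have ne: "AE t in lborel. t \<noteq> ?c \<and> t \<noteq> ?c + 1/2 \<and> t \<noteq> ?c + 1"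
      using AE_lborel_singleton[of ?c] AE_lborel_singleton[of "?c + 1/2"] AE_lborel_singleton[of "?c + 1"]
      by eventually_elim simp
    have ne2: "AE t in lborel. t \<noteq> 2 * ?c \<and> t \<noteq> 2 * ?c + 1 \<and> t \<noteq> 2 * ?c + 2"
      using AE_lborel_singleton[of "2 * ?c"] AE_lborel_singleton[of "2 * ?c + 1"] AE_lborel_singleton[of "2 * ?c + 2"]
      by eventually_elim simp
    have "(\<integral>\<^sup>+t. ?G t * indicator {t. \<lfloor>t\<rfloor> = k} t \<partial>lborel) =
        (\<integral>\<^sup>+t. ?G t * indicator {?c..?c + 1/2} t + ?G t * indicator {?c + 1/2..?c + 1} t \<partial>lborel)"
      by (rule nn_integral_cong_AE, use ne in eventually_elim) (auto simp: indicator_def floor_eq_iff)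
    also have "\<dots> = (\<integral>\<^sup>+t. ?G t * indicator {?c..?c + 1/2} t \<partial>lborel) + (\<integral>\<^sup>+t. ?G t * indicator {?c + 1/2..?c + 1} t \<partial>lborel)"
      by (rule nn_integral_add) auto
    also have "(\<integral>\<^sup>+t. ?G t * indicator {?c..?c + 1/2} t \<partial>lborel) = (\<integral>\<^sup>+t. ?P (2 * ?c) t \<partial>lborel)"
    proof (rule nn_integral_cong_AE, use ne in eventually_elim)
      fix t assume t: "t \<noteq> ?c \<and> t \<noteq> ?c + 1/2 \<and> t \<noteq> ?c + 1"
      show "?G t * indicator {?c..?c + 1/2} t = ?P (2 * ?c) t"
      proof (cases "t \<in> {?c..?c + 1/2}")
        case True
        then have f: "\<lfloor>t\<rfloor> = k" "frac t = t - ?c" using floor_frac_eq[of t k "t - ?c"] by auto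
        then have "weight t = 4 - 8 * (t - ?c)" "gamma1 t = 4 * (t - ?c) * (1 - (t - ?c)) + 2 * ?c"
          using True by (auto simp: weight_def gamma1_def)
        then show ?thesis by (simp add: mult.commute)
      qed simp
    qed
    \<comment> \<open>Reflection in the midpoint of the unit interval makes the decreasing half
      increasing, so one substitution rule serves both halves.\<close>
    also have "(\<integral>\<^sup>+t. ?G t * indicator {?c + 1/2..?c + 1} t \<partial>lborel) =
        (\<integral>\<^sup>+t. ?G (2 * ?c + 1 + - 1 * t) * indicator {?c + 1/2..?c + 1} (2 * ?c + 1 + - 1 * t) \<partial>lborel)"
      by (subst nn_integral_real_affine[of _ "- 1" "2 * ?c + 1"]) auto
    also have "\<dots> = (\<integral>\<^sup>+t. ?P (2 * ?c + 1) t \<partial>lborel)"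
    proof (rule nn_integral_cong_AE, use ne in eventually_elim)
      fix t assume t: "t \<noteq> ?c \<and> t \<noteq> ?c + 1/2 \<and> t \<noteq> ?c + 1"
      show "?G (2 * ?c + 1 + - 1 * t) * indicator {?c + 1/2..?c + 1} (2 * ?c + 1 + - 1 * t) = ?P (2 * ?c + 1) t"
      proof (cases "t \<in> {?c..?c + 1/2}")
        case True
        define s where "s = 2 * ?c + 1 + - 1 * t"
        have "s = ?c + (1 - (t - ?c))" by (simp add: s_def)
        then have f: "\<lfloor>s\<rfloor> = k" "frac s = 1 - (t - ?c)"
          using floor_frac_eq[of s k "1 - (t - ?c)"] True t by auto
        then have "weight s = 4 - 8 * (t - ?c)" using True t by (auto simp: weight_def abs_if)
        moreover have "1/2 < frac s" using f(2) True t by auto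
        then have "gamma1 s = 4 * frac s * (1 - frac s) + 2 * ?c + 1" using f(1) by (simp add: gamma1_def)
        then have "gamma1 s = 4 * (t - ?c) * (1 - (t - ?c)) + (2 * ?c + 1)"
          unfolding f(2) by (simp add: algebra_simps)
        moreover have "s \<in> {?c + 1/2..?c + 1}" using True by (auto simp: s_def)
        ultimately show ?thesis using True unfolding s_def[symmetric] by (simp add: mult.commute)
      next
        case False
        then have "2 * ?c + 1 + - 1 * t \<notin> {?c + 1/2..?c + 1}" by auto
        then show ?thesis using False by simp
      qed
    qed
    also have "(\<integral>\<^sup>+t. ?P (2 * ?c) t \<partial>lborel) + (\<integral>\<^sup>+t. ?P (2 * ?c + 1) t \<partial>lborel) =
        (\<integral>\<^sup>+t. F t * indicator {2 * ?c..2 * ?c + 1} t \<partial>lborel) + (\<integral>\<^sup>+t. F t * indicator {2 * ?c + 1..2 * ?c + 1 + 1} t \<partial>lborel)"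
      unfolding nn_integral_gamma1_piece[OF F] ..
    also have "\<dots> = (\<integral>\<^sup>+t. F t * indicator {2 * ?c..2 * ?c + 1} t + F t * indicator {2 * ?c + 1..2 * ?c + 1 + 1} t \<partial>lborel)"
      by (rule nn_integral_add[symmetric]) auto
    also have "\<dots> = (\<integral>\<^sup>+t. F t * indicator {t. \<lfloor>t / 2\<rfloor> = k} t \<partial>lborel)"
      by (rule nn_integral_cong_AE, use ne2 in eventually_elim) (auto simp: indicator_def floor_eq_iff)
    finally show ?thesis .
  qed
  then have "(\<integral>\<^sup>+k. (\<integral>\<^sup>+t. ?G t * indicator {t. \<lfloor>t\<rfloor> = k} t \<partial>lborel) \<partial>count_space UNIV) =
      (\<integral>\<^sup>+k. (\<integral>\<^sup>+t. F t * indicator {t. \<lfloor>t / 2\<rfloor> = k} t \<partial>lborel) \<partial>count_space UNIV)"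
    by simp
  then show ?thesis
    using nn_integral_partition[of "\<lambda>t. \<lfloor>t\<rfloor>" ?G] nn_integral_partition[of "\<lambda>t. \<lfloor>t / 2\<rfloor>" F] by simp
qed

text \<open>The change of variables as an equality of measures, which carries it over from
  nonnegative to complex integrands.\<close>

lemma lborel_eq_distr_gamma1: "distr (density lborel (\<lambda>t. ennreal (weight t))) borel gamma1 = lborel"
proof (rule measure_eqI)
  fix A assume "A \<in> sets (distr (density lborel (\<lambda>t. ennreal (weight t))) borel gamma1)"
  then have A [measurable]: "A \<in> sets borel" by simp
  have "emeasure (distr (density lborel (\<lambda>t. ennreal (weight t))) borel gamma1) A =
      emeasure (density lborel (\<lambda>t. ennreal (weight t))) (gamma1 -` A \<inter> space lborel)"
    by (subst emeasure_distr) auto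
  also have "\<dots> = (\<integral>\<^sup>+t. ennreal (weight t) * indicator (gamma1 -` A \<inter> space lborel) t \<partial>lborel)"
    by (subst emeasure_density) (use measurable_sets[OF gamma1_measurable A] in auto)
  also have "\<dots> = (\<integral>\<^sup>+t. ennreal (weight t) * indicator A (gamma1 t) \<partial>lborel)"
    by (rule nn_integral_cong) (auto simp: indicator_def)
  also have "\<dots> = emeasure lborel A" by (subst nn_integral_gamma1) auto
  finally show "emeasure (distr (density lborel (\<lambda>t. ennreal (weight t))) borel gamma1) A = emeasure lborel A" .
qed simp

lemma integral_gamma1:
  fixes H :: "real \<Rightarrow> complex"
  assumes [measurable]: "H \<in> borel_measurable borel"
  shows "(\<integral>t. H t \<partial>lborel) = (\<integral>t. weight t *\<^sub>R H (gamma1 t) \<partial>lborel)"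
proof -
  have "(\<integral>t. H t \<partial>lborel) = (\<integral>t. H t \<partial>distr (density lborel (\<lambda>t. ennreal (weight t))) borel gamma1)"
    by (simp add: lborel_eq_distr_gamma1)
  also have "\<dots> = (\<integral>t. H (gamma1 t) \<partial>density lborel (\<lambda>t. ennreal (weight t)))"
    by (rule integral_distr) auto
  also have "\<dots> = (\<integral>t. weight t *\<^sub>R H (gamma1 t) \<partial>lborel)"
    by (rule integral_density) (auto simp: weight_def)
  finally show ?thesis .
qed

lemma alpha1_bounds:
  assumes "0 < x" "x < 1" "x \<noteq> 1/2" shows "0 < alpha1 x" "alpha1 x < 1"
proof -
  show "0 < alpha1 x" using assms by (simp add: alpha1_def)
  have "0 < (1 - 2 * x)\<^sup>2" using assms by simp
  then show "alpha1 x < 1" by (simp add: alpha1_def power2_eq_square algebra_simps)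
qed

text \<open>On integer parts \<open>gamma1\<close> is the binary shift that inserts the bit
  \<open>1/2 < frac t\<close> at the lowest place; on fractional parts it is the logistic map. This
  is the source of its relation to \<open>alpha1_tilde\<close>.\<close>

lemma floor_frac_gamma1:
  assumes "t \<notin> half_ints"
  shows "\<lfloor>gamma1 t\<rfloor> = 2 * \<lfloor>t\<rfloor> + of_bool (1/2 < frac t)" "frac (gamma1 t) = alpha1 (frac t)"
proof -
  have "gamma1 t = of_int (2 * \<lfloor>t\<rfloor> + of_bool (1/2 < frac t)) + alpha1 (frac t)"
    by (auto simp: gamma1_def alpha1_def)
  then show "\<lfloor>gamma1 t\<rfloor> = 2 * \<lfloor>t\<rfloor> + of_bool (1/2 < frac t)" "frac (gamma1 t) = alpha1 (frac t)"
    using floor_frac_eq alpha1_bounds[OF not_half_intsD(1-3)[OF assms]] by (metis less_imp_le)+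
qed

lemma ginv_gamma1:
  assumes "t \<notin> half_ints" shows "ginv (gamma1 t) = t"
proof -
  have "branch (1/2 < frac t) (alpha1 (frac t)) = frac t" by (rule branch_alpha1) auto
  then show ?thesis
    unfolding ginv_def floor_frac_gamma1[OF assms] by (auto simp: frac_def)
qed

lemma gamma1_ginv:
  assumes "s \<notin> half_ints" shows "gamma1 (ginv s) = s" "ginv s \<notin> half_ints"
proof -
  note s = not_half_intsD[OF assms]
  define r where "r = branch (odd \<lfloor>s\<rfloor>) (frac s)"
  have r: "0 < r" "r < 1" "r \<noteq> 1/2" "1/2 < r \<longleftrightarrow> odd \<lfloor>s\<rfloor>"
  proof -
    define q where "q = sqrt (1 - frac s)"
    have "0 < q" "q < 1" using s by (auto simp: q_def)
    moreover have "r = (if odd \<lfloor>s\<rfloor> then (1 + q) / 2 else (1 - q) / 2)" by (simp add: r_def branch_def q_def)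
    ultimately show "0 < r" "r < 1" "r \<noteq> 1/2" "1/2 < r \<longleftrightarrow> odd \<lfloor>s\<rfloor>" by auto
  qed
  have f: "\<lfloor>ginv s\<rfloor> = \<lfloor>s\<rfloor> div 2" "frac (ginv s) = r"
    using floor_frac_eq[of "ginv s" "\<lfloor>s\<rfloor> div 2" r] r by (auto simp: ginv_def r_def)
  then show "ginv s \<notin> half_ints" using r by (simp add: half_ints_iff)
  have "gamma1 (ginv s) = alpha1 r + of_int (2 * (\<lfloor>s\<rfloor> div 2) + of_bool (odd \<lfloor>s\<rfloor>))"
    unfolding gamma1_def f alpha1_def using r by auto
  also have "alpha1 r = frac s" using s unfolding r_def by (intro alpha1_branch) simp
  also have "2 * (\<lfloor>s\<rfloor> div 2) + of_bool (odd \<lfloor>s\<rfloor>) = \<lfloor>s\<rfloor>" by (auto elim!: evenE oddE)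
  finally show "gamma1 (ginv s) = s" by (simp add: frac_def)
qed

section \<open>The operator and its adjoint as weighted compositions\<close>

definition U_mult :: "real \<Rightarrow> complex" where
  "U_mult t = of_real (sqrt (weight t))"

definition V_mult :: "real \<Rightarrow> complex" where
  "V_mult s = of_real (1 / sqrt (weight (ginv s)))"

lemma weight_nonneg: "0 \<le> weight t"
  by (simp add: weight_def)

lemma UV_mult_measurable [measurable]: "U_mult \<in> borel_measurable borel" "V_mult \<in> borel_measurable borel"
  unfolding U_mult_def V_mult_def by measurable

lemma weighted_U: "weighted U_mult gamma1 1"
  unfolding weighted_def
proof (intro conjI allI impI)
  fix F :: "real \<Rightarrow> ennreal" assume F: "F \<in> borel_measurable borel"
  show "(\<integral>\<^sup>+t. ennreal ((cmod (U_mult t))\<^sup>2) * F (gamma1 t) \<partial>lborel) \<le> ennreal (1\<^sup>2) * (\<integral>\<^sup>+t. F t \<partial>lborel)"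
    using nn_integral_gamma1[OF F] by (simp add: U_mult_def weight_nonneg)
qed auto

lemma weighted_V: "weighted V_mult ginv 1"
  unfolding weighted_def
proof (intro conjI allI impI)
  fix F :: "real \<Rightarrow> ennreal" assume F [measurable]: "F \<in> borel_measurable borel"
  have "(\<integral>\<^sup>+t. ennreal ((cmod (V_mult t))\<^sup>2) * F (ginv t) \<partial>lborel) =
      (\<integral>\<^sup>+t. ennreal (weight t) * (ennreal ((cmod (V_mult (gamma1 t)))\<^sup>2) * F (ginv (gamma1 t))) \<partial>lborel)"
    by (rule nn_integral_gamma1[symmetric]) measurable
  also have "\<dots> = (\<integral>\<^sup>+t. F t \<partial>lborel)"
  proof (rule nn_integral_cong_AE, use AE_not_half_ints in eventually_elim)
    fix t assume t: "t \<notin> half_ints"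
    have "(cmod (V_mult (gamma1 t)))\<^sup>2 = 1 / weight t"
      using not_half_intsD(4)[OF t] by (simp add: V_mult_def ginv_gamma1[OF t] norm_divide power_divide)
    then have "ennreal (weight t) * ennreal ((cmod (V_mult (gamma1 t)))\<^sup>2) = 1"
      using not_half_intsD(4)[OF t] by (simp flip: ennreal_mult)
    then show "ennreal (weight t) * (ennreal ((cmod (V_mult (gamma1 t)))\<^sup>2) * F (ginv (gamma1 t))) = F t"
      by (simp add: ginv_gamma1[OF t] flip: mult.assoc)
  qed
  finally show "(\<integral>\<^sup>+t. ennreal ((cmod (V_mult t))\<^sup>2) * F (ginv t) \<partial>lborel) \<le> ennreal (1\<^sup>2) * (\<integral>\<^sup>+t. F t \<partial>lborel)"
    by simp
qed auto

lemma deriv_gamma1: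
  assumes "t \<notin> half_ints" shows "\<bar>deriv gamma1 t\<bar> = weight t"
proof -
  define k where "k = \<lfloor>t\<rfloor>"
  note h = not_half_intsD(1-3)[OF assms]
  have tk: "t = of_int k + frac t" by (simp add: k_def frac_def)
  obtain l d where l: "t \<in> {l<..<l + 1/2}"
    "\<And>x. x \<in> {l<..<l + 1/2} \<Longrightarrow> gamma1 x = 4 * (x - of_int k) * (1 - (x - of_int k)) + d"
  proof (cases "frac t < 1/2")
    case True
    show ?thesis
    proof (rule that[of "of_int k" "2 * of_int k"])
      show "t \<in> {of_int k<..<of_int k + 1/2}"
        unfolding greaterThanLessThan_iff using tk h True by linarith
      fix x assume x: "x \<in> {real_of_int k<..<real_of_int k + 1/2}"
      then have "\<lfloor>x\<rfloor> = k" "frac x = x - of_int k" using floor_frac_eq[of x k "x - of_int k"] by auto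
      then show "gamma1 x = 4 * (x - of_int k) * (1 - (x - of_int k)) + 2 * of_int k"
        using x by (simp add: gamma1_def)
    qed
  next
    case False
    show ?thesis
    proof (rule that[of "of_int k + 1/2" "2 * of_int k + 1"])
      show "t \<in> {of_int k + 1/2<..<of_int k + 1/2 + 1/2}"
        unfolding greaterThanLessThan_iff using tk h False by linarith
      fix x assume x: "x \<in> {real_of_int k + 1/2<..<real_of_int k + 1/2 + 1/2}"
      then have "\<lfloor>x\<rfloor> = k" "frac x = x - of_int k" using floor_frac_eq[of x k "x - of_int k"] by auto
      then show "gamma1 x = 4 * (x - of_int k) * (1 - (x - of_int k)) + (2 * of_int k + 1)"
        using x by (simp add: gamma1_def)
    qed
  qed
  have "((\<lambda>x. 4 * (x - of_int k) * (1 - (x - of_int k)) + d) has_real_derivative 4 - 8 * (t - of_int k)) (at t)"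
    by (auto intro!: derivative_eq_intros simp: algebra_simps)
  then have "(gamma1 has_real_derivative 4 - 8 * (t - of_int k)) (at t)"
    by (rule has_field_derivative_transform_within_open[where S = "{l<..<l + 1/2}"]) (use l in auto)
  then show ?thesis using tk by (simp add: DERIV_imp_deriv weight_def)
qed

lemma U1_eq_wcomp: "U1 = wcomp U_mult gamma1"
proof -
  \<comment> \<open>No value of \<open>deriv\<close> at the half-integers has been established;
    changing a measurable function on a countable set keeps it measurable.\<close>
  have "(\<lambda>t. complex_of_real (sqrt \<bar>deriv gamma1 t\<bar>)) \<in> borel_measurable borel"
    by (rule measurable_discrete_difference[OF UV_mult_measurable(1) countable_half_ints])
       (auto simp: U_mult_def deriv_gamma1)
  moreover have "AE t in lborel. U_mult t = complex_of_real (sqrt \<bar>deriv gamma1 t\<bar>) \<and> gamma1 t = gamma1 t"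
    using AE_not_half_ints by eventually_elim (simp add: U_mult_def deriv_gamma1)
  ultimately have "wcomp U_mult gamma1 = wcomp (\<lambda>t. complex_of_real (sqrt \<bar>deriv gamma1 t\<bar>)) gamma1"
    by (intro wcomp_cong_AE(2)[OF weighted_U]) auto
  then show ?thesis by (simp add: U1_def wcomp_def)
qed

abbreviation V1 :: op where "V1 \<equiv> wcomp V_mult ginv"

lemma V_mult_gamma1: "t \<notin> half_ints \<Longrightarrow> U_mult t * V_mult (gamma1 t) = 1"
  using not_half_intsD(4)[of t] by (simp add: U_mult_def V_mult_def ginv_gamma1 flip: of_real_mult)

lemma V1_U1: "V1 o\<^sub>L U1 = id_blinfun"
proof -
  have "V1 o\<^sub>L U1 = wcomp (\<lambda>t. V_mult t * U_mult (ginv t)) (\<lambda>t. gamma1 (ginv t))"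
    unfolding U1_eq_wcomp by (rule wcomp_compose[OF weighted_V weighted_U])
  also have "\<dots> = wcomp (\<lambda>_. 1) (\<lambda>t. t)"
  proof (rule wcomp_cong_AE(2)[OF weighted_compose[OF weighted_V weighted_U]])
    show "AE t in lborel. V_mult t * U_mult (ginv t) = 1 \<and> gamma1 (ginv t) = t"
      using AE_not_half_ints
    proof eventually_elim
      fix t assume t: "t \<notin> half_ints"
      then show "V_mult t * U_mult (ginv t) = 1 \<and> gamma1 (ginv t) = t"
        using V_mult_gamma1[OF gamma1_ginv(2)[OF t]] by (simp add: gamma1_ginv(1)[OF t] mult.commute)
    qed
  qed auto
  finally show ?thesis by (simp add: wcomp_id)
qed

lemma borel_measurable_cnj:
  "f \<in> borel_measurable M \<Longrightarrow> (\<lambda>x. cnj (f x)) \<in> borel_measurable M"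
  by (rule measurable_compose[OF _ borel_measurable_continuous_onI[OF continuous_on_cnj[OF continuous_on_id]]])

text \<open>Substitution along \<open>gamma1\<close> contributes the factor \<open>weight t\<close>.
  Divided by its square root, which comes from \<open>V_mult\<close>, it leaves
  \<open>U_mult\<close>.\<close>

lemma adj_U1: "adj U1 = V1"
proof (rule adj_eqI)
  fix f g
  define f0 g0 where "f0 = rep_L2 f" and "g0 = rep_L2 g"
  have sq: "square_integrable f0" "square_integrable g0" by (simp_all add: f0_def g0_def L2_rep)
  have [measurable]: "f0 \<in> borel_measurable borel" "g0 \<in> borel_measurable borel"
    using sq by (simp_all add: square_integrable_def)
  have "cinner_L2 (abs_L2 f0) (blinfun_apply V1 (abs_L2 g0)) = (\<integral>t. f0 t * cnj (V_mult t * g0 (ginv t)) \<partial>lborel)"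
    unfolding wcomp_abs_L2[OF weighted_V sq(2)]
    by (rule cinner_abs_L2[OF sq(1) weighted_square_integrable[OF weighted_V sq(2)]])
  also have "\<dots> = (\<integral>t. weight t *\<^sub>R (f0 (gamma1 t) * cnj (V_mult (gamma1 t) * g0 (ginv (gamma1 t)))) \<partial>lborel)"
  proof (rule integral_gamma1)
    show "(\<lambda>t. f0 t * cnj (V_mult t * g0 (ginv t))) \<in> borel_measurable borel"
      by (intro borel_measurable_times borel_measurable_cnj) measurable
  qed
  also have "\<dots> = (\<integral>t. U_mult t * f0 (gamma1 t) * cnj (g0 t) \<partial>lborel)"
  proof (rule integral_cong_AE)
    show "(\<lambda>t. weight t *\<^sub>R (f0 (gamma1 t) * cnj (V_mult (gamma1 t) * g0 (ginv (gamma1 t))))) \<in> borel_measurable lborel"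
      "(\<lambda>t. U_mult t * f0 (gamma1 t) * cnj (g0 t)) \<in> borel_measurable lborel"
      by (intro borel_measurable_times borel_measurable_scaleR borel_measurable_cnj; measurable)+
    show "AE t in lborel. weight t *\<^sub>R (f0 (gamma1 t) * cnj (V_mult (gamma1 t) * g0 (ginv (gamma1 t)))) =
        U_mult t * f0 (gamma1 t) * cnj (g0 t)"
      using AE_not_half_ints
    proof eventually_elim
      fix t assume t: "t \<notin> half_ints"
      have "weight t *\<^sub>R cnj (V_mult (gamma1 t)) = complex_of_real (weight t / sqrt (weight t))"
        by (simp add: V_mult_def ginv_gamma1[OF t] scaleR_conv_of_real)
      also have "\<dots> = U_mult t" unfolding real_div_sqrt[OF weight_nonneg] U_mult_def ..
      finally have w: "weight t *\<^sub>R cnj (V_mult (gamma1 t)) = U_mult t" .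
      have "weight t *\<^sub>R (x * cnj (y * z)) = (weight t *\<^sub>R cnj y) * x * cnj z" for x y z
        by (simp add: scaleR_conv_of_real ac_simps)
      then show "weight t *\<^sub>R (f0 (gamma1 t) * cnj (V_mult (gamma1 t) * g0 (ginv (gamma1 t)))) =
          U_mult t * f0 (gamma1 t) * cnj (g0 t)"
        by (simp only: w ginv_gamma1[OF t])
    qed
  qed
  also have "\<dots> = cinner_L2 (blinfun_apply U1 (abs_L2 f0)) (abs_L2 g0)"
    unfolding U1_eq_wcomp wcomp_abs_L2[OF weighted_U sq(1)]
    by (rule cinner_abs_L2[symmetric, OF weighted_square_integrable[OF weighted_U sq(1)] sq(2)])
  finally show "cinner_L2 (blinfun_apply U1 f) g = cinner_L2 f (blinfun_apply V1 g)"
    by (simp add: f0_def g0_def abs_rep_L2)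
qed

section \<open>Multiplication operators of continuous functions on the inverse limit\<close>

text \<open>The real line winds densely through the inverse limit: the binary digits of the integer part
  (in two's complement for negative numbers) choose the branches of the inverse of the logistic map.\<close>

definition winding :: "real \<Rightarrow> nat \<Rightarrow> real" where
  "winding t = thread (bit \<lfloor>t\<rfloor>) (frac t)"

definition mop :: "((nat \<Rightarrow> real) \<Rightarrow> complex) \<Rightarrow> op" where
  "mop F = mult_op (\<lambda>t. F (winding t))"

lemma winding_in_M1: "winding t \<in> M1"
  unfolding winding_def by (rule thread_in_M1) (use frac_ge_0[of t] frac_lt_1[of t] in auto)

text \<open>The lowest bit of the new integer part records the half in which \<open>frac t\<close>
  lies, and the old bits move up by one place. These are the branch choices of the shifted
  sequence.\<close>

lemma winding_gamma1:
  assumes "t \<notin> half_ints" shows "winding (gamma1 t) = alpha1_tilde (winding t)"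
proof -
  let ?y = "alpha1_tilde (winding t)"
  have "thread (bit \<lfloor>gamma1 t\<rfloor>) (?y 0) = ?y"
  proof (rule thread_eqI)
    show "?y \<in> M1" by (rule alpha1_tilde_in_M1[OF winding_in_M1])
    show "if bit \<lfloor>gamma1 t\<rfloor> n then 1/2 \<le> ?y (Suc n) else ?y (Suc n) \<le> 1/2" for n
    proof (cases n)
      case 0
      then show ?thesis by (auto simp: floor_frac_gamma1[OF assms] bit_0 alpha1_tilde_def winding_def)
    next
      case (Suc m)
      have "bit \<lfloor>gamma1 t\<rfloor> n = bit \<lfloor>t\<rfloor> m"
        unfolding floor_frac_gamma1[OF assms] Suc bit_Suc by (cases "1/2 < frac t") auto
      moreover have "thread (bit \<lfloor>t\<rfloor>) (frac t) m \<le> 1"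
        using M1_bounds(2)[OF winding_in_M1, of t m] by (simp add: winding_def)
      ultimately show ?thesis using branch_bounds[of "thread (bit \<lfloor>t\<rfloor>) (frac t) m" "bit \<lfloor>t\<rfloor> m"]
        by (auto simp: Suc alpha1_tilde_def winding_def)
    qed
  qed
  moreover have "?y 0 = frac (gamma1 t)"
    by (simp add: floor_frac_gamma1[OF assms] alpha1_tilde_def winding_def)
  ultimately show ?thesis by (simp add: winding_def[of "gamma1 t"])
qed

lemma continuous_bounded_M1:
  assumes "continuous_on M1 (F :: _ \<Rightarrow> complex)" obtains B where "\<And>x. x \<in> M1 \<Longrightarrow> cmod (F x) \<le> B"
  using compact_imp_bounded[OF compact_continuous_image[OF assms compact_M1]] by (auto simp: bounded_iff)

lemma winding_measurable:
  assumes "continuous_on M1 (F :: _ \<Rightarrow> complex)"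
  shows "(\<lambda>t. F (winding t)) \<in> borel_measurable borel"
proof (rule measurable_piecewise_restrict)
  let ?C = "range (\<lambda>k::int. {real_of_int k..<real_of_int k + 1})"
  show "countable ?C" by simp
  show "\<Omega> \<inter> space borel \<in> sets borel" if "\<Omega> \<in> ?C" for \<Omega> using that by auto
  show "space borel \<subseteq> \<Union> ?C"
  proof
    fix t :: real
    have "t \<in> {of_int \<lfloor>t\<rfloor>..<of_int \<lfloor>t\<rfloor> + 1}" by simp
    then show "t \<in> \<Union> ?C" by blast
  qed
  fix \<Omega> assume "\<Omega> \<in> ?C"
  then obtain k where \<Omega>: "\<Omega> = {real_of_int k..<real_of_int k + 1}" by auto
  have "continuous_on \<Omega> (\<lambda>t. F (thread (bit k) (t - of_int k)))"
  proof (rule continuous_on_compose2[OF assms])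
    show "continuous_on \<Omega> (\<lambda>t. thread (bit k) (t - of_int k))"
      by (rule continuous_on_compose2[OF continuous_on_thread[of UNIV]]) (auto intro!: continuous_intros)
    show "(\<lambda>t. thread (bit k) (t - of_int k)) ` \<Omega> \<subseteq> M1" using thread_in_M1 by (auto simp: \<Omega>)
  qed
  then have "continuous_on \<Omega> (\<lambda>t. F (winding t))"
  proof (rule continuous_on_eq)
    fix t assume "t \<in> \<Omega>"
    then have "\<lfloor>t\<rfloor> = k" "frac t = t - of_int k" using floor_frac_eq[of t k "t - of_int k"] by (auto simp: \<Omega>)
    then show "F (thread (bit k) (t - of_int k)) = F (winding t)" by (simp add: winding_def)
  qed
  then show "(\<lambda>t. F (winding t)) \<in> borel_measurable (restrict_space borel \<Omega>)"
    by (rule borel_measurable_continuous_on_restrict)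
qed

lemma ex_int_bits: "\<exists>k::int. \<forall>n<N. bit k n = b n"
proof (induction N arbitrary: b)
  case (Suc N)
  obtain k :: int where k: "\<forall>n<N. bit k n = b (Suc n)" using Suc[of "\<lambda>n. b (Suc n)"] by blast
  have "bit (of_bool (b 0) + 2 * k) n = b n" if "n < Suc N" for n
    using that k by (cases n) (auto simp: bit_0 bit_Suc)
  then show ?case by blast
qed simp

text \<open>Finitely many branch choices together with a small range for the zeroth coordinate fix a
  point up to a small distance. An integer with the required lowest bits supplies the
  choices.\<close>

lemma winding_visits:
  assumes F: "continuous_on M1 (F :: _ \<Rightarrow> complex)" and x: "x \<in> M1" and c: "c < cmod (F x)"
  shows "\<exists>l u. l < u \<and> (\<forall>t\<in>{l<..<u}. c < cmod (F (winding t)))"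
proof -
  define b where "b = (\<lambda>n. 1/2 < x (Suc n))"
  have xb: "thread b (x 0) = x" unfolding b_def by (rule M1_eq_thread[OF x])
  obtain d where d: "0 < d" "\<And>y. y \<in> M1 \<Longrightarrow> dist y x < d \<Longrightarrow> dist (F y) (F x) < cmod (F x) - c"
    using F x c unfolding continuous_on_iff by (metis diff_gt_0_iff_gt)
  obtain N where N: "\<And>y z :: nat \<Rightarrow> real. (\<forall>n\<le>N. y n = z n) \<Longrightarrow> dist y z < d / 2"
    using dist_fun_small[of "d / 2"] d(1) by auto
  obtain k :: int where k: "\<And>n. n < N \<Longrightarrow> bit k n = b n" using ex_int_bits by blast
  obtain \<eta> where \<eta>: "0 < \<eta>" "\<And>z. dist z (x 0) < \<eta> \<Longrightarrow> dist (thread b z) x < d / 2"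
    using continuous_on_thread[of UNIV b, unfolded continuous_on_iff, rule_format, of "x 0" "d / 2"] d(1)
    by (auto simp: xb)
  \<comment> \<open>Clamping keeps the translated interval inside [k, k+1]. It stays nondegenerate
    even if the zeroth coordinate of \<open>x\<close> is 0 or 1.\<close>
  define l u where "l = max 0 (x 0 - \<eta>)" and "u = min 1 (x 0 + \<eta>)"
  have "l < u" using M1_bounds[OF x, of 0] \<eta>(1) by (auto simp: l_def u_def)
  moreover have "c < cmod (F (winding t))" if t: "t \<in> {of_int k + l<..<of_int k + u}" for t
  proof -
    define z where "z = t - of_int k"
    have z: "0 < z" "z < 1" "dist z (x 0) < \<eta>" using t by (auto simp: z_def l_def u_def dist_real_def)
    then have w: "winding t = thread (bit k) z"
      using floor_frac_eq[of t k z] by (simp add: winding_def z_def)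
    have "dist (thread (bit k) z) (thread b z) < d / 2"
      using k by (intro N allI impI thread_cong) auto
    moreover have "dist (thread b z) x < d / 2" by (rule \<eta>(2)[OF z(3)])
    ultimately have "dist (winding t) x < d"
      unfolding w using dist_triangle[of "thread (bit k) z" x "thread b z"] by linarith
    then have "cmod (F (winding t) - F x) < cmod (F x) - c"
      using d(2)[OF winding_in_M1] by (simp add: dist_norm)
    then show ?thesis using norm_triangle_ineq2[of "F x" "F (winding t)"] by (simp add: norm_minus_commute)
  qed
  ultimately show ?thesis by (intro exI[of _ "of_int k + l"] exI[of _ "of_int k + u"]) auto
qed

lemma mop_cong: "(\<And>x. x \<in> M1 \<Longrightarrow> F x = G x) \<Longrightarrow> mop F = mop G"
  unfolding mop_def using winding_in_M1 by simp

lemma weighted_mop: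
  assumes "continuous_on M1 F" obtains B where "weighted (\<lambda>t. F (winding t)) (\<lambda>t. t) B"
  using continuous_bounded_M1[OF assms] weighted_mult[OF winding_measurable[OF assms]] winding_in_M1 by metis

lemma norm_mop_le:
  assumes "continuous_on M1 F" "\<And>x. x \<in> M1 \<Longrightarrow> cmod (F x) \<le> B"
  shows "norm (mop F) \<le> B"
  unfolding mop_def mult_op_eq_wcomp
  by (rule norm_wcomp_le[OF weighted_mult[OF winding_measurable]]) (use assms winding_in_M1 in auto)

text \<open>A modulus close to that of \<open>F x\<close>, or larger, occurs along an interval of
  positive length, which no null set can hide. Together with \<open>norm_mop_le\<close> this makes
  \<open>mop\<close> isometric.\<close>

lemma norm_mop_ge:
  assumes F: "continuous_on M1 F" and x: "x \<in> M1"
  shows "cmod (F x) \<le> norm (mop F)"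
proof (rule field_le_epsilon)
  fix e :: real assume e: "0 < e"
  obtain B where B: "\<And>x. x \<in> M1 \<Longrightarrow> cmod (F x) \<le> B" using continuous_bounded_M1[OF F] by blast
  show "cmod (F x) \<le> norm (mop F) + e"
  proof (cases "cmod (F x) \<le> e")
    case True
    then show ?thesis using norm_ge_zero[of "mop F"] by linarith
  next
    case False
    obtain l u where lu: "l < u" "\<forall>t\<in>{l<..<u}. cmod (F x) - e < cmod (F (winding t))"
      using winding_visits[OF F x, of "cmod (F x) - e"] e by auto
    have "cmod (F x) - e \<le> norm (mop F)"
      unfolding mop_def
      by (rule norm_mult_op_ge[OF winding_measurable[OF F] _ lu(1)]) (use B winding_in_M1 False lu(2) in \<open>auto intro: less_imp_le\<close>)
    then show ?thesis by simp
  qed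
qed

lemma mop_add:
  assumes "continuous_on M1 F" "continuous_on M1 G"
  shows "mop F + mop G = mop (\<lambda>x. F x + G x)"
proof -
  obtain B B' where "\<And>x. x \<in> M1 \<Longrightarrow> cmod (F x) \<le> B" "\<And>x. x \<in> M1 \<Longrightarrow> cmod (G x) \<le> B'"
    using continuous_bounded_M1 assms by metis
  then show ?thesis
    unfolding mop_def by (intro add_mult_op winding_measurable assms) (auto intro: winding_in_M1)
qed

lemma mop_mult:
  assumes "continuous_on M1 F" "continuous_on M1 G"
  shows "mop F o\<^sub>L mop G = mop (\<lambda>x. F x * G x)"
proof -
  obtain B B' where "weighted (\<lambda>t. F (winding t)) (\<lambda>t. t) B" "weighted (\<lambda>t. G (winding t)) (\<lambda>t. t) B'"
    using weighted_mop assms by metis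
  then show ?thesis unfolding mop_def mult_op_eq_wcomp by (rule wcomp_compose)
qed

lemma mop_smult:
  assumes "continuous_on M1 F" shows "smult_op c (mop F) = mop (\<lambda>x. c * F x)"
proof -
  obtain B where "weighted (\<lambda>t. F (winding t)) (\<lambda>t. t) B" using weighted_mop assms by metis
  then show ?thesis unfolding mop_def mult_op_eq_wcomp by (rule smult_wcomp)
qed

lemma mop_adj:
  assumes "continuous_on M1 F" shows "adj (mop F) = mop (\<lambda>x. cnj (F x))"
proof -
  obtain B where "\<And>x. x \<in> M1 \<Longrightarrow> cmod (F x) \<le> B" using continuous_bounded_M1 assms by metis
  then show ?thesis unfolding mop_def by (intro adj_mult_op winding_measurable assms) (auto intro: winding_in_M1)
qed

lemma mop_one: "mop (\<lambda>_. 1) = id_blinfun"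
  unfolding mop_def mult_op_eq_wcomp by (rule wcomp_id)

lemma mop_zero: "mop (\<lambda>_. 0) = 0"
  using norm_mop_le[of "\<lambda>_. 0" 0] by simp

lemma mop_in_op_L2: "continuous_on M1 F \<Longrightarrow> mop F \<in> op_L2"
  unfolding mop_def mult_op_eq_wcomp using weighted_mop wcomp_in_op_L2 by metis

lemma mop_diff:
  assumes "continuous_on M1 F" "continuous_on M1 G"
  shows "mop F - mop G = mop (\<lambda>x. F x - G x)"
proof -
  have "mop (\<lambda>x. F x - G x) + mop G = mop (\<lambda>x. F x - G x + G x)"
    by (intro mop_add continuous_intros assms)
  then show ?thesis by (simp add: algebra_simps)
qed

lemma mop_inj:
  assumes "continuous_on M1 F" "continuous_on M1 G" "mop F = mop G" "x \<in> M1"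
  shows "F x = G x"
proof -
  have "cmod (F x - G x) \<le> norm (mop (\<lambda>x. F x - G x))"
    by (intro norm_mop_ge continuous_intros assms)
  also have "\<dots> = 0" using mop_diff[OF assms(1,2)] assms(3) by simp
  finally show ?thesis by simp
qed

section \<open>Conjugation as composition with the shift\<close>

lemma continuous_on_M1_alpha1_tilde:
  "continuous_on M1 F \<Longrightarrow> continuous_on M1 (\<lambda>x. F (alpha1_tilde x))"
  by (rule continuous_on_compose2[OF _ continuous_on_alpha1_tilde]) (auto intro: alpha1_tilde_in_M1)

lemma continuous_on_M1_unshift:
  "continuous_on M1 F \<Longrightarrow> continuous_on M1 (\<lambda>x. F (unshift x))"
  by (rule continuous_on_compose2[OF _ continuous_on_unshift]) (auto intro: unshift_in_M1)

lemma U1_mop_V1: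
  assumes F: "continuous_on M1 F"
  shows "U1 o\<^sub>L mop F o\<^sub>L V1 = mop (\<lambda>x. F (alpha1_tilde x))"
proof -
  obtain B where w: "weighted (\<lambda>t. F (winding t)) (\<lambda>t. t) B" using weighted_mop[OF F] by blast
  note wU = weighted_compose[OF weighted_U w]
  have "U1 o\<^sub>L mop F o\<^sub>L V1 =
      wcomp (\<lambda>t. U_mult t * F (winding (gamma1 t)) * V_mult (gamma1 t)) (\<lambda>t. ginv (gamma1 t))"
    unfolding U1_eq_wcomp mop_def mult_op_eq_wcomp wcomp_compose[OF weighted_U w]
    by (rule wcomp_compose[OF wU weighted_V])
  also have "\<dots> = wcomp (\<lambda>t. F (alpha1_tilde (winding t))) (\<lambda>t. t)"
  proof (rule wcomp_cong_AE(2)[OF weighted_compose[OF wU weighted_V]])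
    show "(\<lambda>t. F (alpha1_tilde (winding t))) \<in> borel_measurable borel"
      by (rule winding_measurable[OF continuous_on_M1_alpha1_tilde[OF F]])
    show "AE t in lborel. U_mult t * F (winding (gamma1 t)) * V_mult (gamma1 t) = F (alpha1_tilde (winding t)) \<and>
        ginv (gamma1 t) = t"
      using AE_not_half_ints
    proof eventually_elim
      fix t assume t: "t \<notin> half_ints"
      have "U_mult t * F (winding (gamma1 t)) * V_mult (gamma1 t) =
          F (winding (gamma1 t)) * (U_mult t * V_mult (gamma1 t))" by simp
      then show "U_mult t * F (winding (gamma1 t)) * V_mult (gamma1 t) = F (alpha1_tilde (winding t)) \<and> ginv (gamma1 t) = t"
        by (simp only: V_mult_gamma1[OF t] winding_gamma1[OF t] ginv_gamma1[OF t]) simp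
    qed
  qed simp
  finally show ?thesis by (simp add: mop_def mult_op_eq_wcomp)
qed

lemma delta1_mop: "continuous_on M1 F \<Longrightarrow> delta1 (mop F) = mop (\<lambda>x. F (alpha1_tilde x))"
  unfolding delta1_def adj_U1 by (rule U1_mop_V1)

lemma V1_mop_U1:
  assumes F: "continuous_on M1 F"
  shows "V1 o\<^sub>L mop F o\<^sub>L U1 = mop (\<lambda>x. F (unshift x))"
proof -
  \<comment> \<open>Writing \<open>mop F\<close> as a conjugate lets \<open>V1 o\<^sub>L U1\<close>
    cancel on both sides, so the weights need not be computed again.\<close>
  have "mop F = U1 o\<^sub>L mop (\<lambda>x. F (unshift x)) o\<^sub>L V1"
    using U1_mop_V1[OF continuous_on_M1_unshift[OF F]] by simp
  then have "V1 o\<^sub>L mop F o\<^sub>L U1 = (V1 o\<^sub>L U1) o\<^sub>L mop (\<lambda>x. F (unshift x)) o\<^sub>L (V1 o\<^sub>L U1)"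
    by (intro blinfun_eqI) simp
  also have "\<dots> = mop (\<lambda>x. F (unshift x))"
    unfolding V1_U1 by (intro blinfun_eqI) simp
  finally show ?thesis .
qed

section \<open>The algebra $\mathcal{B}_1$\<close>

lemma op_power_simps:
  "op_power T 0 = id_blinfun" "op_power T (Suc n) = T o\<^sub>L op_power T n"
  by (simp_all add: op_power_def)

lemma op_power_Suc_right: "op_power T (Suc n) = op_power T n o\<^sub>L T"
proof (induction n)
  case 0
  show ?case by (rule blinfun_eqI) (simp add: op_power_simps)
next
  case (Suc n)
  have "op_power T (Suc (Suc n)) = T o\<^sub>L (op_power T n o\<^sub>L T)"
    unfolding Suc[symmetric] by (rule op_power_simps)
  also have "\<dots> = op_power T (Suc n) o\<^sub>L T"
    unfolding op_power_simps(2) by (rule blinfun_eqI) simp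
  finally show ?case .
qed

lemma funpow_unshift: "(unshift ^^ n) x = (\<lambda>m. x (m + n))"
  by (induction n) (auto simp: unshift_def)

lemma op_power_mop:
  "continuous_on M1 F \<Longrightarrow> op_power V1 n o\<^sub>L mop F o\<^sub>L op_power U1 n = mop (\<lambda>x. F ((unshift ^^ n) x))"
proof (induction n arbitrary: F)
  case 0
  show ?case by (rule blinfun_eqI) (simp add: op_power_simps)
next
  case (Suc n)
  have "op_power V1 (Suc n) o\<^sub>L mop F o\<^sub>L op_power U1 (Suc n) =
      op_power V1 n o\<^sub>L (V1 o\<^sub>L mop F o\<^sub>L U1) o\<^sub>L op_power U1 n"
    unfolding op_power_Suc_right[of V1] op_power_simps(2)[of U1] by (rule blinfun_eqI) simp
  also have "\<dots> = mop (\<lambda>x. F (unshift ((unshift ^^ n) x)))"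
    unfolding V1_mop_U1[OF Suc.prems] by (rule Suc.IH[OF continuous_on_M1_unshift[OF Suc.prems]])
  finally show ?case by simp
qed

lemma periodic_frac:
  fixes a :: "real \<Rightarrow> 'a"
  assumes "\<And>t. a (t + 1) = a t" shows "a (frac t) = a t"
proof -
  have nat: "a (s + real n) = a s" for s n
  proof (induction n)
    case (Suc n)
    then show ?case using assms[of "s + real n"] by (simp add: ac_simps)
  qed simp
  show ?thesis
  proof (cases "0 \<le> \<lfloor>t\<rfloor>")
    case True
    then have "t = frac t + real (nat \<lfloor>t\<rfloor>)" by (simp add: frac_def)
    then show ?thesis using nat[of "frac t" "nat \<lfloor>t\<rfloor>"] by simp
  next
    case False
    then have "frac t = t + real (nat (- \<lfloor>t\<rfloor>))" by (simp add: frac_def)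
    then show ?thesis using nat[of t "nat (- \<lfloor>t\<rfloor>)"] by simp
  qed
qed

text \<open>\<open>frac t\<close> is the zeroth coordinate of \<open>winding t\<close>. The jumps
  that \<open>alg_A\<close> permits at the integers are absorbed because the left limit becomes the
  value of \<open>f\<close> at 1, which may differ from \<open>f 0\<close>.\<close>

lemma alg_A_eq_mop:
  assumes "a \<in> alg_A" obtains f where "continuous_on {0..1} f" "a = mop (\<lambda>x. f (x 0))"
proof -
  obtain a0 l where a0: "a = mult_op a0" "\<And>t. a0 (t + 1) = a0 t" "continuous_on {0..<1} a0" "(a0 \<longlongrightarrow> l) (at_left 1)"
    using assms unfolding alg_A_def by blast
  define f where "f x = (if x = 1 then l else a0 x)" for x
  have "continuous_on {0..1} f"
  proof (rule continuous_on_IccI)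
    have "continuous_on {0..1/2} a0" by (rule continuous_on_subset[OF a0(3)]) auto
    then have "(a0 \<longlongrightarrow> a0 0) (at_right 0)" by (rule continuous_on_Icc_at_rightD) simp
    moreover have "\<forall>\<^sub>F x in at_right 0. a0 x = f x"
      by (rule eventually_at_rightI[of 0 1]) (auto simp: f_def)
    ultimately have "(f \<longlongrightarrow> a0 0) (at_right 0)" by (rule Lim_transform_eventually)
    then show "(f \<longlongrightarrow> f 0) (at_right 0)" by (simp add: f_def)
    have "\<forall>\<^sub>F x in at_left 1. a0 x = f x"
      by (rule eventually_at_leftI[of 0]) (auto simp: f_def)
    then have "(f \<longlongrightarrow> l) (at_left 1)" by (rule Lim_transform_eventually[OF a0(4)])
    then show "(f \<longlongrightarrow> f 1) (at_left 1)" by (simp add: f_def)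
    show "f \<midarrow>x\<rightarrow> f x" if "0 < x" "x < 1" for x
    proof -
      have "continuous_on {0<..<1} a0" by (rule continuous_on_subset[OF a0(3)]) auto
      then have "a0 \<midarrow>x\<rightarrow> a0 x" using that by (simp add: continuous_on_eq_continuous_at isCont_def)
      then have "f \<midarrow>x\<rightarrow> a0 x"
        by (rule Lim_transform_within_open[of _ _ _ _ "{0<..<1}"]) (use that in \<open>auto simp: f_def\<close>)
      then show ?thesis using that by (simp add: f_def)
    qed
  qed simp
  moreover have "a = mop (\<lambda>x. f (x 0))"
  proof -
    have "f (winding t 0) = a0 t" for t
      using frac_lt_1[of t] periodic_frac[of a0, OF a0(2)] by (simp add: winding_def f_def)
    then show ?thesis by (simp add: mop_def a0(1))
  qed
  ultimately show ?thesis by (rule that)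
qed

lemma mop_in_alg_A:
  assumes "continuous_on {0..1} f" shows "mop (\<lambda>x. f (x 0)) \<in> alg_A"
proof -
  have "mop (\<lambda>x. f (x 0)) = mult_op (\<lambda>t. f (frac t))" by (simp add: mop_def winding_def)
  moreover have "\<forall>t. f (frac (t + 1)) = f (frac t)" by (simp add: frac_def)
  moreover have "continuous_on {0..<1} (\<lambda>t. f (frac t))"
  proof (rule continuous_on_eq)
    show "continuous_on {0..<1} f" by (rule continuous_on_subset[OF assms]) auto
    show "f t = f (frac t)" if "t \<in> {0..<1}" for t using floor_frac_eq(2)[of t 0 t] that by simp
  qed
  moreover have "((\<lambda>t. f (frac t)) \<longlongrightarrow> f 1) (at_left 1)"
  proof (rule Lim_transform_eventually)
    show "(f \<longlongrightarrow> f 1) (at_left 1)" using continuous_on_Icc_at_leftD[OF assms] by simp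
    show "\<forall>\<^sub>F t in at_left 1. f t = f (frac t)"
    proof (rule eventually_at_leftI[of 0])
      show "f t = f (frac t)" if "t \<in> {0<..<1}" for t using floor_frac_eq(2)[of t 0 t] that by simp
    qed simp
  qed
  ultimately show ?thesis
    unfolding alg_A_def by (intro CollectI exI[of _ "\<lambda>t. f (frac t)"] conjI exI[of _ "f 1"])
qed

lemma continuous_on_M1_coord:
  "continuous_on {0..1} f \<Longrightarrow> continuous_on M1 (\<lambda>x. f (x n))"
  by (rule continuous_on_compose2[OF _ continuous_on_subset[OF continuous_on_product_coordinates subset_UNIV]])
     (auto intro: M1_bounds)

text \<open>By uniform continuity on the compact space \<open>M1\<close>, changing only the
  coordinates above a large \<open>N\<close> hardly affects \<open>F\<close>. So functions of one
  single coordinate are already uniformly dense.\<close>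

lemma section_approx:
  assumes F: "continuous_on M1 (F :: _ \<Rightarrow> complex)" and e: "0 < e"
  shows "\<exists>N. \<forall>x\<in>M1. cmod (F (section_at N (x N)) - F x) \<le> e"
proof -
  obtain d where d: "0 < d" "\<And>x y. x \<in> M1 \<Longrightarrow> y \<in> M1 \<Longrightarrow> dist y x < d \<Longrightarrow> dist (F y) (F x) < e"
    using compact_uniformly_continuous[OF F compact_M1] e unfolding uniformly_continuous_on_def by metis
  obtain N where N: "\<And>y z :: nat \<Rightarrow> real. (\<forall>n\<le>N. y n = z n) \<Longrightarrow> dist y z < d"
    using dist_fun_small[OF d(1)] by blast
  have "cmod (F (section_at N (x N)) - F x) \<le> e" if x: "x \<in> M1" for x
  proof -
    have "dist (section_at N (x N)) x < d" by (intro N allI impI section_at_agree[OF x])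
    moreover have "section_at N (x N) \<in> M1" by (rule section_at_in_M1) (use M1_bounds[OF x] in simp)
    ultimately show ?thesis using d(2)[OF x] by (simp add: dist_norm less_imp_le)
  qed
  then show ?thesis by blast
qed

text \<open>As \<open>mop\<close> is isometric, a convergent sequence of such operators comes from a
  uniformly Cauchy sequence of functions, whose limit is again continuous.\<close>

lemma closed_mop_range: "closed {mop F |F. continuous_on M1 F}"
  unfolding closed_sequential_limits
proof (intro allI impI, elim conjE)
  fix T :: "nat \<Rightarrow> op" and L
  assume "\<forall>n. T n \<in> {mop F |F. continuous_on M1 F}" and lim: "T \<longlonglongrightarrow> L"
  then obtain F where F: "\<And>n. continuous_on M1 (F n)" "\<And>n. T n = mop (F n)" by simp metis
  have d: "cmod (F m x - F n x) \<le> norm (T m - T n)" if "x \<in> M1" for m n x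
    unfolding F(2) mop_diff[OF F(1) F(1)] by (rule norm_mop_ge[OF continuous_on_diff[OF F(1) F(1)] that])
  have "uniformly_Cauchy_on M1 F"
  proof (rule uniformly_Cauchy_onI)
    fix e :: real assume "0 < e"
    then obtain M where M: "\<And>m n. m \<ge> M \<Longrightarrow> n \<ge> M \<Longrightarrow> norm (T m - T n) < e"
      using LIMSEQ_imp_Cauchy[OF lim] unfolding Cauchy_iff by blast
    have "dist (F m x) (F n x) < e" if "x \<in> M1" "m \<ge> M" "n \<ge> M" for x m n
      using le_less_trans[OF d[OF that(1)] M[OF that(2,3)]] by (simp add: dist_norm)
    then show "\<exists>M. \<forall>x\<in>M1. \<forall>m\<ge>M. \<forall>n\<ge>M. dist (F m x) (F n x) < e" by blast
  qed
  then obtain G where G: "uniform_limit M1 F G sequentially"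
    using Cauchy_uniformly_convergent unfolding uniformly_convergent_on_def by blast
  have cG: "continuous_on M1 G"
    by (rule uniform_limit_theorem[OF _ G]) (use F(1) in auto)
  have "T \<longlonglongrightarrow> mop G"
  proof (rule LIMSEQ_I)
    fix e :: real assume e: "0 < e"
    then have "0 < e / 2" by simp
    then have "\<forall>\<^sub>F n in sequentially. \<forall>x\<in>M1. dist (F n x) (G x) < e / 2"
      using G unfolding uniform_limit_iff by blast
    then obtain M where M: "\<And>n x. n \<ge> M \<Longrightarrow> x \<in> M1 \<Longrightarrow> dist (F n x) (G x) < e / 2"
      unfolding eventually_sequentially by blast
    have "norm (T n - mop G) < e" if "n \<ge> M" for n
    proof -
      have "norm (T n - mop G) \<le> e / 2"
        unfolding F(2) mop_diff[OF F(1) cG]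
        by (rule norm_mop_le[OF continuous_on_diff[OF F(1) cG]]) (use M[OF that] in \<open>auto simp: dist_norm intro: less_imp_le\<close>)
      then show ?thesis using e by simp
    qed
    then show "\<exists>no. \<forall>n\<ge>no. norm (T n - mop G) < e" by blast
  qed
  then have "L = mop G" using LIMSEQ_unique lim by blast
  then show "L \<in> {mop F |F. continuous_on M1 F}" using cG by blast
qed

lemma star_subalgebra_mop: "star_subalgebra {mop F |F. continuous_on M1 F}"
  unfolding star_subalgebra_def
proof (intro conjI ballI allI)
  show "{mop F |F. continuous_on M1 F} \<subseteq> op_L2" using mop_in_op_L2 by blast
  show "0 \<in> {mop F |F. continuous_on M1 F}" using mop_zero[symmetric] continuous_on_const by blast
  fix a assume "a \<in> {mop F |F. continuous_on M1 F}"
  then obtain F where F: "a = mop F" "continuous_on M1 F" by blast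
  show "smult_op c a \<in> {mop F |F. continuous_on M1 F}" for c
    unfolding F(1) mop_smult[OF F(2)] using continuous_on_mult[OF continuous_on_const F(2)] by blast
  show "adj a \<in> {mop F |F. continuous_on M1 F}"
    unfolding F(1) mop_adj[OF F(2)] using continuous_on_cnj[OF F(2)] by blast
  fix b assume "b \<in> {mop F |F. continuous_on M1 F}"
  then obtain G where G: "b = mop G" "continuous_on M1 G" by blast
  show "a + b \<in> {mop F |F. continuous_on M1 F}"
    unfolding F(1) G(1) mop_add[OF F(2) G(2)] using continuous_on_add[OF F(2) G(2)] by blast
  show "a o\<^sub>L b \<in> {mop F |F. continuous_on M1 F}"
    unfolding F(1) G(1) mop_mult[OF F(2) G(2)] using continuous_on_mult[OF F(2) G(2)] by blast
qed

text \<open>Conjugating \<open>n\<close> times composes with \<open>unshift ^^ n\<close>, which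
  replaces the zeroth coordinate by the coordinate \<open>n\<close>.\<close>

lemma generators_eq:
  "(\<Union>n. (\<lambda>a. op_power (adj U1) n o\<^sub>L a o\<^sub>L op_power U1 n) ` alg_A) =
    {mop (\<lambda>x. f (x n)) |f n. continuous_on {0..1} f}"
proof -
  have eq: "op_power V1 n o\<^sub>L mop (\<lambda>x. f (x 0)) o\<^sub>L op_power U1 n = mop (\<lambda>x. f (x n))"
    if "continuous_on {0..1} f" for f n
    using op_power_mop[OF continuous_on_M1_coord[OF that]] by (simp add: funpow_unshift)
  show ?thesis
    unfolding adj_U1
  proof (intro equalityI subsetI)
    fix b assume "b \<in> (\<Union>n. (\<lambda>a. op_power V1 n o\<^sub>L a o\<^sub>L op_power U1 n) ` alg_A)"
    then obtain n a where b: "a \<in> alg_A" "b = op_power V1 n o\<^sub>L a o\<^sub>L op_power U1 n" by blast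
    obtain f where "continuous_on {0..1} f" "a = mop (\<lambda>x. f (x 0))" using alg_A_eq_mop[OF b(1)] by blast
    then show "b \<in> {mop (\<lambda>x. f (x n)) |f n. continuous_on {0..1} f}" using eq b(2) by blast
  next
    fix b assume "b \<in> {mop (\<lambda>x. f (x n)) |f n. continuous_on {0..1} f}"
    then obtain f n where f: "continuous_on {0..1} f" "b = mop (\<lambda>x. f (x n))" by blast
    then show "b \<in> (\<Union>n. (\<lambda>a. op_power V1 n o\<^sub>L a o\<^sub>L op_power U1 n) ` alg_A)"
      by (intro UN_I[of n] image_eqI[OF _ mop_in_alg_A[OF f(1)]]) (simp_all add: eq[OF f(1)] f(2))
  qed
qed

text \<open>The operators \<open>mop F\<close> form a closed star subalgebra containing the
  generators, which gives one inclusion. For the other, the functions of one coordinate that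
  approximate \<open>F\<close> are themselves generators.\<close>

lemma alg_B1_eq: "alg_B1 = {mop F |F. continuous_on M1 F}"
proof
  show "alg_B1 \<subseteq> {mop F |F. continuous_on M1 F}"
    unfolding alg_B1_def cstar_generated_def generators_eq
    by (rule Inter_lower) (use star_subalgebra_mop closed_mop_range continuous_on_M1_coord in blast)
  show "{mop F |F. continuous_on M1 F} \<subseteq> alg_B1"
    unfolding alg_B1_def cstar_generated_def generators_eq
  proof (intro subsetI InterI)
    fix a S assume "a \<in> {mop F |F. continuous_on M1 F}"
      and "S \<in> {S. star_subalgebra S \<and> closed S \<and> {mop (\<lambda>x. f (x n)) |f n. continuous_on {0..1} f} \<subseteq> S}"
    then obtain F where F: "a = mop F" "continuous_on M1 F"
      and S: "closed S" "\<And>f n. continuous_on {0..1} f \<Longrightarrow> mop (\<lambda>x. f (x n)) \<in> S" by blast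
    have "\<exists>y\<in>S. dist y a < e" if e: "0 < e" for e
    proof -
      obtain N where N: "\<And>x. x \<in> M1 \<Longrightarrow> cmod (F (section_at N (x N)) - F x) \<le> e / 2"
        using section_approx[OF F(2), of "e / 2"] e by auto
      have c: "continuous_on {0..1} (\<lambda>y. F (section_at N y))"
        by (rule continuous_on_compose2[OF F(2) continuous_on_section_at]) (auto intro: section_at_in_M1)
      have "norm (mop (\<lambda>x. F (section_at N (x N))) - mop F) \<le> e / 2"
        unfolding mop_diff[OF continuous_on_M1_coord[OF c] F(2)]
        by (intro norm_mop_le N continuous_on_diff continuous_on_M1_coord[OF c] F(2))
      then show ?thesis using e F(1) by (intro bexI[OF _ S(2)[OF c, of N]]) (auto simp: dist_norm)
    qed
    then show "a \<in> S" using S(1) closure_approachable[of a S] by simp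
  qed
qed

lemma B1_simps [simp]:
  "carrier B1 = {mop F |F. continuous_on M1 F}" "mult B1 = (o\<^sub>L)" "one B1 = id_blinfun" "zero B1 = 0"
  "add B1 = (+)" "smult B1 = smult_op" "invol B1 = adj" "nrm B1 = norm"
  by (simp_all add: B1_def alg_B1_eq)

section \<open>The Gelfand isomorphism\<close>

text \<open>By \<open>mop_inj\<close> the chosen function is unique on \<open>M1\<close>;
  \<open>restrict\<close> removes the freedom outside \<open>M1\<close>, as \<open>C_alg\<close>
  demands.\<close>

definition gelfand :: "op \<Rightarrow> (nat \<Rightarrow> real) \<Rightarrow> complex" where
  "gelfand b = restrict (SOME F. continuous_on M1 F \<and> mop F = b) M1"

lemma gelfand_mop:
  assumes F: "continuous_on M1 F" shows "gelfand (mop F) = restrict F M1"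
proof -
  define G where "G = (SOME G. continuous_on M1 G \<and> mop G = mop F)"
  have G: "continuous_on M1 G \<and> mop G = mop F" unfolding G_def by (rule someI[of _ F]) (simp add: F)
  have "G x = F x" if "x \<in> M1" for x using mop_inj[OF _ F _ that] G by blast
  then show ?thesis unfolding gelfand_def G_def[symmetric] by (auto simp: restrict_def)
qed

lemma norm_mop: "continuous_on M1 F \<Longrightarrow> norm (mop F) = (SUP x\<in>M1. cmod (F x))"
proof (rule antisym)
  assume F: "continuous_on M1 F"
  have b: "bdd_above ((\<lambda>x. cmod (F x)) ` M1)" using norm_mop_ge[OF F] by (auto intro!: bdd_aboveI)
  show "norm (mop F) \<le> (SUP x\<in>M1. cmod (F x))"
    by (rule norm_mop_le[OF F]) (rule cSUP_upper[OF _ b])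
  show "(SUP x\<in>M1. cmod (F x)) \<le> norm (mop F)"
    by (rule cSUP_least) (use zero_in_M1 norm_mop_ge[OF F] in auto)
qed

lemma gelfand_iso: "gelfand \<in> star_iso B1 (C_alg M1)"
proof -
  have cr: "continuous_on M1 (restrict F M1) \<longleftrightarrow> continuous_on M1 F" for F :: "_ \<Rightarrow> complex"
    by (rule continuous_on_cong) auto
  have "gelfand \<in> ring_hom B1 (C_alg M1)"
  proof (rule ring_hom_memI)
    fix a assume "a \<in> carrier B1"
    then obtain F where F: "a = mop F" "continuous_on M1 F" by auto
    show "gelfand a \<in> carrier (C_alg M1)"
      unfolding F(1) gelfand_mop[OF F(2)] by (simp add: C_alg_def cr F(2))
    fix b assume "b \<in> carrier B1"
    then obtain G where G: "b = mop G" "continuous_on M1 G" by auto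
    show "gelfand (a \<otimes>\<^bsub>B1\<^esub> b) = gelfand a \<otimes>\<^bsub>C_alg M1\<^esub> gelfand b"
      by (simp add: F(1) G(1) mop_mult[OF F(2) G(2)] gelfand_mop F(2) G(2) continuous_on_mult C_alg_def)
         (auto simp: restrict_def)
    show "gelfand (a \<oplus>\<^bsub>B1\<^esub> b) = gelfand a \<oplus>\<^bsub>C_alg M1\<^esub> gelfand b"
      by (simp add: F(1) G(1) mop_add[OF F(2) G(2)] gelfand_mop F(2) G(2) continuous_on_add C_alg_def)
         (auto simp: restrict_def)
  next
    show "gelfand \<one>\<^bsub>B1\<^esub> = \<one>\<^bsub>C_alg M1\<^esub>"
      using gelfand_mop[of "\<lambda>_. 1"] by (simp add: mop_one C_alg_def)
  qed
  moreover have "bij_betw gelfand (carrier B1) (carrier (C_alg M1))"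
  proof (rule bij_betwI[where g = mop])
    show "gelfand \<in> carrier B1 \<rightarrow> carrier (C_alg M1)" by (auto simp: gelfand_mop C_alg_def cr)
    show "mop \<in> carrier (C_alg M1) \<rightarrow> carrier B1" by (auto simp: C_alg_def)
    show "mop (gelfand b) = b" if "b \<in> carrier B1" for b
      using that by (auto simp: gelfand_mop intro: mop_cong)
    show "gelfand (mop f) = f" if "f \<in> carrier (C_alg M1)" for f
      using that by (auto simp: C_alg_def gelfand_mop extensional_restrict)
  qed
  moreover have "gelfand (c \<odot>\<^bsub>B1\<^esub> a) = c \<odot>\<^bsub>C_alg M1\<^esub> gelfand a \<and> gelfand (invol B1 a) = invol (C_alg M1) (gelfand a)
      \<and> nrm (C_alg M1) (gelfand a) = nrm B1 a" if "a \<in> carrier B1" for a c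
  proof -
    from that obtain F where F: "a = mop F" "continuous_on M1 F" by auto
    have "(SUP x\<in>M1. cmod (restrict F M1 x)) = (SUP x\<in>M1. cmod (F x))" by (rule SUP_cong) auto
    then show ?thesis
      using F(2) by (auto simp: F(1) mop_smult mop_adj gelfand_mop continuous_on_mult continuous_on_const
          continuous_on_cnj C_alg_def norm_mop fun_eq_iff)
  qed
  ultimately show ?thesis by (auto simp: star_iso_def ring_iso_def)
qed

section \<open>The automorphism on functions\<close>

lemma norm_delta1_mop:
  assumes F: "continuous_on M1 F" shows "norm (mop (\<lambda>x. F (alpha1_tilde x))) = norm (mop F)"
proof (rule antisym)
  show "norm (mop (\<lambda>x. F (alpha1_tilde x))) \<le> norm (mop F)"
    by (intro norm_mop_le continuous_on_M1_alpha1_tilde F norm_mop_ge alpha1_tilde_in_M1)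
  show "norm (mop F) \<le> norm (mop (\<lambda>x. F (alpha1_tilde x)))"
    using norm_mop_ge[OF continuous_on_M1_alpha1_tilde[OF F] unshift_in_M1]
    by (intro norm_mop_le F) (simp add: alpha1_tilde_unshift)
qed

lemma delta1_iso: "delta1 \<in> star_iso B1 B1"
proof -
  note ca = continuous_on_M1_alpha1_tilde
  have "delta1 \<in> ring_hom B1 B1"
  proof (rule ring_hom_memI)
    fix a assume "a \<in> carrier B1"
    then obtain F where F: "a = mop F" "continuous_on M1 F" by auto
    show "delta1 a \<in> carrier B1" using F ca[OF F(2)] by (auto simp: delta1_mop)
    fix b assume "b \<in> carrier B1"
    then obtain G where G: "b = mop G" "continuous_on M1 G" by auto
    show "delta1 (a \<otimes>\<^bsub>B1\<^esub> b) = delta1 a \<otimes>\<^bsub>B1\<^esub> delta1 b"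
      using F(2) G(2) by (simp add: F(1) G(1) mop_mult delta1_mop ca continuous_on_mult)
    show "delta1 (a \<oplus>\<^bsub>B1\<^esub> b) = delta1 a \<oplus>\<^bsub>B1\<^esub> delta1 b"
      using F(2) G(2) by (simp add: F(1) G(1) mop_add delta1_mop ca continuous_on_add)
  next
    show "delta1 \<one>\<^bsub>B1\<^esub> = \<one>\<^bsub>B1\<^esub>" using delta1_mop[of "\<lambda>_. 1"] by (simp add: mop_one)
  qed
  moreover have "bij_betw delta1 (carrier B1) (carrier B1)"
    unfolding bij_betw_def
  proof
    show "inj_on delta1 (carrier B1)"
    proof (rule inj_onI)
      fix a b assume "a \<in> carrier B1" "b \<in> carrier B1" and eq: "delta1 a = delta1 b"
      then obtain F G where F: "a = mop F" "continuous_on M1 F" and G: "b = mop G" "continuous_on M1 G" by auto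
      have "F x = G x" if x: "x \<in> M1" for x
        using mop_inj[OF ca[OF F(2)] ca[OF G(2)] _ unshift_in_M1[OF x]] eq
        by (simp add: F G delta1_mop alpha1_tilde_unshift[OF x])
      then show "a = b" unfolding F(1) G(1) by (rule mop_cong)
    qed
    show "delta1 ` carrier B1 = carrier B1"
    proof (intro equalityI subsetI)
      fix a assume "a \<in> delta1 ` carrier B1"
      then obtain F where "a = delta1 (mop F)" "continuous_on M1 F" by auto
      then show "a \<in> carrier B1" unfolding B1_simps using ca delta1_mop by blast
    next
      fix a assume "a \<in> carrier B1"
      then obtain F where F: "a = mop F" "continuous_on M1 F" by auto
      have "delta1 (mop (\<lambda>x. F (unshift x))) = a"
        using delta1_mop[OF continuous_on_M1_unshift[OF F(2)]] F(1) by simp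
      moreover have "mop (\<lambda>x. F (unshift x)) \<in> carrier B1" using continuous_on_M1_unshift[OF F(2)] by auto
      ultimately show "a \<in> delta1 ` carrier B1" by blast
    qed
  qed
  moreover have "delta1 (c \<odot>\<^bsub>B1\<^esub> a) = c \<odot>\<^bsub>B1\<^esub> delta1 a \<and> delta1 (invol B1 a) = invol B1 (delta1 a)
      \<and> nrm B1 (delta1 a) = nrm B1 a" if "a \<in> carrier B1" for a c
    using that by (auto simp: mop_smult mop_adj delta1_mop ca continuous_on_mult continuous_on_const
        continuous_on_cnj norm_delta1_mop)
  ultimately show ?thesis by (auto simp: star_iso_def ring_iso_def)
qed

lemma gelfand_delta1:
  assumes "b \<in> carrier B1" shows "gelfand (delta1 b) = (\<lambda>x\<in>M1. gelfand b (alpha1_tilde x))"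
  using assms by (auto simp: delta1_mop gelfand_mop continuous_on_M1_alpha1_tilde alpha1_tilde_in_M1 fun_eq_iff)

section \<open>Closed ideals\<close>

text \<open>The hull of the ideal, with the points of \<open>M1\<close> in the role of the
  characters.\<close>

definition hull_set :: "op set \<Rightarrow> (nat \<Rightarrow> real) set" where
  "hull_set I = {x \<in> M1. \<forall>F. continuous_on M1 F \<longrightarrow> mop F \<in> I \<longrightarrow> F x = 0}"

lemma ideal_B1D:
  assumes "ideal I B1"
  shows "I \<subseteq> {mop F |F. continuous_on M1 F}" "0 \<in> I" "a \<in> I \<Longrightarrow> b \<in> I \<Longrightarrow> a + b \<in> I"
    "a \<in> I \<Longrightarrow> continuous_on M1 F \<Longrightarrow> mop F o\<^sub>L a \<in> I" "a \<in> I \<Longrightarrow> - a \<in> I"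
proof -
  interpret ideal I B1 by fact
  show sub: "I \<subseteq> {mop F |F. continuous_on M1 F}" using a_subset by simp
  show "0 \<in> I" using additive_subgroup.zero_closed[OF is_additive_subgroup] by simp
  show "a + b \<in> I" if "a \<in> I" "b \<in> I" using additive_subgroup.a_closed[OF is_additive_subgroup that] by simp
  show absorb: "mop F o\<^sub>L a \<in> I" if "a \<in> I" "continuous_on M1 F" for a F
    using I_l_closed[OF that(1), of "mop F"] that(2) by auto
  show "- a \<in> I" if "a \<in> I"
  proof -
    obtain F where F: "a = mop F" "continuous_on M1 F" using \<open>a \<in> I\<close> sub by blast
    have "- a = 0 - a" by simp
    also have "\<dots> = mop (\<lambda>x. - 1 * F x)"
      unfolding F(1) mop_zero[symmetric] mop_diff[OF continuous_on_const F(2)] by simp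
    also have "\<dots> = mop (\<lambda>_. - 1) o\<^sub>L a" unfolding F(1) by (rule mop_mult[symmetric]) (auto simp: F(2) continuous_on_const)
    finally show ?thesis using absorb[OF \<open>a \<in> I\<close> continuous_on_const] by simp
  qed
qed

text \<open>Around each point of \<open>K\<close> some member of the ideal does not vanish, and by
  compactness finitely many such members suffice. Multiplying each by its conjugate and adding stays
  in the ideal and produces the sum of the squared moduli.\<close>

lemma ideal_positive_element:
  assumes I: "ideal I B1" and K: "compact K" "K \<subseteq> M1" "K \<inter> hull_set I = {}"
  obtains H :: "(nat \<Rightarrow> real) \<Rightarrow> real" where "continuous_on M1 H" "\<And>x. 0 \<le> H x" "\<And>x. x \<in> K \<Longrightarrow> 0 < H x"
    "mop (\<lambda>x. of_real (H x)) \<in> I"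
proof -
  have "\<exists>F. continuous_on M1 F \<and> mop F \<in> I \<and> F x \<noteq> 0" if "x \<in> K" for x
    using that K by (auto simp: hull_set_def)
  then obtain F where F: "\<And>x. x \<in> K \<Longrightarrow> continuous_on M1 (F x)" "\<And>x. x \<in> K \<Longrightarrow> mop (F x) \<in> I"
    "\<And>x. x \<in> K \<Longrightarrow> F x x \<noteq> 0" by metis
  have "\<exists>T. open T \<and> T \<inter> M1 = F x -` (- {0}) \<inter> M1" if "x \<in> K" for x
    using F(1)[OF that] unfolding continuous_on_open_invariant by (metis open_Compl closed_singleton)
  then obtain T where T: "\<And>x. x \<in> K \<Longrightarrow> open (T x)" "\<And>x. x \<in> K \<Longrightarrow> T x \<inter> M1 = F x -` (- {0}) \<inter> M1" by metis
  have "K \<subseteq> (\<Union>x\<in>K. T x)" using T(2) F(3) K(2) by blast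
  then obtain D where D: "D \<subseteq> K" "finite D" "K \<subseteq> (\<Union>x\<in>D. T x)"
    using compactE_image[OF K(1), of K T] T(1) by metis
  define H where "H y = (\<Sum>x\<in>D. (cmod (F x y))\<^sup>2)" for y
  show ?thesis
  proof (rule that)
    show "continuous_on M1 H" unfolding H_def using F(1) D(1) by (intro continuous_intros) auto
    show "0 \<le> H y" for y unfolding H_def by (intro sum_nonneg) simp
    show "0 < H y" if y: "y \<in> K" for y
    proof -
      obtain x where x: "x \<in> D" "y \<in> T x" using D(3) y by blast
      then have "F x y \<noteq> 0" using T(2)[of x] D(1) K(2) y by blast
      then show ?thesis unfolding H_def using x(1) D(2) by (intro sum_pos2[of _ x]) auto
    qed
    have "continuous_on M1 (\<lambda>y. of_real (\<Sum>x\<in>D. (cmod (F x y))\<^sup>2) :: complex) \<and>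
        mop (\<lambda>y. of_real (\<Sum>x\<in>D. (cmod (F x y))\<^sup>2)) \<in> I"
      using D(2,1)
    proof (induction D rule: finite_induct)
      case empty
      then show ?case using ideal_B1D(2)[OF I] by (simp add: mop_zero continuous_on_const)
    next
      case (insert x D)
      have c: "continuous_on M1 (F x)" "continuous_on M1 (\<lambda>y. cnj (F x y))" "mop (F x) \<in> I"
        using F insert.prems by (auto intro: continuous_on_cnj)
      have "mop (\<lambda>y. cnj (F x y)) o\<^sub>L mop (F x) \<in> I" by (rule ideal_B1D(4)[OF I c(3,2)])
      then have m: "mop (\<lambda>y. cnj (F x y) * F x y) \<in> I" by (simp add: mop_mult[OF c(2,1)])
      have cm: "continuous_on M1 (\<lambda>y. cnj (F x y) * F x y)" by (intro continuous_on_mult c)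
      have e: "of_real (\<Sum>x\<in>insert x D. (cmod (F x y))\<^sup>2) =
          cnj (F x y) * F x y + of_real (\<Sum>x\<in>D. (cmod (F x y))\<^sup>2)" for y
        using insert.hyps by (simp add: complex_norm_square mult.commute del: of_real_power)
      show ?case
        unfolding e using insert.IH insert.prems ideal_B1D(3)[OF I m] cm
        by (auto simp: mop_add[OF cm, symmetric] intro!: continuous_on_add)
    qed
    then show "mop (\<lambda>y. of_real (H y)) \<in> I" unfolding H_def by blast
  qed
qed

lemma vanishing_imp_in_ideal:
  assumes I: "ideal I B1" "closed I" and F: "continuous_on M1 F" "\<And>x. x \<in> hull_set I \<Longrightarrow> F x = 0"
  shows "mop F \<in> I"
proof -
  have "\<exists>y\<in>I. dist y (mop F) < e" if e: "0 < e" for e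
  proof -
    define K where "K = {x \<in> M1. e / 2 \<le> cmod (F x)}"
    have "compact K"
    proof -
      have "closedin (top_of_set M1) (M1 \<inter> (\<lambda>x. cmod (F x)) -` {e / 2..})"
        by (intro continuous_closedin_preimage continuous_on_norm F(1) closed_atLeast)
      then have "closed (M1 \<inter> (\<lambda>x. cmod (F x)) -` {e / 2..})"
        using compact_imp_closed[OF compact_M1] closedin_closed_trans by blast
      moreover have "K = M1 \<inter> (M1 \<inter> (\<lambda>x. cmod (F x)) -` {e / 2..})" by (auto simp: K_def)
      ultimately show ?thesis using compact_Int_closed[OF compact_M1] by metis
    qed
    moreover have "K \<subseteq> M1" "K \<inter> hull_set I = {}" using F(2) e by (auto simp: K_def)
    ultimately obtain H :: "(nat \<Rightarrow> real) \<Rightarrow> real" where H: "continuous_on M1 H" "\<And>x. 0 \<le> H x"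
      "\<And>x. x \<in> K \<Longrightarrow> 0 < H x" "mop (\<lambda>x. of_real (H x)) \<in> I"
      using ideal_positive_element[OF I(1)] by metis
    obtain m where m: "0 < m" "\<And>x. x \<in> K \<Longrightarrow> m \<le> H x"
    proof (cases "K = {}")
      case False
      have "continuous_on K H" by (rule continuous_on_subset[OF H(1)]) (auto simp: K_def)
      then show ?thesis using continuous_attains_inf[OF \<open>compact K\<close> False] H(3) that by metis
    qed (use that[of 1] in auto)
    \<comment> \<open>The product of \<open>q\<close> and \<open>H\<close> lies in the ideal. It
      equals \<open>F\<close> on \<open>K\<close>, where \<open>m \<le> H\<close>; elsewhere on
      \<open>M1\<close> it is \<open>F\<close> times a factor in [0, 1], and there \<open>F\<close>
      is smaller than \<open>e / 2\<close> in modulus.\<close>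
    define q where "q x = F x / of_real (max m (H x))" for x
    have q: "continuous_on M1 q"
      unfolding q_def using m(1) by (intro continuous_intros F(1) H(1)) auto
    have cH: "continuous_on M1 (\<lambda>x. of_real (H x) :: complex)" by (intro continuous_intros H(1))
    have qH: "continuous_on M1 (\<lambda>x. q x * of_real (H x))" by (intro continuous_on_mult q cH)
    have "mop (\<lambda>x. q x * of_real (H x)) \<in> I"
      using ideal_B1D(4)[OF I(1) H(4) q] by (simp add: mop_mult[OF q cH])
    moreover have "norm (mop (\<lambda>x. q x * of_real (H x)) - mop F) \<le> e / 2"
      unfolding mop_diff[OF qH F(1)]
    proof (rule norm_mop_le)
      show "continuous_on M1 (\<lambda>x. q x * of_real (H x) - F x)" by (intro continuous_on_diff qH F(1))
      fix x assume x: "x \<in> M1"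
      have M: "0 < max m (H x)" using m(1) by simp
      have "q x * of_real (H x) - F x = F x * of_real (H x / max m (H x) - 1)"
        using M by (simp add: q_def algebra_simps)
      then have n: "cmod (q x * of_real (H x) - F x) = cmod (F x) * \<bar>H x / max m (H x) - 1\<bar>"
        by (simp only: norm_mult norm_of_real)
      show "cmod (q x * of_real (H x) - F x) \<le> e / 2"
      proof (cases "x \<in> K")
        case True
        then have "max m (H x) = H x" using m(2) by (simp add: max_def)
        then show ?thesis using n e H(3)[OF True] by simp
      next
        case False
        then have "cmod (F x) \<le> e / 2" using x by (simp add: K_def)
        moreover have "0 \<le> H x / max m (H x)" "H x / max m (H x) \<le> 1"
          using M H(2)[of x] by (auto simp: divide_le_eq_1)
        then have "\<bar>H x / max m (H x) - 1\<bar> \<le> 1" by linarith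
        ultimately have "cmod (F x) * \<bar>H x / max m (H x) - 1\<bar> \<le> e / 2 * 1"
          by (intro mult_mono) (use e in auto)
        then show ?thesis using n by simp
      qed
    qed
    ultimately show ?thesis using e by (intro bexI) (auto simp: dist_norm)
  qed
  then show ?thesis using I(2) closure_approachable[of "mop F" I] by simp
qed

lemma closed_hull_set: "closed (hull_set I)"
proof -
  let ?C = "{{x \<in> M1. F x = 0} |F. continuous_on M1 F \<and> mop F \<in> I}"
  have "closed {x \<in> M1. F x = 0}" if "continuous_on M1 F" for F :: "_ \<Rightarrow> complex"
    using continuous_closed_preimage_constant[OF that compact_imp_closed[OF compact_M1], of 0] by simp
  then have "closed (\<Inter>?C)" by (intro closed_Inter) auto
  then have "closed (M1 \<inter> \<Inter>?C)" by (intro closed_Int compact_imp_closed[OF compact_M1])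
  moreover have "hull_set I = M1 \<inter> \<Inter>?C" by (auto simp: hull_set_def)
  ultimately show ?thesis by metis
qed

lemma a_r_coset_B1: "a_r_coset B1 I x = (\<lambda>h. h + x) ` I"
  by (auto simp: a_r_coset_def')

text \<open>A separation of the hull gives a continuous function that is 0 on one part and 1 on the
  other. Its square minus itself vanishes on the hull and so lies in the closed ideal; its class is
  an idempotent different from 0 and 1.\<close>

lemma connected_hull_set:
  assumes I: "ideal I B1" "closed I" and triv: "only_trivial_idempotents (B1 Quot I)"
  shows "connected (hull_set I)"
proof (rule ccontr)
  assume "\<not> connected (hull_set I)"
  then obtain A B where AB: "closed A" "closed B" "A \<noteq> {}" "B \<noteq> {}" "A \<union> B = hull_set I" "A \<inter> B = {}"
    unfolding connected_closed_set[OF closed_hull_set] by metis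
  \<comment> \<open>An Urysohn function. The denominator is positive because \<open>A\<close> and
    \<open>B\<close> are closed, disjoint and nonempty; the distance to an empty set would be 0 by
    convention.\<close>
  define f where "f x = complex_of_real (infdist x A / (infdist x A + infdist x B))" for x
  have pos: "0 < infdist x A + infdist x B" for x
  proof -
    have "infdist x A \<noteq> 0 \<or> infdist x B \<noteq> 0"
      using AB in_closed_iff_infdist_zero by blast
    then show ?thesis using infdist_nonneg[of x A] infdist_nonneg[of x B] by linarith
  qed
  have f: "continuous_on M1 f"
    unfolding f_def using pos by (intro continuous_intros) (auto simp: less_imp_neq[symmetric])
  have fA: "f x = 0" if "x \<in> A" for x
    using that AB by (simp add: f_def)
  have fB: "f x = 1" if "x \<in> B" for x
    using that pos[of x] by (simp add: f_def)
  let ?e = "mop f"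
  interpret ideal I B1 by (rule I(1))
  have e: "?e \<in> carrier B1" using f by auto
  have "mop (\<lambda>x. f x * f x) - ?e \<in> I"
    unfolding mop_diff[OF continuous_on_mult[OF f f] f]
  proof (rule vanishing_imp_in_ideal[OF I])
    show "continuous_on M1 (\<lambda>x. f x * f x - f x)" by (intro continuous_on_diff continuous_on_mult f)
    show "f x * f x - f x = 0" if "x \<in> hull_set I" for x
      using that fA[of x] fB[of x] AB(5) by force
  qed
  then have d: "(?e o\<^sub>L ?e) - ?e \<in> I" by (simp add: mop_mult[OF f f])
  have coset_eq: "a_r_coset B1 I x = a_r_coset B1 I y" if "x - y \<in> I" for x y
  proof -
    have "(\<lambda>h. h + x) ` I \<subseteq> (\<lambda>h. h + y) ` I" if "x - y \<in> I" for x y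
    proof
      fix z assume "z \<in> (\<lambda>h. h + x) ` I"
      then obtain h where h: "h \<in> I" "z = h + x" by blast
      then have "h + (x - y) \<in> I" "z = (h + (x - y)) + y" using ideal_B1D(3)[OF I(1)] that by auto
      then show "z \<in> (\<lambda>h. h + y) ` I" by blast
    qed
    from this[of x y] this[of y x] show ?thesis
      using that ideal_B1D(5)[OF I(1) that] unfolding a_r_coset_B1 by auto
  qed
  have "a_r_coset B1 I ?e \<otimes>\<^bsub>B1 Quot I\<^esub> a_r_coset B1 I ?e = a_r_coset B1 I (?e o\<^sub>L ?e)"
    using rcoset_mult_add[OF e e] by (simp add: FactRing_def)
  also have "\<dots> = a_r_coset B1 I ?e" by (rule coset_eq[OF d])
  finally have idem: "a_r_coset B1 I ?e \<otimes>\<^bsub>B1 Quot I\<^esub> a_r_coset B1 I ?e = a_r_coset B1 I ?e" .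
  have "a_r_coset B1 I ?e \<in> carrier (B1 Quot I)"
    using e by (auto simp: FactRing_def A_RCOSETS_def')
  then have "a_r_coset B1 I ?e = I \<or> a_r_coset B1 I ?e = a_r_coset B1 I id_blinfun"
    using triv idem unfolding only_trivial_idempotents_def by (auto simp: FactRing_def)
  then show False
  proof
    assume "a_r_coset B1 I ?e = I"
    moreover have "0 + ?e \<in> a_r_coset B1 I ?e" unfolding a_r_coset_B1 using ideal_B1D(2)[OF I(1)] by blast
    ultimately have "?e \<in> I" by simp
    then have "f x = 0" if "x \<in> hull_set I" for x using that f unfolding hull_set_def by blast
    moreover obtain x where "x \<in> B" "x \<in> hull_set I" using AB(4,5) by blast
    ultimately show False using fB[of x] by force
  next
    assume eq: "a_r_coset B1 I ?e = a_r_coset B1 I id_blinfun"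
    have "0 + ?e \<in> a_r_coset B1 I ?e" unfolding a_r_coset_B1 using ideal_B1D(2)[OF I(1)] by blast
    then have "?e \<in> a_r_coset B1 I id_blinfun" by (simp only: eq add_0_left)
    then obtain h where h: "h \<in> I" "?e = h + id_blinfun" unfolding a_r_coset_B1 by blast
    then have "h = ?e - mop (\<lambda>_. 1)" by (simp add: mop_one)
    then have "mop (\<lambda>x. f x - 1) \<in> I" using h(1) mop_diff[OF f continuous_on_const] by simp
    then have "f x - 1 = 0" if "x \<in> hull_set I" for x
      using that continuous_on_diff[OF f continuous_on_const] unfolding hull_set_def by blast
    moreover obtain x where "x \<in> A" "x \<in> hull_set I" using AB(3,5) by blast
    ultimately show False using fA[of x] by force
  qed
qed

lemma ideal_zero_if_hull_full:
  assumes "ideal I B1" "M1 \<subseteq> hull_set I" shows "I = {0}"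
proof -
  have "a = 0" if "a \<in> I" for a
  proof -
    obtain F where F: "a = mop F" "continuous_on M1 F" using ideal_B1D(1)[OF assms(1)] \<open>a \<in> I\<close> by blast
    then have "F x = 0" if "x \<in> M1" for x using assms(2) that \<open>a \<in> I\<close> by (auto simp: hull_set_def)
    then have "mop F = mop (\<lambda>_. 0)" by (rule mop_cong)
    then show ?thesis by (simp add: F(1) mop_zero)
  qed
  then show ?thesis using ideal_B1D(2)[OF assms(1)] by blast
qed

text \<open>At a point outside both hulls each ideal has a member that does not vanish there. Their
  product belongs to both ideals without being zero.\<close>

lemma hull_sets_cover:
  assumes I: "ideal I B1" "ideal J B1" "I \<inter> J = {0}" shows "hull_set I \<union> hull_set J = M1"
proof
  show "hull_set I \<union> hull_set J \<subseteq> M1" by (auto simp: hull_set_def)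
  show "M1 \<subseteq> hull_set I \<union> hull_set J"
  proof (rule ccontr)
    assume "\<not> M1 \<subseteq> hull_set I \<union> hull_set J"
    then obtain x F G where x: "x \<in> M1"
      and F: "continuous_on M1 F" "mop F \<in> I" "F x \<noteq> 0" and G: "continuous_on M1 G" "mop G \<in> J" "G x \<noteq> 0"
      by (auto simp: hull_set_def)
    have "mop (\<lambda>x. F x * G x) \<in> J" using ideal_B1D(4)[OF I(2) G(2) F(1)] by (simp add: mop_mult[OF F(1) G(1)])
    moreover have "mop (\<lambda>x. G x * F x) \<in> I" using ideal_B1D(4)[OF I(1) F(2) G(1)] by (simp add: mop_mult[OF G(1) F(1)])
    ultimately have "mop (\<lambda>x. F x * G x) = mop (\<lambda>_. 0)" using I(3) by (auto simp: mult.commute mop_zero)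
    then have "F x * G x = 0"
      using mop_inj[OF continuous_on_mult[OF F(1) G(1)] continuous_on_const _ x] by blast
    then show False using F(3) G(3) by simp
  qed
qed

lemma ideals_B1_irreducible:
  assumes I: "ideal I B1" "closed I" "only_trivial_idempotents (B1 Quot I)"
    and J: "ideal J B1" "closed J" "only_trivial_idempotents (B1 Quot J)" and "I \<inter> J = {0}"
  shows "I = {0} \<or> J = {0}"
proof (rule ccontr)
  assume "\<not> (I = {0} \<or> J = {0})"
  then have proper: "\<not> M1 \<subseteq> hull_set I" "\<not> M1 \<subseteq> hull_set J"
    using ideal_zero_if_hull_full I(1) J(1) by blast+
  have cover: "hull_set I \<union> hull_set J = M1" by (rule hull_sets_cover[OF I(1) J(1)]) fact
  have compact: "compact (hull_set K)" for K
    using compact_Int_closed[OF compact_M1 closed_hull_set, of K] by (simp add: hull_set_def Int_def)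
  \<comment> \<open>Neither hull is empty, since otherwise the other one would be all of
    \<open>M1\<close>.\<close>
  have "continuum (hull_set I)" "continuum (hull_set J)"
    unfolding continuum_def using compact connected_hull_set I J proper cover by auto
  then show False
    using irreducible_continuum_M1 cover proper unfolding irreducible_continuum_def by blast
qed

theorem theorem3p5:
  shows "M1 homeomorphic BJK \<and>
    delta1 \<in> star_iso B1 B1 \<and>
    (\<exists>\<beta>. homeomorphism M1 M1 alpha1_tilde \<beta>) \<and>
    (\<exists>\<Phi> \<in> star_iso B1 (C_alg M1).
       \<forall>b\<in>carrier B1. \<Phi> (delta1 b) = (\<lambda>x\<in>M1. \<Phi> b (alpha1_tilde x))) \<and>
    continuous_on {0..} rho \<and> bij_betw rho {0..} (composant M1 (\<lambda>n. 0)) \<and>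
    (\<forall>t\<ge>0. alpha1_tilde (rho t) = rho (g1 t)) \<and>
    irreducible_continuum M1 \<and>
    (\<forall>I\<^sub>1 I\<^sub>2. ideal I\<^sub>1 B1 \<longrightarrow> closed I\<^sub>1 \<longrightarrow> ideal I\<^sub>2 B1 \<longrightarrow> closed I\<^sub>2 \<longrightarrow>
       only_trivial_idempotents (B1 Quot I\<^sub>1) \<longrightarrow> only_trivial_idempotents (B1 Quot I\<^sub>2) \<longrightarrow>
       I\<^sub>1 \<inter> I\<^sub>2 = {0} \<longrightarrow> I\<^sub>1 = {0} \<or> I\<^sub>2 = {0})"
proof (intro conjI)
  show "\<exists>\<Phi> \<in> star_iso B1 (C_alg M1).
       \<forall>b\<in>carrier B1. \<Phi> (delta1 b) = (\<lambda>x\<in>M1. \<Phi> b (alpha1_tilde x))"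
    using gelfand_iso gelfand_delta1 by blast
  show "\<exists>\<beta>. homeomorphism M1 M1 alpha1_tilde \<beta>" using homeomorphism_alpha1_tilde by blast
  show "\<forall>I\<^sub>1 I\<^sub>2. ideal I\<^sub>1 B1 \<longrightarrow> closed I\<^sub>1 \<longrightarrow> ideal I\<^sub>2 B1 \<longrightarrow> closed I\<^sub>2 \<longrightarrow>
       only_trivial_idempotents (B1 Quot I\<^sub>1) \<longrightarrow> only_trivial_idempotents (B1 Quot I\<^sub>2) \<longrightarrow>
       I\<^sub>1 \<inter> I\<^sub>2 = {0} \<longrightarrow> I\<^sub>1 = {0} \<or> I\<^sub>2 = {0}"
    using ideals_B1_irreducible by blast
qed (use M1_homeomorphic_BJK delta1_iso continuous_on_rho bij_betw_rho alpha1_tilde_rho irreducible_continuum_M1 in auto)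

end
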